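(* (1) For every integer $1\le k\leq16$, every minimal splitting family on $k$ is uniform. (2) Among even $k\leq16$, there is, up to equivalence, just one minimal splitting family which is not equivalent to a standard splitting family, namely, for $k=8$, the family $$\mathcal F=\{\{1,2,3,4\},\{1,2,5,6\},\{3,4,5,6\},\{1,3,5,7\}\}.$$
   Context: Let $[k]=\{1,\dots,k\}$. For $A,B\subseteq[k]$, $A$ splits $B$ if $|A\cap B|=|B|/2$ when $|B|$ is even, and $|A\cap B|\in\{(|B|-1)/2,(|B|+1)/2\}$ when $|B|$ is odd. A collection $\mathcal A$ of subsets of $[k]$ is a splitting family on $k$ if every $B\subseteq[k]$ is split by some $A\in\mathcal A$. A splitting family on $k$ is minimal if it has the minimum possible number of sets among all splitting families on $k$ (this minimum is $\lceil k/2\rceil$). A splitting family $\mathcal A$ on $k$ is uniform if every $A\in\mathcal A$ has $|A|=\lfloor k/2\rfloor$ or $|A|=\lceil k/2\rceil$. Families $\mathcal A,\mathcal A'$ of subsets of $[k]$ are equivalent if $\mathcal A'$ can be obtained from $\mathcal A$ by replacing some of the sets of $\mathcal A$ by their complements in $[k]$ and permuting the elements of $[k]$. For even $k$, the standard splitting family on $k$ consists of the sets $A_i=\{i,i+1,\dots,i+k/2-1\}$ for $i=1,\dots,k/2$. *)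

theory Defs
  imports Main "HOL-Combinatorics.Permutations"
begin

definition splits :: "nat set \<Rightarrow> nat set \<Rightarrow> bool" where
  "splits A B \<longleftrightarrow>
     (if even (card B) then card (A \<inter> B) = card B div 2
      else card (A \<inter> B) \<in> {(card B - 1) div 2, (card B + 1) div 2})"

definition splitting_family :: "nat \<Rightarrow> nat set set \<Rightarrow> bool" where
  "splitting_family k \<A> \<longleftrightarrow>
     \<A> \<subseteq> Pow {1..k} \<and> (\<forall>B. B \<subseteq> {1..k} \<longrightarrow> (\<exists>A\<in>\<A>. splits A B))"

definition minimal_splitting_family :: "nat \<Rightarrow> nat set set \<Rightarrow> bool" where
  "minimal_splitting_family k \<A> \<longleftrightarrow>
     splitting_family k \<A> \<and> (\<forall>\<B>. splitting_family k \<B> \<longrightarrow> card \<A> \<le> card \<B>)"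

text \<open>Here \<open>(k + 1) div 2\<close> is the ceiling of \<open>k/2\<close>.\<close>

definition uniform_splitting_family :: "nat \<Rightarrow> nat set set \<Rightarrow> bool" where
  "uniform_splitting_family k \<A> \<longleftrightarrow>
     splitting_family k \<A> \<and> (\<forall>A\<in>\<A>. card A = k div 2 \<or> card A = (k + 1) div 2)"

text \<open>\<open>\<S>\<close> is the collection of members that are replaced by their complements in \<open>{1..k}\<close>.\<close>

definition equivalent_families :: "nat \<Rightarrow> nat set set \<Rightarrow> nat set set \<Rightarrow> bool" where
  "equivalent_families k \<A> \<A>' \<longleftrightarrow>
     (\<exists>\<S> \<pi>. \<S> \<subseteq> \<A> \<and> \<pi> permutes {1..k} \<and>
        \<A>' = image \<pi> ` ((\<A> - \<S>) \<union> (\<lambda>A. {1..k} - A) ` \<S>))"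

definition standard_splitting_family :: "nat \<Rightarrow> nat set set" where
  "standard_splitting_family k = (\<lambda>i. {i..i + k div 2 - 1}) ` {1..k div 2}"

definition exceptional_family :: "nat set set" where
  "exceptional_family = {{1, 2, 3, 4}, {1, 2, 5, 6}, {3, 4, 5, 6}, {1, 3, 5, 7}}"

end

theory Submission
  imports Defs "HOL-Library.Multiset"
begin

text \<open>An even set on which every parity \<open>|A \<inter> B|\<close> agrees has size \<open>2 |A \<inter> B|\<close> modulo 4 for any splitting
  member \<open>A\<close>, so these sets form a space on which pairwise intersections are even. Hence there are many
  disjoint pairs whose toggling controls the parities of the members independently, and an
  unbalanced member of a minimal family leaves enough freedom to produce an unsplit set.

  For \<open>k = 2 n\<close> a minimal family is therefore an \<open>n \<times> 2 n\<close> matrix of signs with vanishing row sums in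
  which the product of the row sums over any even set of columns is 0. As this product has
  degree \<open>n\<close>, it sums to 0 over the neighbours of any set of columns. If three columns form a
  chain, the second differing from the first only in row \<open>r\<close> and from the third only in row \<open>t\<close>, these
  identities give an antipode of the middle column and show that \<open>r\<close> and \<open>t\<close> agree up to sign outside the
  two columns. Deleting \<open>r\<close> and the two columns leaves a smaller matrix of the same kind, and
  reinserting them preserves the cyclic arrangement of the standard family.

  For \<open>2 \<le> n \<le> 8\<close> a chain exists except when \<open>n = 4\<close> and no two columns are antipodal: patterns
  of few columns are excluded one after the other by linear combinations of the
  neighbour identities and the row sums, found by linear programming. The
  exception is the family for \<open>k = 8\<close>, and it does not arise by deletion from \<open>n = 5\<close>.\<close>


text \<open>The splitting condition on a sign matrix is a disjunction, some row sum is 0, which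
  linear algebra cannot use directly. Multiplying the row sums turns it into equations, and each
  neighbour identity involves a chosen set of columns together with one further column at a time.
  Such an identity therefore sees a column outside a small pattern only through the number of rows
  of each kind in which it disagrees, so a search over matrices becomes a search over counts. A
  chain is what three consecutive columns of the standard cycle look like. Only the existence of a
  chain is settled by computation, separately for each n from 3 to 8, and this is where the bound k
  <= 16 enters. At n = 4 the computation cannot start from an arbitrary column, because the
  exceptional matrix contains no chain: three of its rows have a constant product, so a step that
  changes a single row must change the fourth one, whereas a chain has such steps in two different
  rows. There the search starts from an antipodal pair, and the matrices without such a pair are
  determined directly.\<close>

section \<open>Kernel sets and free pairs\<close>

text \<open>The kernel of the linear map that sends an even set to its vector of intersection
  parities modulo the all-ones vector. The common parity may be odd: comparing two toggled sets
  later determines the parities of their difference only up to a constant, given by half their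
  sizes.\<close>

definition kernel_sets :: "nat \<Rightarrow> nat set set \<Rightarrow> nat set set" where
  "kernel_sets k \<A> = {B. B \<subseteq> {1..k} \<and> even (card B) \<and> (\<exists>e. \<forall>A\<in>\<A>. even (card (A \<inter> B)) = e)}"

lemma card_sym_diff_add:
  assumes "finite X" "finite Y"
  shows "card (sym_diff X Y) + 2 * card (X \<inter> Y) = card X + card Y"
proof -
  have "card X = card (X - Y) + card (X \<inter> Y)" "card Y = card (Y - X) + card (X \<inter> Y)"
    using assms card_Diff_subset_Int[of X Y] card_Diff_subset_Int[of Y X]
      card_mono[OF assms(1), of "X \<inter> Y"] card_mono[OF assms(2), of "X \<inter> Y"]
    by (auto simp: Int_commute)
  moreover have "card (sym_diff X Y) = card (X - Y) + card (Y - X)"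
    using assms by (intro card_Un_disjoint) auto
  ultimately show ?thesis by simp
qed

lemma even_card_sym_diff:
  assumes "finite X" "finite Y"
  shows "even (card (sym_diff X Y)) \<longleftrightarrow> (even (card X) \<longleftrightarrow> even (card Y))"
  using arg_cong[OF card_sym_diff_add[OF assms], of even] by simp

lemma even_card_Int_sym_diff:
  assumes "finite X" "finite Y"
  shows "even (card (A \<inter> sym_diff X Y)) \<longleftrightarrow> (even (card (A \<inter> X)) \<longleftrightarrow> even (card (A \<inter> Y)))"
proof -
  have "A \<inter> sym_diff X Y = sym_diff (A \<inter> X) (A \<inter> Y)" by auto
  then show ?thesis using assms by (simp add: even_card_sym_diff)
qed

lemma splitting_family_splits_even:
  assumes "splitting_family k \<A>" "B \<subseteq> {1..k}" "even (card B)"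
  obtains A where "A \<in> \<A>" "2 * card (A \<inter> B) = card B"
  using assms by (auto simp: splitting_family_def splits_def split: if_splits)

text \<open>Some member splits B and so meets it in half its size; the common parity carries this
  over to every member.\<close>

lemma kernel_sets_parity:
  assumes "splitting_family k \<A>" "B \<in> kernel_sets k \<A>" "A \<in> \<A>"
  shows "even (card (A \<inter> B)) \<longleftrightarrow> even (card B div 2)"
proof -
  from assms obtain A' where "A' \<in> \<A>" "2 * card (A' \<inter> B) = card B"
    using splitting_family_splits_even[OF assms(1), of B] by (auto simp: kernel_sets_def)
  then have "card B div 2 = card (A' \<inter> B)" by linarith
  then have "even (card (A' \<inter> B)) = even (card B div 2)" by simp
  moreover have "even (card (A \<inter> B)) = even (card (A' \<inter> B))"
    using assms(2,3) \<open>A' \<in> \<A>\<close> by (auto simp: kernel_sets_def)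
  ultimately show ?thesis by simp
qed

text \<open>Modulo 4, the size of a kernel set is twice the parity of its intersection with any member,
  so half the size is additive modulo 2 under symmetric difference.\<close>

lemma kernel_sets_Int_even:
  assumes fam: "splitting_family k \<A>" and B: "B \<in> kernel_sets k \<A>" "B' \<in> kernel_sets k \<A>"
  shows "even (card (B \<inter> B'))"
proof -
  have fin: "finite B" "finite B'"
    using B finite_subset[of _ "{1..k}"] by (auto simp: kernel_sets_def)
  obtain A where A: "A \<in> \<A>"
    using splitting_family_splits_even[OF fam, of "{}"] by auto
  have D: "sym_diff B B' \<in> kernel_sets k \<A>"
    using B fin unfolding kernel_sets_def by (auto simp: even_card_sym_diff even_card_Int_sym_diff)
  have "even (card (sym_diff B B') div 2) \<longleftrightarrow> (even (card B div 2) \<longleftrightarrow> even (card B' div 2))"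
    using kernel_sets_parity[OF fam _ A] B D even_card_Int_sym_diff[OF fin, of A] by simp
  moreover have "even (card B)" "even (card B')" "even (card (sym_diff B B'))"
    using B D by (auto simp: kernel_sets_def)
  ultimately obtain x y z where xyz: "card B = 2 * x" "card B' = 2 * y" "card (sym_diff B B') = 2 * z"
    and "even z \<longleftrightarrow> (even x \<longleftrightarrow> even y)"
    by (metis evenE nonzero_mult_div_cancel_left zero_neq_numeral)
  then have "z + card (B \<inter> B') = x + y"
    using card_sym_diff_add[OF fin] unfolding xyz by simp
  then have "even z = even (card (B \<inter> B')) \<longleftrightarrow> (even x \<longleftrightarrow> even y)"
    by (metis even_add)
  with \<open>even z \<longleftrightarrow> (even x \<longleftrightarrow> even y)\<close> show ?thesis by blast
qed

text \<open>Linear independence modulo the kernel: the indicator vectors of the pairs have no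
  nonempty sum in it, disjointness turning the sum into a union.\<close>

definition free_pairs :: "nat \<Rightarrow> nat set set \<Rightarrow> nat set set \<Rightarrow> bool" where
  "free_pairs k \<A> P \<longleftrightarrow> finite P \<and> (\<forall>X\<in>P. X \<subseteq> {1..k} \<and> card X = 2) \<and> pairwise disjnt P \<and>
     (\<forall>U\<subseteq>P. U \<noteq> {} \<longrightarrow> \<Union>U \<notin> kernel_sets k \<A>)"

lemma card_Union_pairs:
  assumes "free_pairs k \<A> P" "U \<subseteq> P"
  shows "card (\<Union>U) = 2 * card U"
proof -
  have "card (\<Union>U) = sum card U"
  proof (rule card_Union_disjoint)
    show "pairwise disjnt U"
      using assms by (auto simp: free_pairs_def intro: pairwise_subset)
    show "finite X" if "X \<in> U" for X
      using assms that unfolding free_pairs_def by (metis card.infinite subsetD zero_neq_numeral)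
  qed
  also have "\<dots> = 2 * card U"
    using assms by (subst sum.cong[OF refl, of U card "\<lambda>_. 2"]) (auto simp: free_pairs_def)
  finally show ?thesis .
qed

lemma free_pairs_insert:
  assumes P: "free_pairs k \<A> P" and X: "X \<subseteq> {1..k}" "card X = 2" "X \<inter> \<Union>P = {}"
    and new: "\<And>U. U \<subseteq> P \<Longrightarrow> X \<union> \<Union>U \<notin> kernel_sets k \<A>"
  shows "free_pairs k \<A> (insert X P)"
  unfolding free_pairs_def
proof (intro conjI allI impI ballI)
  show "pairwise disjnt (insert X P)"
    using P X by (auto simp: free_pairs_def pairwise_insert disjnt_def)
  fix U assume U: "U \<subseteq> insert X P" "U \<noteq> {}"
  show "\<Union>U \<notin> kernel_sets k \<A>"
  proof (cases "X \<in> U")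
    case True
    then have "\<Union>U = X \<union> \<Union>(U - {X})" by auto
    then show ?thesis using new[of "U - {X}"] U by auto
  next
    case False
    then show ?thesis using U P unfolding free_pairs_def by blast
  qed
qed (use P X in \<open>auto simp: free_pairs_def\<close>)

text \<open>Greedy choice. While three points p, q, r are uncovered, {p, q} or {q, r} extends the
  family: if both, united with earlier pairs, gave kernel sets, these two would meet in q together
  with some whole pairs, an odd number of points. Three points do remain after t pairs because 2 (t
  + 1) < k.\<close>

lemma free_pairs_exist:
  assumes fam: "splitting_family k \<A>"
  shows "2 * t < k \<Longrightarrow> \<exists>P. free_pairs k \<A> P \<and> card P = t"
proof (induction t)
  case 0
  show ?case by (rule exI[of _ "{}"]) (simp add: free_pairs_def)
next
  case (Suc t)
  then obtain P where P: "free_pairs k \<A> P" "card P = t" by auto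
  have fin: "finite (\<Union>P)"
    using P by (intro finite_subset[of "\<Union>P" "{1..k}"]) (auto simp: free_pairs_def)
  have "card (\<Union>P) = 2 * t"
    using card_Union_pairs[OF P(1) order_refl] P(2) by simp
  moreover have "\<Union>P \<subseteq> {1..k}" using P by (auto simp: free_pairs_def)
  ultimately have "card ({1..k} - \<Union>P) = k - 2 * t"
    by (simp add: card_Diff_subset fin)
  with Suc.prems have "3 \<le> card ({1..k} - \<Union>P)" by simp
  then obtain W where W: "W \<subseteq> {1..k} - \<Union>P" "card W = 3"
    by (meson obtain_subset_with_card_n)
  then obtain p q r where pqr: "W = {p, q, r}" "p \<noteq> q" "q \<noteq> r" "p \<noteq> r"
    by (auto simp: card_3_iff)
  have out: "p \<notin> \<Union>P" "q \<notin> \<Union>P" "r \<notin> \<Union>P" "p \<in> {1..k}" "q \<in> {1..k}" "r \<in> {1..k}"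
    using W pqr by auto
  have "\<not> (U \<subseteq> P \<and> U' \<subseteq> P \<and> {p, q} \<union> \<Union>U \<in> kernel_sets k \<A> \<and> {q, r} \<union> \<Union>U' \<in> kernel_sets k \<A>)"
    for U U'
  proof
    assume a: "U \<subseteq> P \<and> U' \<subseteq> P \<and> {p, q} \<union> \<Union>U \<in> kernel_sets k \<A> \<and> {q, r} \<union> \<Union>U' \<in> kernel_sets k \<A>"
    have cap: "\<Union>U \<inter> \<Union>U' = \<Union>(U \<inter> U')"
    proof
      show "\<Union>U \<inter> \<Union>U' \<subseteq> \<Union>(U \<inter> U')"
      proof
        fix x assume "x \<in> \<Union>U \<inter> \<Union>U'"
        then obtain X Y where XY: "X \<in> U" "Y \<in> U'" "x \<in> X" "x \<in> Y" by auto
        have "pairwise disjnt P" using P(1) by (simp add: free_pairs_def)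
        moreover have "X \<in> P" "Y \<in> P" "\<not> disjnt X Y" using XY a by (auto simp: disjnt_def)
        ultimately have "X = Y" by (meson pairwiseD)
        with XY show "x \<in> \<Union>(U \<inter> U')" by auto
      qed
    qed auto
    have sub: "\<Union>U \<subseteq> \<Union>P" "\<Union>U' \<subseteq> \<Union>P" using a by auto
    have "({p, q} \<union> \<Union>U) \<inter> ({q, r} \<union> \<Union>U') = insert q (\<Union>U \<inter> \<Union>U')"
      using pqr out(1-3) sub by auto
    moreover note cap
    moreover have "q \<notin> \<Union>(U \<inter> U')" using out(2) sub by auto
    moreover have "finite (\<Union>(U \<inter> U'))"
      by (rule finite_subset[OF _ fin]) (use sub in auto)
    moreover have "card (\<Union>(U \<inter> U')) = 2 * card (U \<inter> U')"
      using a by (intro card_Union_pairs[OF P(1)]) auto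
    ultimately have "odd (card (({p, q} \<union> \<Union>U) \<inter> ({q, r} \<union> \<Union>U')))"
      by simp
    then show False using kernel_sets_Int_even[OF fam] a by blast
  qed
  then consider "\<And>U. U \<subseteq> P \<Longrightarrow> {p, q} \<union> \<Union>U \<notin> kernel_sets k \<A>"
    | "\<And>U. U \<subseteq> P \<Longrightarrow> {q, r} \<union> \<Union>U \<notin> kernel_sets k \<A>" by blast
  then obtain X where X: "X \<subseteq> {1..k}" "card X = 2" "X \<inter> \<Union>P = {}"
    "\<And>U. U \<subseteq> P \<Longrightarrow> X \<union> \<Union>U \<notin> kernel_sets k \<A>"
  proof cases
    case 1 with that[of "{p, q}"] pqr out show ?thesis by auto
  next
    case 2 with that[of "{q, r}"] pqr out show ?thesis by auto
  qed
  have "X \<notin> P" using X(2,3) by (cases "X = {}") auto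
  with free_pairs_insert[OF P(1) X] P show ?case
    by (intro exI[of _ "insert X P"]) (auto simp: free_pairs_def)
qed

section \<open>Excess and the balance of members\<close>

text \<open>For a finite even B, excess 0 says that A splits B. The form as a signed sum is the one
  that reappears as a row sum of the sign matrix.\<close>

definition excess :: "nat set \<Rightarrow> nat set \<Rightarrow> int" where
  "excess A B = (\<Sum>j\<in>B. if j \<in> A then 1 else - 1)"

lemma excess_eq:
  assumes "finite B"
  shows "excess A B = 2 * int (card (A \<inter> B)) - int (card B)"
proof -
  have "excess A B = (\<Sum>j\<in>B. 2 * (if j \<in> A then 1 else 0) - 1)"
    unfolding excess_def by (rule sum.cong) auto
  also have "\<dots> = 2 * int (card (A \<inter> B)) - int (card B)"
    using assms by (simp add: sum_subtractf flip: sum_distrib_left sum.inter_restrict)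
      (simp add: Int_commute)
  finally show ?thesis .
qed

lemma excess_Un_disjoint:
  "finite B \<Longrightarrow> finite B' \<Longrightarrow> B \<inter> B' = {} \<Longrightarrow> excess A (B \<union> B') = excess A B + excess A B'"
  unfolding excess_def by (rule sum.union_disjoint)

lemma excess_Int_Union:
  assumes "finite U" "\<And>X. X \<in> U \<Longrightarrow> finite X" "pairwise disjnt U"
  shows "excess A (B \<inter> \<Union>U) = (\<Sum>X\<in>U. excess A (B \<inter> X))"
  using assms
proof (induction U rule: finite_induct)
  case empty
  show ?case by (simp add: excess_def)
next
  case (insert X U)
  have "disjnt X Y" if "Y \<in> U" for Y
    using insert.prems(2) insert.hyps(2) that by (auto simp: pairwise_insert)
  then have "X \<inter> \<Union>U = {}" by (auto simp: disjnt_def)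
  then have "excess A ((B \<inter> X) \<union> (B \<inter> \<Union>U)) = excess A (B \<inter> X) + excess A (B \<inter> \<Union>U)"
    using insert.hyps(1) insert.prems(1) by (intro excess_Un_disjoint) auto
  moreover have "pairwise disjnt U" using insert.prems(2) by (simp add: pairwise_insert)
  ultimately show ?case
    using insert by (simp add: Int_Un_distrib)
qed

lemma excess_sym_diff:
  assumes "finite B" "finite B'"
  shows "excess A (sym_diff B B') = excess A B + excess A B' - 2 * excess A (B \<inter> B')"
proof -
  have *: "excess A X = excess A (X - Y) + excess A (X \<inter> Y)" if "finite X" for X Y
  proof -
    have "excess A ((X - Y) \<union> (X \<inter> Y)) = excess A (X - Y) + excess A (X \<inter> Y)"
      using that by (intro excess_Un_disjoint) auto
    moreover have "(X - Y) \<union> (X \<inter> Y) = X" by auto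
    ultimately show ?thesis by simp
  qed
  have "excess A (sym_diff B B') = excess A (B - B') + excess A (B' - B)"
    using assms by (intro excess_Un_disjoint) auto
  then show ?thesis
    using *[OF assms(1), of B'] *[OF assms(2), of B] by (simp add: Int_commute)
qed

lemma sym_diff_Union_sym_diff:
  assumes "pairwise disjnt P" "U \<subseteq> P" "U' \<subseteq> P"
  shows "sym_diff (sym_diff B (\<Union>U)) (sym_diff B (\<Union>U')) = \<Union>(sym_diff U U')"
proof -
  have eq: "X = Y" if "X \<in> P" "Y \<in> P" "x \<in> X" "x \<in> Y" for X Y x
    using assms(1) that by (auto simp: pairwise_def disjnt_def)
  have "x \<in> \<Union>(sym_diff U U') \<longleftrightarrow> x \<in> sym_diff (\<Union>U) (\<Union>U')" for x
  proof (cases "\<exists>X\<in>P. x \<in> X")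
    case True
    then obtain X where X: "X \<in> P" "x \<in> X" by blast
    have "x \<in> \<Union>V \<longleftrightarrow> X \<in> V" if "V \<subseteq> P" for V
      using that X eq[OF X(1) _ X(2)] by blast
    moreover have "sym_diff U U' \<subseteq> P" using assms by auto
    ultimately show ?thesis using assms(2,3) by simp
  next
    case False
    then show ?thesis using assms(2,3) by blast
  qed
  then have "\<Union>(sym_diff U U') = sym_diff (\<Union>U) (\<Union>U')" by (rule set_eqI)
  then show ?thesis by auto
qed

text \<open>Toggling the pairs of a free family realises every parity pattern on the members in
  \<open>\<R>\<close>, in particular the one in which no member of \<open>\<R>\<close> can split, while the members outside
  \<open>\<R>\<close> keep a nonzero excess.\<close>

lemma splitting_family_free_pairs_contra:
  assumes fam: "splitting_family k \<A>" and P: "free_pairs k \<A> P"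
    and R: "\<R> \<subseteq> \<A>" "card \<R> \<le> card P"
    and B: "B \<subseteq> {1..k}" "even (card B)"
    and rest: "\<And>A. A \<in> \<A> - \<R> \<Longrightarrow> excess A B \<noteq> 0"
    and const: "\<And>A X. A \<in> \<A> - \<R> \<Longrightarrow> X \<in> P \<Longrightarrow> excess A X = 2 * excess A (B \<inter> X)"
  shows False
proof -
  have \<A>: "\<A> \<subseteq> Pow {1..k}" using fam by (simp add: splitting_family_def)
  then have "finite \<A>" by (rule finite_subset) simp
  with R have finR: "finite \<R>" by (auto intro: finite_subset)
  have finP: "finite P" and disj: "pairwise disjnt P"
    using P by (auto simp: free_pairs_def)
  have finB: "finite B" by (rule finite_subset[OF B(1)]) simp
  have finX: "finite X" if "X \<in> P" for X
    using P that unfolding free_pairs_def by (metis card.infinite zero_neq_numeral)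
  define T where "T U = sym_diff B (\<Union>U)" for U
  have finT: "finite (T U)" and subT: "T U \<subseteq> {1..k}" if "U \<subseteq> P" for U
  proof -
    show "T U \<subseteq> {1..k}" using that P B unfolding T_def free_pairs_def by blast
    then show "finite (T U)" by (rule finite_subset) simp
  qed
  have evenT: "even (card (T U))" if "U \<subseteq> P" for U
  proof -
    have "finite (\<Union>U)" using that finP finX by (auto intro: finite_subset)
    then show ?thesis unfolding T_def
      using B(2) card_Union_pairs[OF P that] finB by (simp add: even_card_sym_diff)
  qed
  \<comment> \<open>By \<open>const\<close>, half of the signed weight of each pair lies inside B,
    so exchanging the inside part for the outside part changes nothing: toggling is invisible to the
    members outside \<open>\<R>\<close>.\<close>
  have exT: "excess A (T U) = excess A B" if A: "A \<in> \<A> - \<R>" and U: "U \<subseteq> P" for A U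
  proof -
    have disjU: "pairwise disjnt U" using disj U by (rule pairwise_subset)
    have finU: "finite U" using finP U by (rule rev_finite_subset)
    have "excess A (\<Union>U) = (\<Sum>X\<in>U. excess A X)"
      using excess_Int_Union[OF finU _ disjU, of A UNIV] U finX by auto
    also have "\<dots> = (\<Sum>X\<in>U. 2 * excess A (B \<inter> X))"
      using const[OF A] U by (intro sum.cong) auto
    also have "\<dots> = 2 * excess A (B \<inter> \<Union>U)"
      using U finX by (subst excess_Int_Union[OF finU _ disjU]) (auto simp: sum_distrib_left)
    finally have "excess A (\<Union>U) = 2 * excess A (B \<inter> \<Union>U)" .
    moreover have "finite (\<Union>U)" using finU U finX by auto
    ultimately show ?thesis unfolding T_def using finB by (simp add: excess_sym_diff)
  qed
  \<comment> \<open>Membership in \<open>v U\<close> excludes splitting of \<open>T U\<close>: a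
    member that splits it meets it in half its size, which makes the sum even.\<close>
  define v where "v U = {A \<in> \<R>. odd (card (A \<inter> T U) + card (T U) div 2)}" for U
  have "inj_on v (Pow P)"
  proof (rule inj_onI)
    fix U U' assume U: "U \<in> Pow P" "U' \<in> Pow P" and eq: "v U = v U'"
    have D: "sym_diff (T U) (T U') = \<Union>(sym_diff U U')"
      unfolding T_def using sym_diff_Union_sym_diff[OF disj] U by auto
    have "even (card (A \<inter> \<Union>(sym_diff U U'))) \<longleftrightarrow> (even (card (T U) div 2) \<longleftrightarrow> even (card (T U') div 2))"
      if A: "A \<in> \<A>" for A
    proof -
      have "even (card (A \<inter> T U) + card (T U) div 2) \<longleftrightarrow> even (card (A \<inter> T U') + card (T U') div 2)"
      proof (cases "A \<in> \<R>")
        case True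
        with eq show ?thesis unfolding v_def by blast
      next
        case False
        with A U exT[of A U] exT[of A U'] have "excess A (T U) = excess A (T U')" by simp
        then have "2 * int (card (A \<inter> T U)) - int (card (T U)) = 2 * int (card (A \<inter> T U')) - int (card (T U'))"
          using U finT by (simp add: excess_eq)
        moreover obtain x y where "card (T U) = 2 * x" "card (T U') = 2 * y"
          using evenT U by (meson PowD evenE)
        ultimately have "card (A \<inter> T U) + y = card (A \<inter> T U') + x" and
          "card (T U) div 2 = x" "card (T U') div 2 = y" by auto
        then show ?thesis by (metis even_add)
      qed
      then show ?thesis
        using even_card_Int_sym_diff[of "T U" "T U'" A] finT U unfolding D by auto
    qed
    moreover have "even (card (\<Union>(sym_diff U U')))"
      unfolding D[symmetric] using even_card_sym_diff[of "T U" "T U'"] finT evenT U by auto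
    moreover have "\<Union>(sym_diff U U') \<subseteq> {1..k}"
      unfolding D[symmetric] using subT U by blast
    ultimately have "\<Union>(sym_diff U U') \<in> kernel_sets k \<A>" by (auto simp: kernel_sets_def)
    moreover have "sym_diff U U' \<subseteq> P" using U by auto
    ultimately have "sym_diff U U' = {}" using P unfolding free_pairs_def by blast
    then show "U = U'" by auto
  qed
  \<comment> \<open>An injection from the subsets of P into those of \<open>\<R>\<close>, of which
    there are no more, is onto; so some U prevents every member of \<open>\<R>\<close> from
    splitting.\<close>
  then have "card (v ` Pow P) = 2 ^ card P" using finP by (simp add: card_image card_Pow)
  moreover have sub: "v ` Pow P \<subseteq> Pow \<R>" by (auto simp: v_def)
  moreover have "card (Pow \<R>) = 2 ^ card \<R>" "finite (Pow \<R>)"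
    using finR by (simp_all add: card_Pow)
  moreover have "(2::nat) ^ card \<R> \<le> 2 ^ card P" using R(2) by simp
  ultimately have "card (v ` Pow P) = card (Pow \<R>)"
    using card_mono[of "Pow \<R>" "v ` Pow P"] by linarith
  then have "v ` Pow P = Pow \<R>"
    using sub \<open>finite (Pow \<R>)\<close> by (intro card_subset_eq)
  then obtain U where U: "U \<subseteq> P" "v U = \<R>" by (metis PowD Pow_top imageE)
  obtain A where A: "A \<in> \<A>" "2 * card (A \<inter> T U) = card (T U)"
    using splitting_family_splits_even[OF fam subT[OF U(1)] evenT[OF U(1)]] .
  show False
  proof (cases "A \<in> \<R>")
    case True
    with U(2) have "odd (card (A \<inter> T U) + card (T U) div 2)" unfolding v_def by blast
    then show False unfolding A(2)[symmetric] by simp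
  next
    case False
    then have "A \<in> \<A> - \<R>" using A(1) by simp
    then have "excess A (T U) \<noteq> 0" using exT[OF _ U(1)] rest by metis
    then show False using A(2) finT[OF U(1)] by (simp add: excess_eq)
  qed
qed

text \<open>With more than twice as many points as members there are as many free pairs as members;
  toggling them from the empty set, with every member in \<open>\<R>\<close>, yields an even set
  that no member splits.\<close>

lemma splitting_family_card_ge:
  assumes fam: "splitting_family k \<A>"
  shows "k \<le> 2 * card \<A>"
proof (rule ccontr)
  assume "\<not> k \<le> 2 * card \<A>"
  then obtain P where "free_pairs k \<A> P" "card P = card \<A>"
    using free_pairs_exist[OF fam, of "card \<A>"] by auto
  then show False
    using splitting_family_free_pairs_contra[OF fam, of P \<A> "{}"] by auto
qed

text \<open>One free pair fewer than members is available. Toggling blocks all members but A, and A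
  is kept from splitting by starting from a set B with nonzero excess that toggling preserves. Such
  a B exists as soon as A is unbalanced by at least 2.\<close>

lemma splitting_family_excess_bound:
  assumes fam: "splitting_family k \<A>" and card: "2 * card \<A> \<le> Suc k"
    and A: "A \<in> \<A>"
  shows "\<bar>excess A {1..k}\<bar> \<le> 1"
proof (rule ccontr)
  assume big: "\<not> \<bar>excess A {1..k}\<bar> \<le> 1"
  define n where "n = card \<A>"
  have sub\<A>: "\<A> \<subseteq> Pow {1..k}" using fam by (simp add: splitting_family_def)
  then have fin\<A>: "finite \<A>" by (rule finite_subset) simp
  with A have n: "n \<ge> 1" unfolding n_def by (metis One_nat_def Suc_leI card_gt_0_iff empty_iff)
  have kn: "k \<le> 2 * n" "2 * n \<le> Suc k"
    using card splitting_family_card_ge[OF fam] by (auto simp: n_def)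
  have "2 * (n - 1) < k" using n kn by linarith
  then obtain P where P: "free_pairs k \<A> P" and cardP: "card P = n - 1"
    using free_pairs_exist[OF fam] by blast
  have finP: "finite P" and disj: "pairwise disjnt P" and P2: "\<And>X. X \<in> P \<Longrightarrow> card X = 2"
    and subP: "\<Union>P \<subseteq> {1..k}"
    using P by (auto simp: free_pairs_def)
  have finX: "finite X" if "X \<in> P" for X using P2[OF that] by (metis card.infinite zero_neq_numeral)
  have finUP: "finite (\<Union>P)" using finP finX by auto
  define L where "L = {1..k} - \<Union>P"
  have cardUP: "card (\<Union>P) = 2 * (n - 1)"
    using card_Union_pairs[OF P order_refl] cardP by simp
  have cardL: "card L = k - 2 * (n - 1)"
    unfolding L_def using finUP subP by (simp add: card_Diff_subset cardUP)
  have finL: "finite L" by (simp add: L_def)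
  define sg where "sg j = (if j \<in> A then 1 else - 1 :: int)" for j
  \<comment> \<open>To satisfy \<open>const\<close>, B will take one point from each pair on which A
    has excess 2 or -2 and none from a pair of excess 0.\<close>
  define S where "S = {X \<in> P. excess A X \<noteq> 0}"
  have sel: "\<exists>p\<in>X. excess A X = 2 * sg p" if "X \<in> S" for X
  proof -
    from that have "card X = 2" "excess A X \<noteq> 0" using P2 by (auto simp: S_def)
    then obtain p q where "X = {p, q}" "p \<noteq> q" by (auto simp: card_2_iff)
    with \<open>excess A X \<noteq> 0\<close> show ?thesis by (auto simp: excess_def sg_def split: if_splits)
  qed
  then obtain f where f: "\<And>X. X \<in> S \<Longrightarrow> f X \<in> X" "\<And>X. X \<in> S \<Longrightarrow> excess A X = 2 * sg (f X)"
    by metis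
  have SP: "S \<subseteq> P" by (auto simp: S_def)
  have finS: "finite S" using SP finP by (rule finite_subset)
  have eqX: "X = Y" if "X \<in> P" "Y \<in> P" "x \<in> X" "x \<in> Y" for X Y x
    using disj that by (auto simp: pairwise_def disjnt_def)
  have injf: "inj_on f S"
    using eqX SP f(1) by (intro inj_onI) (metis subsetD)
  have fX: "f ` S \<inter> X = (if X \<in> S then {f X} else {})" if "X \<in> P" for X
    using eqX[OF _ that] SP f(1) that by auto
  have fL: "f ` S \<inter> L = {}" using f(1) SP by (auto simp: L_def)
  have tot: "excess A {1..k} = 2 * excess A (f ` S) + excess A L"
  proof -
    have "excess A (\<Union>P) = (\<Sum>X\<in>P. excess A X)"
      using excess_Int_Union[OF finP finX disj, of A UNIV] by simp
    also have "\<dots> = (\<Sum>X\<in>S. excess A X)"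
      using finP by (intro sum.mono_neutral_right) (auto simp: S_def)
    also have "\<dots> = (\<Sum>X\<in>S. 2 * sg (f X))" using f(2) by simp
    also have "\<dots> = 2 * excess A (f ` S)"
      using injf by (simp add: excess_def sg_def sum.reindex sum_distrib_left)
    finally have "excess A (\<Union>P) = 2 * excess A (f ` S)" .
    moreover have "excess A (\<Union>P \<union> L) = excess A (\<Union>P) + excess A L"
      using finUP finL by (intro excess_Un_disjoint) (auto simp: L_def)
    moreover have "\<Union>P \<union> L = {1..k}" using subP by (auto simp: L_def)
    ultimately show ?thesis by simp
  qed
  \<comment> \<open>The total excess of A is the sum of the excesses of B for two choices of Z that
    complement each other in L. If |L| = 2, both choices have the same parity and one of them has
    nonzero excess. If |L| = 1, parity dictates the choice; the two excesses differ by 1 and their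
    sum has absolute value at least 2, so neither is 0.\<close>
  have "\<exists>Z\<subseteq>L. even (card S + card Z) \<and> excess A (f ` S) + excess A Z \<noteq> 0"
  proof -
    have "card L = 1 \<or> card L = 2" using cardL kn n by linarith
    then consider r where "L = {r}" | r r' where "L = {r, r'}" "r \<noteq> r'"
      by (auto simp: card_1_singleton_iff card_2_iff)
    then show ?thesis
    proof cases
      case 1
      have "excess A {1..k} = 2 * excess A (f ` S) + sg r" using tot 1 by (simp add: excess_def sg_def)
      moreover have "\<bar>sg r\<bar> = 1" by (simp add: sg_def)
      ultimately have *: "excess A (f ` S) \<noteq> 0 \<and> excess A (f ` S) + sg r \<noteq> 0"
        using big by linarith
      show ?thesis
      proof (cases "even (card S)")
        case True
        with * show ?thesis by (intro exI[of _ "{}"]) (simp add: excess_def)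
      next
        case False
        with * 1 show ?thesis by (intro exI[of _ "{r}"]) (simp add: excess_def sg_def)
      qed
    next
      case 2
      with tot have t: "excess A {1..k} = 2 * excess A (f ` S) + sg r + sg r'"
        by (simp add: excess_def sg_def)
      show ?thesis
      proof (cases "even (card S)")
        case True
        from t big have "excess A (f ` S) \<noteq> 0 \<or> excess A (f ` S) + (sg r + sg r') \<noteq> 0"
          by linarith
        then show ?thesis
        proof
          assume "excess A (f ` S) \<noteq> 0"
          with True show ?thesis by (intro exI[of _ "{}"]) (simp add: excess_def)
        next
          assume "excess A (f ` S) + (sg r + sg r') \<noteq> 0"
          with True 2 show ?thesis by (intro exI[of _ L]) (simp add: excess_def sg_def)
        qed
      next
        case False
        from t big have "excess A (f ` S) + sg r \<noteq> 0 \<or> excess A (f ` S) + sg r' \<noteq> 0"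
          by linarith
        then show ?thesis
        proof
          assume "excess A (f ` S) + sg r \<noteq> 0"
          with False 2 show ?thesis by (intro exI[of _ "{r}"]) (simp add: excess_def sg_def)
        next
          assume "excess A (f ` S) + sg r' \<noteq> 0"
          with False 2 show ?thesis by (intro exI[of _ "{r'}"]) (simp add: excess_def sg_def)
        qed
      qed
    qed
  qed
  then obtain Z where Z: "Z \<subseteq> L" "even (card S + card Z)" "excess A (f ` S) + excess A Z \<noteq> 0"
    by blast
  have finZ: "finite Z" using Z(1) finL by (rule finite_subset)
  have fZ: "f ` S \<inter> Z = {}" using Z(1) fL by auto
  define B where "B = f ` S \<union> Z"
  show False
  proof (rule splitting_family_free_pairs_contra[OF fam P, of "\<A> - {A}" B])
    show "card (\<A> - {A}) \<le> card P" using A fin\<A> cardP by (simp add: n_def)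
    have "f ` S \<subseteq> \<Union>P" using f(1) SP by auto
    then show "B \<subseteq> {1..k}" using Z(1) subP unfolding B_def L_def by blast
    show "even (card B)"
      unfolding B_def using finS finZ fZ Z(2) injf by (simp add: card_Un_disjoint card_image)
  next
    fix A' assume "A' \<in> \<A> - (\<A> - {A})"
    then have A': "A' = A" by auto
    show "excess A' B \<noteq> 0"
      unfolding A' B_def using finS finZ fZ Z(3) by (simp add: excess_Un_disjoint)
    fix X assume X: "X \<in> P"
    have "B \<inter> X = f ` S \<inter> X" using Z(1) X by (auto simp: B_def L_def)
    then show "excess A' X = 2 * excess A' (B \<inter> X)"
      unfolding A' using fX[OF X] f(2)[of X] X by (auto simp: S_def excess_def sg_def split: if_splits)
  qed auto
qed

lemma splitting_family_uniform:
  assumes fam: "splitting_family k \<A>" and card: "2 * card \<A> \<le> Suc k"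
  shows "uniform_splitting_family k \<A>"
  unfolding uniform_splitting_family_def
proof (intro conjI ballI fam)
  fix A assume A: "A \<in> \<A>"
  then have "A \<subseteq> {1..k}" using fam by (auto simp: splitting_family_def)
  then have "A \<inter> {1..k} = A" by auto
  with splitting_family_excess_bound[OF fam card A] have "\<bar>2 * int (card A) - int k\<bar> \<le> 1"
    by (simp add: excess_eq)
  then have "2 * card A \<le> k + 1" "k \<le> 2 * card A + 1" by linarith+
  then show "card A = k div 2 \<or> card A = (k + 1) div 2" by presburger
qed

section \<open>The standard family and the minimum size\<close>

lemma splits_iff:
  "splits A B \<longleftrightarrow> card (A \<inter> B) = card B div 2 \<or> card (A \<inter> B) = card B - card B div 2"
  unfolding splits_def by (cases "even (card B)") (auto elim!: evenE oddE)

text \<open>A discrete intermediate value argument for a sliding window of length k/2: the count of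
  B in the window changes by at most 1 per step, and the first and last windows are complementary,
  so their counts lie on both sides of half of |B|.\<close>

lemma splitting_family_standard:
  assumes "even k" "k > 0"
  shows "splitting_family k (standard_splitting_family k)"
proof -
  obtain n where k: "k = 2 * n" and n: "n > 0" using assms by (auto elim!: evenE)
  have "\<exists>A\<in>standard_splitting_family k. splits A B" if B: "B \<subseteq> {1..k}" for B
  proof -
    have fin: "finite B" by (rule finite_subset[OF B]) simp
    define g where "g i = card ({i+1..i+n} \<inter> B)" for i
    have mem: "{i+1..i+n} \<in> standard_splitting_family k" if "i < n" for i
      unfolding standard_splitting_family_def using that k n by (intro image_eqI[of _ _ "i + 1"]) auto
    have sum: "g 0 + g n = card B"
    proof -
      have "card (({1..n} \<inter> B) \<union> ({n+1..n+n} \<inter> B)) = g 0 + g n"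
        unfolding g_def by (subst card_Un_disjoint) auto
      moreover have "({1..n} \<inter> B) \<union> ({n+1..n+n} \<inter> B) = B" using B k by auto
      ultimately show ?thesis by simp
    qed
    have step: "\<bar>int (g (i + 1)) - int (g i)\<bar> \<le> 1" for i
    proof -
      define X where "X = {i+2..i+n} \<inter> B"
      have X: "finite X" by (simp add: X_def)
      have "g i = card (({i+1} \<inter> B) \<union> X)" "g (i + 1) = card (({i+1+n} \<inter> B) \<union> X)"
        unfolding g_def X_def using n by (auto intro!: arg_cong[of _ _ card])
      moreover have "card X \<le> card (({j} \<inter> B) \<union> X) \<and> card (({j} \<inter> B) \<union> X) \<le> card X + 1" for j
        using X card_insert_le[of X j] card_insert_if[OF X, of j] by (cases "j \<in> B") auto
      ultimately show ?thesis by (smt (verit, best) of_nat_1 of_nat_add of_nat_le_iff)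
    qed
    have "\<exists>i\<le>n. g i = card B div 2"
    proof (cases "g 0 \<le> card B div 2")
      case True
      then have "\<exists>i\<le>n. int (g i) = int (card B div 2)"
        using sum step by (intro nat0_intermed_int_val) auto
      then show ?thesis by simp
    next
      case False
      then have "\<exists>i\<le>n. - int (g i) = - int (card B div 2)"
        using sum step by (intro nat0_intermed_int_val) (auto simp: abs_minus_commute)
      then show ?thesis by simp
    qed
    then obtain i where i: "i \<le> n" "g i = card B div 2" by blast
    show ?thesis
    proof (cases "i = n")
      \<comment> \<open>The last window is not a member, but its complement, the first window, then
        contains the rounded-up half of B.\<close>
      case True
      with i sum have "g 0 = card B - card B div 2" by simp
      with mem[of 0] n show ?thesis by (intro bexI[OF _ mem[of 0]]) (simp_all add: splits_iff g_def)
    next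
      case False
      with i show ?thesis by (intro bexI[OF _ mem[of i]]) (simp_all add: splits_iff g_def)
    qed
  qed
  moreover have "standard_splitting_family k \<subseteq> Pow {1..k}"
    by (auto simp: standard_splitting_family_def k)
  ultimately show ?thesis by (simp add: splitting_family_def)
qed

lemma card_standard_splitting_family_le: "card (standard_splitting_family k) \<le> k div 2"
  unfolding standard_splitting_family_def by (rule order_trans[OF card_image_le]) auto

text \<open>Gives the upper bound on the minimum for odd k from the standard family on k +
  1.\<close>

lemma splitting_family_restrict:
  assumes "splitting_family (Suc k) \<A>"
  shows "splitting_family k ((\<lambda>A. A \<inter> {1..k}) ` \<A>)"
  unfolding splitting_family_def
proof (intro conjI allI impI)
  fix B assume B: "B \<subseteq> {1..k}"
  then have "B \<subseteq> {1..Suc k}" by auto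
  then obtain A where A: "A \<in> \<A>" "splits A B"
    using assms unfolding splitting_family_def by blast
  have "A \<inter> {1..k} \<inter> B = A \<inter> B" using B by auto
  with A(2) have "splits (A \<inter> {1..k}) B" by (simp only: splits_def)
  with A(1) show "\<exists>A\<in>(\<lambda>A. A \<inter> {1..k}) ` \<A>. splits A B" by blast
qed auto

lemma minimal_splitting_family_card:
  assumes "minimal_splitting_family k \<A>" "k > 0"
  shows "card \<A> = (k + 1) div 2"
proof -
  have "\<exists>\<B>. splitting_family k \<B> \<and> card \<B> \<le> (k + 1) div 2"
  proof (cases "even k")
    case True
    then show ?thesis
      using splitting_family_standard[of k] card_standard_splitting_family_le[of k] assms(2) by auto
  next
    case False
    have "card ((\<lambda>A. A \<inter> {1..k}) ` standard_splitting_family (Suc k)) \<le> card (standard_splitting_family (Suc k))"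
      by (rule card_image_le) (simp add: standard_splitting_family_def)
    with False show ?thesis
      using splitting_family_restrict[OF splitting_family_standard[of "Suc k"]]
        card_standard_splitting_family_le[of "Suc k"]
      by (intro exI[of _ "(\<lambda>A. A \<inter> {1..k}) ` standard_splitting_family (Suc k)"] conjI) auto
  qed
  with assms have "card \<A> \<le> (k + 1) div 2"
    unfolding minimal_splitting_family_def by (meson order_trans)
  moreover have "k \<le> 2 * card \<A>"
    using assms by (intro splitting_family_card_ge) (simp add: minimal_splitting_family_def)
  ultimately show ?thesis by linarith
qed

lemma minimal_splitting_family_uniform:
  assumes "minimal_splitting_family k \<A>" "k > 0"
  shows "uniform_splitting_family k \<A>"
  using minimal_splitting_family_card[OF assms] assms
  by (intro splitting_family_uniform) (auto simp: minimal_splitting_family_def)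

section \<open>Sign matrices\<close>

text \<open>The Walsh character with index S, evaluated at B.\<close>

definition parity_sign :: "'c set \<Rightarrow> 'c set \<Rightarrow> int" where
  "parity_sign S B = (if even (card (S \<inter> B)) then 1 else - 1)"

lemma parity_sign_commute: "parity_sign S B = parity_sign B S"
  by (simp add: parity_sign_def Int_commute)

lemma parity_sign_sym_diff:
  assumes "finite B" "finite B'"
  shows "parity_sign S (sym_diff B B') = parity_sign S B * parity_sign S B'"
  using even_card_Int_sym_diff[OF assms, of S] by (auto simp: parity_sign_def)

text \<open>As a function of the indicator of B the product is a polynomial of degree at most
  \<open>card R\<close>, so it is orthogonal to all characters of larger index. In the induction the
  new linear factor is rewritten by 2 [j in B] = 1 - \<open>parity_sign {j} B\<close>, which changes
  the index S in one point and lowers its size by at most 1.\<close>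

lemma sum_prod_parity_sign:
  fixes a :: "'r \<Rightarrow> 'c \<Rightarrow> int"
  assumes "finite R" "finite C" "S \<subseteq> C" "card R < card S"
  shows "(\<Sum>B\<in>Pow C. parity_sign S B * (\<Prod>i\<in>R. \<Sum>j\<in>B. a i j)) = 0"
  using assms(1,3,4)
proof (induction R arbitrary: S rule: finite_induct)
  case empty
  then have "S \<noteq> {}" by auto
  then obtain s where s: "s \<in> S" by blast
  have finC: "finite B" if "B \<in> Pow C" for B
    using that \<open>finite C\<close> by (auto intro: finite_subset)
  have "(\<Sum>B\<in>Pow C. parity_sign S B) = (\<Sum>B\<in>Pow C. parity_sign S (sym_diff B {s}))"
  proof (rule sum.reindex_bij_witness[of _ "\<lambda>B. sym_diff B {s}" "\<lambda>B. sym_diff B {s}"])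
    fix B assume "B \<in> Pow C"
    then show "sym_diff B {s} \<in> Pow C" "sym_diff B {s} \<in> Pow C" using s empty.prems by auto
    show inv: "sym_diff (sym_diff B {s}) {s} = B" "sym_diff (sym_diff B {s}) {s} = B" by auto
    show "parity_sign S (sym_diff (sym_diff B {s}) {s}) = parity_sign S B" by (simp only: inv)
  qed
  also have "\<dots> = (\<Sum>B\<in>Pow C. - parity_sign S B)"
  proof (intro sum.cong refl)
    fix B assume "B \<in> Pow C"
    moreover have "parity_sign S {s} = - 1" using s by (simp add: parity_sign_def)
    ultimately show "parity_sign S (sym_diff B {s}) = - parity_sign S B"
      using parity_sign_sym_diff[of B "{s}" S] finC by simp
  qed
  finally show ?case by (simp add: sum_negf)
next
  case (insert r R)
  have finS: "finite S" using insert.prems(1) \<open>finite C\<close> by (rule finite_subset)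
  define P where "P B = (\<Prod>i\<in>R. \<Sum>j\<in>B. a i j)" for B
  have P0: "(\<Sum>B\<in>Pow C. parity_sign S' B * P B) = 0" if "S' \<subseteq> C" "card R < card S'" for S'
    unfolding P_def by (rule insert.IH) (use that in auto)
  have "2 * (\<Sum>B\<in>Pow C. parity_sign S B * ((\<Sum>j\<in>B. a r j) * P B)) =
      (\<Sum>B\<in>Pow C. \<Sum>j\<in>C. a r j * (parity_sign S B * P B - parity_sign (sym_diff S {j}) B * P B))"
    unfolding sum_distrib_left
  proof (intro sum.cong refl)
    fix B assume B: "B \<in> Pow C"
    have "(\<Sum>j\<in>C. a r j * (parity_sign S B * P B - parity_sign (sym_diff S {j}) B * P B)) =
        (\<Sum>j\<in>C. if j \<in> B then 2 * parity_sign S B * P B * a r j else 0)"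
    proof (intro sum.cong refl)
      fix j
      have "parity_sign (sym_diff S {j}) B = parity_sign S B * (if j \<in> B then - 1 else 1)"
        using parity_sign_sym_diff[OF finS, of "{j}" B]
        by (simp add: parity_sign_commute[of _ B]) (simp add: parity_sign_def)
      then show "a r j * (parity_sign S B * P B - parity_sign (sym_diff S {j}) B * P B) =
          (if j \<in> B then 2 * parity_sign S B * P B * a r j else 0)"
        by (simp add: algebra_simps)
    qed
    also have "\<dots> = (\<Sum>j\<in>B. 2 * parity_sign S B * P B * a r j)"
      using B \<open>finite C\<close> by (subst sum.inter_restrict[symmetric]) (auto simp: Int_absorb1)
    finally show "2 * (parity_sign S B * ((\<Sum>j\<in>B. a r j) * P B)) =
        (\<Sum>j\<in>C. a r j * (parity_sign S B * P B - parity_sign (sym_diff S {j}) B * P B))"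
      by (simp add: sum_distrib_left sum_distrib_right mult_ac)
  qed
  also have "\<dots> = (\<Sum>j\<in>C. a r j * ((\<Sum>B\<in>Pow C. parity_sign S B * P B) -
      (\<Sum>B\<in>Pow C. parity_sign (sym_diff S {j}) B * P B)))"
    by (subst sum.swap) (simp only: sum_distrib_left[symmetric] sum_subtractf)
  also have "\<dots> = 0"
  proof (intro sum.neutral ballI)
    fix j assume j: "j \<in> C"
    have "card S \<le> card (sym_diff S {j}) + 1"
      using finS card_sym_diff_add[of S "{j}"] card_mono[of "{j}" "S \<inter> {j}"] by simp
    then have "card R < card (sym_diff S {j})" using insert by simp
    moreover have "sym_diff S {j} \<subseteq> C" using insert.prems j by auto
    ultimately show "a r j * ((\<Sum>B\<in>Pow C. parity_sign S B * P B) -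
        (\<Sum>B\<in>Pow C. parity_sign (sym_diff S {j}) B * P B)) = 0"
      using P0[of S] P0[of "sym_diff S {j}"] insert by simp
  qed
  finally show ?case using insert.hyps by (simp add: P_def)
qed

text \<open>Writing \<open>F\<close> for the product below, the Fourier coefficients of \<open>F\<close> vanish on sets of
  size above \<open>card R\<close> because of the degree, hence also on sets of size below \<open>card R\<close>, because
  \<open>F\<close> vanishes on all sets of even size. The sum over the neighbours of a vertex of the cube
  annihilates the remaining middle level.\<close>

lemma sum_neighbours_eq_0:
  fixes a :: "'r \<Rightarrow> 'c \<Rightarrow> int"
  assumes fin: "finite R" "finite C" and card: "card C = 2 * card R"
    and zero: "\<And>B. B \<subseteq> C \<Longrightarrow> even (card B) \<Longrightarrow> (\<Prod>i\<in>R. \<Sum>j\<in>B. a i j) = 0"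
    and D: "D \<subseteq> C"
  shows "(\<Sum>c\<in>C. \<Prod>i\<in>R. \<Sum>j\<in>sym_diff D {c}. a i j) = 0"
proof -
  define F where "F B = (\<Prod>i\<in>R. \<Sum>j\<in>B. a i j)" for B
  have finB: "finite B" if "B \<subseteq> C" for B using that fin(2) by (rule finite_subset)
  have high: "(\<Sum>B\<in>Pow C. parity_sign S B * F B) = 0" if "S \<subseteq> C" "card R < card S" for S
    unfolding F_def using fin that by (rule sum_prod_parity_sign)
  have low: "(\<Sum>B\<in>Pow C. parity_sign S B * F B) = 0" if S: "S \<subseteq> C" "card S < card R" for S
  proof -
    have "(\<Sum>B\<in>Pow C. parity_sign S B * F B) = (\<Sum>B\<in>Pow C. - (parity_sign (C - S) B * F B))"
    proof (intro sum.cong refl)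
      fix B assume B: "B \<in> Pow C"
      show "parity_sign S B * F B = - (parity_sign (C - S) B * F B)"
      proof (cases "even (card B)")
        case True
        then show ?thesis using zero B by (simp add: F_def)
      next
        case False
        have "card ((S \<inter> B) \<union> ((C - S) \<inter> B)) = card (S \<inter> B) + card ((C - S) \<inter> B)"
          using finB[of B] B by (intro card_Un_disjoint) auto
        moreover have "(S \<inter> B) \<union> ((C - S) \<inter> B) = B" using B by auto
        ultimately have "odd (card (S \<inter> B) + card ((C - S) \<inter> B))" using False by simp
        then show ?thesis by (auto simp: parity_sign_def)
      qed
    qed
    also have "\<dots> = 0"
      using high[of "C - S"] S card finB[OF S(1)] by (simp add: sum_negf card_Diff_subset)
    finally show ?thesis .
  qed
  have orth: "(\<Sum>S\<in>Pow C. parity_sign S E) = (if E = {} then 2 ^ card C else 0)" if "E \<subseteq> C" for E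
    using sum_prod_parity_sign[of "{}" C E] that fin(2) finB[OF that]
    by (simp add: parity_sign_commute[of _ E] card_gt_0_iff)
      (simp add: parity_sign_def card_Pow)
  have level: "(\<Sum>c\<in>C. parity_sign S {c}) = int (card C) - 2 * int (card S)" if "S \<subseteq> C" for S
  proof -
    have "(\<Sum>c\<in>C. parity_sign S {c}) = (\<Sum>c\<in>C. 1 - 2 * (if c \<in> S then 1 else 0))"
      by (intro sum.cong refl) (simp add: parity_sign_def)
    also have "\<dots> = int (card C) - 2 * (\<Sum>c\<in>C. if c \<in> S then 1 else 0)"
      by (simp add: sum_subtractf sum_distrib_left)
    also have "(\<Sum>c\<in>C. if c \<in> S then 1 else 0) = int (card S)"
      using that fin(2) by (simp add: Int_absorb1 flip: sum.inter_restrict)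
    finally show ?thesis .
  qed
  \<comment> \<open>Fourier inversion: the inner character sum is the indicator of
    \<open>B = sym_diff D {c}\<close>, up to the factor \<open>2 ^ card C\<close>. Carrying out the
    sum over c then leaves the factor |C| - 2 |S| on the coefficient of index S.\<close>
  have "2 ^ card C * (\<Sum>c\<in>C. F (sym_diff D {c})) =
      (\<Sum>c\<in>C. \<Sum>B\<in>Pow C. F B * (\<Sum>S\<in>Pow C. parity_sign S (sym_diff B (sym_diff D {c}))))"
  proof (subst sum_distrib_left, intro sum.cong refl)
    fix c assume c: "c \<in> C"
    have Dc: "sym_diff D {c} \<in> Pow C" using D c by auto
    have "(\<Sum>B\<in>Pow C. F B * (\<Sum>S\<in>Pow C. parity_sign S (sym_diff B (sym_diff D {c})))) =
        (\<Sum>B\<in>Pow C. if B = sym_diff D {c} then 2 ^ card C * F B else 0)"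
    proof (intro sum.cong refl)
      fix B assume B: "B \<in> Pow C"
      have "sym_diff B (sym_diff D {c}) \<subseteq> C" using B Dc by auto
      moreover have "sym_diff B (sym_diff D {c}) = {} \<longleftrightarrow> B = sym_diff D {c}" by auto
      ultimately show "F B * (\<Sum>S\<in>Pow C. parity_sign S (sym_diff B (sym_diff D {c}))) =
          (if B = sym_diff D {c} then 2 ^ card C * F B else 0)"
        using orth by simp
    qed
    also have "\<dots> = 2 ^ card C * F (sym_diff D {c})"
      using Dc fin(2) by (subst sum.delta) auto
    finally show "2 ^ card C * F (sym_diff D {c}) =
        (\<Sum>B\<in>Pow C. F B * (\<Sum>S\<in>Pow C. parity_sign S (sym_diff B (sym_diff D {c}))))"
      by (rule sym)
  qed
  also have "\<dots> = (\<Sum>c\<in>C. \<Sum>B\<in>Pow C. \<Sum>S\<in>Pow C.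
      parity_sign S D * parity_sign S {c} * (parity_sign S B * F B))"
  proof (intro sum.cong refl)
    fix c B assume "c \<in> C" "B \<in> Pow C"
    then have "finite B" "finite D" "finite (sym_diff D {c})" using finB D by auto
    then have "parity_sign S (sym_diff B (sym_diff D {c})) =
        parity_sign S B * (parity_sign S D * parity_sign S {c})" for S
      using parity_sign_sym_diff[of B "sym_diff D {c}" S] parity_sign_sym_diff[of D "{c}" S] by simp
    then show "F B * (\<Sum>S\<in>Pow C. parity_sign S (sym_diff B (sym_diff D {c}))) =
        (\<Sum>S\<in>Pow C. parity_sign S D * parity_sign S {c} * (parity_sign S B * F B))"
      by (simp add: sum_distrib_left mult_ac)
  qed
  also have "\<dots> = (\<Sum>c\<in>C. \<Sum>S\<in>Pow C. \<Sum>B\<in>Pow C.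
      parity_sign S D * parity_sign S {c} * (parity_sign S B * F B))"
    by (intro sum.cong refl sum.swap)
  also have "\<dots> = (\<Sum>S\<in>Pow C. \<Sum>c\<in>C. \<Sum>B\<in>Pow C.
      parity_sign S D * parity_sign S {c} * (parity_sign S B * F B))"
    by (rule sum.swap)
  also have "\<dots> = (\<Sum>S\<in>Pow C. parity_sign S D *
      ((\<Sum>c\<in>C. parity_sign S {c}) * (\<Sum>B\<in>Pow C. parity_sign S B * F B)))"
    unfolding sum_product by (intro sum.cong refl) (simp add: sum_distrib_left mult.assoc)
  also have "\<dots> = 0"
  proof (intro sum.neutral ballI)
    fix S assume S: "S \<in> Pow C"
    consider "card S < card R" | "card S = card R" | "card R < card S" by linarith
    then show "parity_sign S D *
      ((\<Sum>c\<in>C. parity_sign S {c}) * (\<Sum>B\<in>Pow C. parity_sign S B * F B)) = 0"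
      by cases (use S low high level card in simp_all)
  qed
  finally have "(\<Sum>c\<in>C. F (sym_diff D {c})) = 0" by simp
  then show ?thesis by (simp add: F_def)
qed

section \<open>Splitting matrices and chains\<close>

text \<open>Rows and columns are indexed by arbitrary finite sets, so that a row and two columns can
  be deleted without renumbering and the members of a family can serve as rows.\<close>

definition splitting_matrix :: "'r set \<Rightarrow> 'c set \<Rightarrow> ('r \<Rightarrow> 'c \<Rightarrow> int) \<Rightarrow> bool" where
  "splitting_matrix R C a \<longleftrightarrow> finite R \<and> finite C \<and> card C = 2 * card R \<and>
     (\<forall>i\<in>R. \<forall>j\<in>C. a i j = 1 \<or> a i j = - 1) \<and> (\<forall>i\<in>R. (\<Sum>j\<in>C. a i j) = 0) \<and>
     (\<forall>B\<subseteq>C. even (card B) \<longrightarrow> (\<exists>i\<in>R. (\<Sum>j\<in>B. a i j) = 0))"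

lemma splitting_matrix_scale:
  assumes M: "splitting_matrix R C a" and s: "\<And>i. i \<in> R \<Longrightarrow> s i = 1 \<or> s i = (- 1 :: int)"
  shows "splitting_matrix R C (\<lambda>i j. s i * a i j)"
  unfolding splitting_matrix_def
proof (intro conjI ballI allI impI)
  fix i j assume "i \<in> R" "j \<in> C"
  then have "a i j = 1 \<or> a i j = - 1" "s i = 1 \<or> s i = - 1"
    using M s by (auto simp: splitting_matrix_def)
  then show "s i * a i j = 1 \<or> s i * a i j = - 1" by auto
next
  fix B assume "B \<subseteq> C" "even (card B)"
  then obtain i where "i \<in> R" "(\<Sum>j\<in>B. a i j) = 0" using M by (auto simp: splitting_matrix_def)
  then show "\<exists>i\<in>R. (\<Sum>j\<in>B. s i * a i j) = 0" by (auto simp flip: sum_distrib_left)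
qed (use M in \<open>auto simp: splitting_matrix_def simp flip: sum_distrib_left\<close>)

lemma splitting_matrix_neighbours:
  assumes M: "splitting_matrix R C a" and D: "D \<subseteq> C"
  shows "(\<Sum>c\<in>C. \<Prod>i\<in>R. \<Sum>j\<in>sym_diff D {c}. a i j) = 0"
proof (rule sum_neighbours_eq_0)
  fix B assume "B \<subseteq> C" "even (card B)"
  then have "\<exists>i\<in>R. (\<Sum>j\<in>B. a i j) = 0" using M unfolding splitting_matrix_def by blast
  then show "(\<Prod>i\<in>R. \<Sum>j\<in>B. a i j) = 0" using M by (simp add: splitting_matrix_def)
qed (use M D in \<open>auto simp: splitting_matrix_def\<close>)

text \<open>The row is one that splits the two-element set of these columns.\<close>

lemma splitting_matrix_distinct:
  assumes M: "splitting_matrix R C a" and pq: "p \<in> C" "q \<in> C" "p \<noteq> q"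
  shows "\<exists>i\<in>R. a i q = - a i p"
proof -
  have "card {p, q} = 2" "{p, q} \<subseteq> C" using pq by auto
  then obtain i where "i \<in> R" "(\<Sum>j\<in>{p, q}. a i j) = 0"
    using M unfolding splitting_matrix_def by (metis even_numeral)
  with pq(3) show ?thesis by (intro bexI[of _ i]) auto
qed

text \<open>Rows are flipped so that they are positive on \<open>p\<close>. Adding the neighbour identities at
  \<open>{p, q}\<close> and \<open>{q, s}\<close> and subtracting twice the one at \<open>{p, s}\<close> leaves, for each further
  column, a nonnegative contribution that is a multiple of 4, and the total is 4.\<close>

lemma splitting_matrix_chain:
  assumes M: "splitting_matrix R C a" and pqs: "p \<in> C" "q \<in> C" "s \<in> C"
    and r: "r \<in> R" "t \<in> R" "r \<noteq> t"
    and pq: "\<And>i. i \<in> R \<Longrightarrow> a i q = (if i = r then - a i p else a i p)"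
    and qs: "\<And>i. i \<in> R \<Longrightarrow> a i s = (if i = t then - a i q else a i q)"
  obtains q' where "q' \<in> C" "\<And>i. i \<in> R \<Longrightarrow> a i q' = - a i q"
    "\<And>l. l \<in> C \<Longrightarrow> l \<noteq> q \<Longrightarrow> l \<noteq> q' \<Longrightarrow> a r l * a r p = a t l * a t p"
proof -
  have pm: "a i j = 1 \<or> a i j = - 1" if "i \<in> R" "j \<in> C" for i j
    using M that by (auto simp: splitting_matrix_def)
  have fin: "finite R" "finite C" using M by (auto simp: splitting_matrix_def)
  define b where "b i j = a i p * a i j" for i j
  have Mb: "splitting_matrix R C b"
    unfolding b_def using M pm pqs by (intro splitting_matrix_scale) auto
  have bpm: "b i j = 1 \<or> b i j = - 1" if "i \<in> R" "j \<in> C" for i j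
    using Mb that by (auto simp: splitting_matrix_def)
  have bp: "b i p = 1" if "i \<in> R" for i using pm[OF that pqs(1)] by (auto simp: b_def)
  have bq: "b i q = (if i = r then - 1 else 1)" if "i \<in> R" for i
    using pm[OF that pqs(1)] pq[OF that] by (auto simp: b_def)
  have bs: "b i s = (if i = r \<or> i = t then - 1 else 1)" if "i \<in> R" for i
    using pm[OF that pqs(1)] pq[OF that] qs[OF that] r by (auto simp: b_def)
  have ne: "p \<noteq> q" "q \<noteq> s" "p \<noteq> s"
    using bp[OF r(1)] bp[OF r(2)] bq[OF r(1)] bq[OF r(2)] bs[OF r(1)] bs[OF r(2)] r by auto
  define C' where "C' = C - {p, q, s}"
  have C: "C = insert p (insert q (insert s C'))" and finC': "finite C'"
    using pqs fin by (auto simp: C'_def)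
  define F where "F B = (\<Prod>i\<in>R. \<Sum>j\<in>B. b i j)" for B
  define R' where "R' = R - {r, t}"
  have R: "R = insert r (insert t R')" and finR': "finite R'" and rt: "r \<notin> R'" "t \<notin> R'"
    using r fin by (auto simp: R'_def)
  have F: "F B = (\<Sum>j\<in>B. b r j) * ((\<Sum>j\<in>B. b t j) * (\<Prod>i\<in>R'. \<Sum>j\<in>B. b i j))" for B
    unfolding F_def R using rt r(3) finR' by simp
  have nb: "F (sym_diff D {p}) + F (sym_diff D {q}) + F (sym_diff D {s}) + (\<Sum>l\<in>C'. F (sym_diff D {l})) = 0"
    if "D \<subseteq> C" for D
    using splitting_matrix_neighbours[OF Mb that] ne finC' unfolding F_def[symmetric]
    by (subst (asm) C) (simp add: C'_def)
  define Q where "Q l = (\<Prod>i\<in>R'. 2 + b i l)" for l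
  define h where "h l = 2 * (b r l - b t l) * Q l" for l
  \<comment> \<open>Each row other than r and t has entry 1 in p, q and s, so all three products
    share the factor \<open>Q l\<close>; the rows r and t contribute b_r (2 + b_t), (b_r - 2) b_t
    and b_r b_t.\<close>
  have F2: "F {p, q, l} + F {q, s, l} - 2 * F {p, s, l} = h l" if l: "l \<in> C'" for l
  proof -
    have l': "l \<noteq> p" "l \<noteq> q" "l \<noteq> s" using l by (auto simp: C'_def)
    have R'R: "i \<in> R" "i \<noteq> r" "i \<noteq> t" if "i \<in> R'" for i using that by (auto simp: R'_def)
    have "(\<Prod>i\<in>R'. \<Sum>j\<in>{p, q, l}. b i j) = Q l" "(\<Prod>i\<in>R'. \<Sum>j\<in>{q, s, l}. b i j) = Q l"
      "(\<Prod>i\<in>R'. \<Sum>j\<in>{p, s, l}. b i j) = Q l"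
      unfolding Q_def using l' ne R'R by (auto intro!: prod.cong simp: bp bq bs)
    then show ?thesis
      unfolding F h_def using l' ne r by (simp add: bp bq bs algebra_simps)
  qed
  have sd: "sym_diff {p, q} {p} = {q}" "sym_diff {p, q} {q} = {p}" "sym_diff {p, q} {s} = {p, q, s}"
    "sym_diff {q, s} {p} = {p, q, s}" "sym_diff {q, s} {q} = {s}" "sym_diff {q, s} {s} = {q}"
    "sym_diff {p, s} {p} = {s}" "sym_diff {p, s} {q} = {p, q, s}" "sym_diff {p, s} {s} = {p}"
    using ne by auto
  have sumF: "(\<Sum>l\<in>C'. F (sym_diff {x, y} {l})) = (\<Sum>l\<in>C'. F {x, y, l})" if "{x, y} \<subseteq> {p, q, s}" for x y
    using that by (intro sum.cong refl arg_cong[of _ _ F]) (auto simp: C'_def)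
  have sum_pq: "(\<Sum>l\<in>C'. F (sym_diff {p, q} {l})) = (\<Sum>l\<in>C'. F {p, q, l})"
    and sum_qs: "(\<Sum>l\<in>C'. F (sym_diff {q, s} {l})) = (\<Sum>l\<in>C'. F {q, s, l})"
    and sum_ps: "(\<Sum>l\<in>C'. F (sym_diff {p, s} {l})) = (\<Sum>l\<in>C'. F {p, s, l})"
    by (rule sumF; auto)+
  have "F {q} + F {p} + F {p, q, s} + (\<Sum>l\<in>C'. F {p, q, l}) = 0"
    using nb[of "{p, q}"] pqs unfolding sd sum_pq by simp
  moreover have "F {p, q, s} + F {s} + F {q} + (\<Sum>l\<in>C'. F {q, s, l}) = 0"
    using nb[of "{q, s}"] pqs unfolding sd sum_qs by simp
  moreover have "F {s} + F {p, q, s} + F {p} + (\<Sum>l\<in>C'. F {p, s, l}) = 0"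
    using nb[of "{p, s}"] pqs unfolding sd sum_ps by simp
  moreover have "F {p} = 1" "F {q} = - 1" "F {s} = 1"
  proof -
    have "(\<Prod>i\<in>R'. b i j) = 1" if "j \<in> {p, q, s}" for j
      using that by (intro prod.neutral) (auto simp: R'_def bp bq bs split: if_splits)
    then show "F {p} = 1" "F {q} = - 1" "F {s} = 1"
      unfolding F using r by (auto simp: bp bq bs)
  qed
  moreover have "(\<Sum>l\<in>C'. h l) = (\<Sum>l\<in>C'. F {p, q, l}) + (\<Sum>l\<in>C'. F {q, s, l}) - 2 * (\<Sum>l\<in>C'. F {p, s, l})"
    using F2 by (simp add: sum_distrib_left flip: sum.distrib sum_subtractf)
  ultimately have total: "(\<Sum>l\<in>C'. h l) = 4" by linarith
  have Q1: "Q l \<ge> 1" if "l \<in> C'" for l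
    unfolding Q_def using bpm[of _ l] that by (intro prod_ge_1) (force simp: R'_def C'_def)
  \<comment> \<open>Rows other than r and t sum to 2 or 4 over p, q, s, l, so this set is split by r
    or t, which needs entry 1 in row r or entry -1 in row t.\<close>
  have loc: "b r l = b t l \<or> b r l = 1 \<and> b t l = - 1" if l: "l \<in> C'" for l
  proof -
    have l': "l \<noteq> p" "l \<noteq> q" "l \<noteq> s" "l \<in> C" using l by (auto simp: C'_def)
    have "{p, q, s, l} \<subseteq> C" "card {p, q, s, l} = 4" using l' pqs ne by auto
    then obtain i where i: "i \<in> R" "(\<Sum>j\<in>{p, q, s, l}. b i j) = 0"
      using Mb unfolding splitting_matrix_def by (metis even_numeral)
    then have "b i p + b i q + b i s + b i l = 0" using l' ne by simp
    then show ?thesis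
      using bp[OF i(1)] bq[OF i(1)] bs[OF i(1)] bpm[OF i(1) l'(4)] bpm[OF r(1) l'(4)]
        bpm[OF r(2) l'(4)] r(3) by (auto split: if_splits)
  qed
  have hnn: "h l \<ge> 0" if "l \<in> C'" for l
    using loc[OF that] Q1[OF that] by (auto simp: h_def)
  from total obtain q' where q': "q' \<in> C'" "h q' \<noteq> 0"
    by (metis sum.neutral zero_neq_numeral)
  then have b': "b r q' = 1" "b t q' = - 1" and h': "h q' = 4 * Q q'"
    using loc[of q'] by (auto simp: h_def)
  have "(\<Sum>l\<in>C'. h l) = h q' + (\<Sum>l\<in>C' - {q'}. h l)"
    using finC' q'(1) by (rule sum.remove)
  moreover have "(\<Sum>l\<in>C' - {q'}. h l) \<ge> 0" by (intro sum_nonneg hnn) auto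
  ultimately have Q': "Q q' = 1" and rest0: "(\<Sum>l\<in>C' - {q'}. h l) = 0"
    using total h' Q1[OF q'(1)] by linarith+
  have rest: "h l = 0" if "l \<in> C'" "l \<noteq> q'" for l
    using rest0 that finC' hnn by (subst (asm) sum_nonneg_eq_0_iff) auto
  \<comment> \<open>The column \<open>q'\<close> alone uses up the total 4, so
    \<open>Q q' = 1\<close>; an entry 1 would put a factor 3 into this product.\<close>
  have b'1: "b i q' = - 1" if i: "i \<in> R'" for i
  proof (rule ccontr)
    assume "b i q' \<noteq> - 1"
    then have "b i q' = 1" using bpm[of i q'] i q'(1) by (auto simp: R'_def C'_def)
    moreover have "Q q' = (2 + b i q') * (\<Prod>i\<in>R' - {i}. 2 + b i q')"
      unfolding Q_def using finR' i by (rule prod.remove)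
    moreover have "(\<Prod>i\<in>R' - {i}. 2 + b i q') \<ge> 1"
      using bpm[of _ q'] q'(1) by (intro prod_ge_1) (force simp: R'_def C'_def)
    ultimately show False using Q' by simp
  qed
  have bq': "b i q' = - b i q" if "i \<in> R" for i
    using that b' b'1 bq[OF that] r(3) by (auto simp: R'_def)
  show ?thesis
  proof (rule that)
    show "q' \<in> C" using q'(1) by (simp add: C'_def)
    show "a i q' = - a i q" if "i \<in> R" for i
      using bq'[OF that] pm[OF that pqs(1)] by (auto simp: b_def)
    show "a r l * a r p = a t l * a t p" if l: "l \<in> C" "l \<noteq> q" "l \<noteq> q'" for l
    proof -
      have "b r l = b t l"
      proof (cases "l \<in> C'")
        case True
        with rest[of l] l(3) Q1[OF True] show ?thesis by (simp add: h_def)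
      next
        case False
        with l have "l = p \<or> l = s" by (auto simp: C'_def)
        with r show ?thesis by (auto simp: bp bs)
      qed
      then show ?thesis by (simp add: b_def mult.commute)
    qed
  qed
qed

section \<open>Certificates\<close>

text \<open>In a pattern, \<open>(v, m)\<close> stands for \<open>m\<close> rows whose entries in the chosen columns agree with the
  entry in the first of them as prescribed by \<open>v\<close>. A further column is described by the numbers
  \<open>us\<close> of rows of each kind in which it disagrees with the first one.\<close>

type_synonym pattern = "(bool list \<times> nat) list"

definition extend_pattern :: "pattern \<Rightarrow> nat list \<Rightarrow> pattern" where
  "extend_pattern P us =
     concat (map2 (\<lambda>(v, m) u. [(v @ [True], m - u), (v @ [False], u)]) P us)"

definition pattern_count :: "pattern \<Rightarrow> bool list \<Rightarrow> nat" where
  "pattern_count P v = sum_list (map snd (filter (\<lambda>x. fst x = v) P))"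

text \<open>Compares the multisets of rows. Entries of multiplicity 0, which extension produces, and
  repeated vectors, which selecting columns produces, must not matter.\<close>

definition same_pattern :: "pattern \<Rightarrow> pattern \<Rightarrow> bool" where
  "same_pattern P Q \<longleftrightarrow> list_all (\<lambda>x. pattern_count P (fst x) = pattern_count Q (fst x)) (P @ Q)"

text \<open>Entries are relative to the first column, so a selection that starts elsewhere is
  renormalised to its own first column.\<close>

definition select_columns :: "nat list \<Rightarrow> bool list \<Rightarrow> bool list" where
  "select_columns sel v = map (\<lambda>s. v ! s = v ! hd sel) sel"

fun mask_sum :: "bool list \<Rightarrow> bool list \<Rightarrow> int" where
  "mask_sum (True # bs) (v # vs) = (if v then 1 else - 1) + mask_sum bs vs"
| "mask_sum (False # bs) (v # vs) = mask_sum bs vs"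
| "mask_sum bs vs = 0"

fun dot :: "int list \<Rightarrow> int list \<Rightarrow> int" where
  "dot (x # xs) (y # ys) = x * y + dot xs ys"
| "dot xs ys = 0"

text \<open>Asks whether the new column brings one of m rows with partial sum s to 0. Partial sum -1
  needs an agreeing row, partial sum 1 a disagreeing one, and any other value is out of reach of a
  single entry.\<close>

definition hit :: "nat \<Rightarrow> nat \<Rightarrow> int \<Rightarrow> bool" where
  "hit m u s \<longleftrightarrow> s = - 1 \<and> u < m \<or> s = 1 \<and> 0 < u"

text \<open>The columns that can occur outside the pattern. Each odd set \<open>b\<close> of columns of the pattern
  together with the new column must contain a row of sum 0 (\<open>hit\<close>); each set in \<open>evens\<close> contributes
  the product of the row sums after adding the new column.\<close>

definition extend_classes ::
  "nat \<Rightarrow> int list \<Rightarrow> int list \<Rightarrow> (nat list \<times> bool list \<times> int list) list \<Rightarrow> (nat list \<times> bool list \<times> int list) list" where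
  "extend_classes m os es xs = concat (map (\<lambda>u. map (\<lambda>(us, hs, gs).
      (us @ [u], map2 (\<lambda>h s. h \<or> hit m u s) hs os, map2 (*) gs (map (\<lambda>s. (s + 1) ^ (m - u) * (s - 1) ^ u) es)))
      xs) [0..<Suc m])"

definition classes :: "pattern \<Rightarrow> bool list list \<Rightarrow> bool list list \<Rightarrow> (nat list \<times> int list) list" where
  "classes P odds evens = map (\<lambda>(us, hs, gs). (us, gs)) (filter (\<lambda>(us, hs, gs). list_all id hs)
     (fold (\<lambda>(v, m). extend_classes m (map (\<lambda>b. mask_sum b v) odds) (map (\<lambda>b. mask_sum b v) evens)) P
       [([], map (\<lambda>b. False) odds, map (\<lambda>b. 1) evens)]))"

text \<open>A step \<open>(ls, ms, c)\<close> combines the neighbour identities for \<open>evens\<close> with weights \<open>ls\<close> and the row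
  sums with weights \<open>ms\<close>; the total of its values over the outer columns is then known, and if all
  values are nonnegative, columns with a larger value are discarded.\<close>

type_synonym step = "int list \<times> int list \<times> int"

definition step_value :: "step \<Rightarrow> nat list \<times> int list \<Rightarrow> int" where
  "step_value s x = (case s of (ls, ms, c) \<Rightarrow> case x of (us, gs) \<Rightarrow> c + dot ls gs + dot ms (map int us))"

text \<open>A negative value makes the step fail, since the total bounds a single value only if all
  values are nonnegative. If no step fails, a negative total discards every column.\<close>

fun keep :: "int \<Rightarrow> int \<Rightarrow> 'a \<Rightarrow> 'a list option \<Rightarrow> 'a list option" where
  "keep h c x None = None"
| "keep h c x (Some xs) = (if h < 0 then None else if c < h then Some xs else Some (x # xs))"

fun reduce_step :: "step \<Rightarrow> int \<Rightarrow> (nat list \<times> int list) list \<Rightarrow> (nat list \<times> int list) list option" where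
  "reduce_step s c [] = Some []"
| "reduce_step s c (x # xs) = keep (step_value s x) c x (reduce_step s c xs)"

fun run_steps :: "step list \<Rightarrow> int \<Rightarrow> int list \<Rightarrow> int list \<Rightarrow> (nat list \<times> int list) list option \<Rightarrow> bool" where
  "run_steps [] n ts ws (Some []) = True"
| "run_steps ((ls, ms, c) # ss) n ts ws (Some xs) =
     run_steps ss n ts ws (reduce_step (ls, ms, c) (c * n + dot ls ts + dot ms ws) xs)"
| "run_steps ss n ts ws xs = False"

text \<open>The neighbour identity with the columns of the pattern moved to the other side: what the
  outer columns must contribute in total.\<close>

definition own_terms :: "pattern \<Rightarrow> bool list list \<Rightarrow> nat \<Rightarrow> int list" where
  "own_terms P evens k = map (\<lambda>b. - sum_list (map (\<lambda>t.
      prod_list (map (\<lambda>(v, m). mask_sum (b[t := \<not> b ! t]) v ^ m) P)) [0..<k])) evens"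

text \<open>Row sum 0 means that a row disagrees with the first column in exactly n columns; those
  inside the pattern are the \<open>False\<close> entries of v.\<close>

definition disagreements :: "nat \<Rightarrow> pattern \<Rightarrow> int list" where
  "disagreements n P = map (\<lambda>(v, m). int m * (int n - int (length (filter Not v)))) P"

text \<open>An entry consists of the pattern to be excluded, the children, odd and even sets of columns,
  and the steps. A child \<open>(us, sel, i)\<close> excludes the outer column \<open>us\<close> because the columns \<open>sel\<close> of the
  extended pattern form the pattern excluded at position \<open>i\<close>.\<close>

type_synonym entry =
  "pattern \<times> (nat list \<times> nat list \<times> nat) list \<times> bool list list \<times> bool list list \<times> step list"

definition child_ok :: "pattern list \<Rightarrow> pattern \<Rightarrow> nat \<Rightarrow> nat list \<times> nat list \<times> nat \<Rightarrow> bool" where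
  "child_ok Ps P k c = (case c of (us, sel, i) \<Rightarrow>
     i < length Ps \<and> sel \<noteq> [] \<and> distinct sel \<and> list_all (\<lambda>s. s \<le> k) sel \<and>
     same_pattern (map (\<lambda>(v, m). (select_columns sel v, m)) (extend_pattern P us)) (Ps ! i))"

definition check_entry :: "nat \<Rightarrow> pattern list \<Rightarrow> entry \<Rightarrow> bool" where
  "check_entry n Ps e = (case e of (P, ch, odds, evens, steps) \<Rightarrow>
     (let k = length (fst (hd P)) in
      P \<noteq> [] \<and> k < 2 * n \<and> distinct (map fst P) \<and> list_all (\<lambda>(v, m). length v = k \<and> 0 < m) P \<and>
      list_all (\<lambda>b. length b = k \<and> odd (length (filter id b))) odds \<and> list_all (\<lambda>b. length b = k) evens \<and>
      list_all (child_ok Ps P k) ch \<and>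
      run_steps steps (2 * int n - int k) (own_terms P evens k) (disagreements n P)
        (Some (filter (\<lambda>x. fst x \<notin> set (map fst ch)) (classes P odds evens)))))"

text \<open>Each excluded pattern joins the list, so children can refer to all earlier entries. The
  list will start with the chain pattern, which is therefore position 0 in the certificates.\<close>

fun check_entries :: "nat \<Rightarrow> pattern list \<Rightarrow> entry list \<Rightarrow> bool" where
  "check_entries n Ps [] = True"
| "check_entries n Ps (e # es) = (check_entry n Ps e \<and> check_entries n (Ps @ [fst e]) es)"

text \<open>The columns of a chain in the order p, s, q, with the middle one last: row r is
  \<open>[True, False, False]\<close> and row t is \<open>[True, False, True]\<close>.\<close>

definition chain_pattern :: "nat \<Rightarrow> pattern" where
  "chain_pattern n = [([True, True, True], n - 2), ([True, False, True], 1), ([True, False, False], 1)]"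

definition agreement :: "('r \<Rightarrow> 'c \<Rightarrow> int) \<Rightarrow> 'r \<Rightarrow> 'c list \<Rightarrow> bool list" where
  "agreement a i js = map (\<lambda>j. a i j = a i (hd js)) js"

definition pattern_mset :: "pattern \<Rightarrow> bool list multiset" where
  "pattern_mset P = sum_list (map (\<lambda>(v, m). replicate_mset m v) P)"

text \<open>Using \<open>agreement\<close> removes the signs of the rows and the multiset removes
  their order; only the order of the chosen columns remains.\<close>

definition realizes ::
  "'r set \<Rightarrow> 'c set \<Rightarrow> ('r \<Rightarrow> 'c \<Rightarrow> int) \<Rightarrow> 'c list \<Rightarrow> pattern \<Rightarrow> bool" where
  "realizes R C a js P \<longleftrightarrow> js \<noteq> [] \<and> distinct js \<and> set js \<subseteq> C \<and>
     image_mset (\<lambda>i. agreement a i js) (mset_set R) = pattern_mset P"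

section \<open>Patterns as multisets of rows\<close>

lemma count_pattern_mset: "count (pattern_mset P) v = pattern_count P v"
  by (induction P) (auto simp: pattern_mset_def pattern_count_def)

lemma same_pattern_mset:
  assumes "same_pattern P Q"
  shows "pattern_mset P = pattern_mset Q"
proof (rule multiset_eqI)
  fix v
  have "pattern_count P v = pattern_count Q v"
  proof (cases "v \<in> fst ` set (P @ Q)")
    case True
    then show ?thesis using assms by (auto simp: same_pattern_def list_all_iff)
  next
    case False
    then have "filter (\<lambda>x. fst x = v) P = []" "filter (\<lambda>x. fst x = v) Q = []"
      by (auto simp: filter_empty_conv)
    then show ?thesis by (simp add: pattern_count_def)
  qed
  then show "count (pattern_mset P) v = count (pattern_mset Q) v"
    by (simp add: count_pattern_mset)
qed

lemma pattern_mset_map: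
  "pattern_mset (map (\<lambda>(v, m). (f v, m)) P) = image_mset f (pattern_mset P)"
  by (induction P) (auto simp: pattern_mset_def)

lemma prod_pattern:
  assumes "image_mset f (mset_set R) = pattern_mset P"
  shows "(\<Prod>i\<in>R. g (f i)) = prod_list (map (\<lambda>(v, m). g v ^ m) P)"
proof -
  have "(\<Prod>i\<in>R. g (f i)) = prod_mset (image_mset g (image_mset f (mset_set R)))"
    by (simp add: prod_unfold_prod_mset image_mset.compositionality comp_def)
  also have "\<dots> = prod_list (map (\<lambda>(v, m). g v ^ m) P)"
    unfolding assms by (induction P) (auto simp: pattern_mset_def)
  finally show ?thesis .
qed

lemma image_mset_bool:
  "image_mset (\<lambda>i. h (g i)) M =
     replicate_mset (size M - size (filter_mset (\<lambda>i. \<not> g i) M)) (h True) +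
     replicate_mset (size (filter_mset (\<lambda>i. \<not> g i) M)) (h False)"
proof (induction M)
  case (add x M)
  have "size (filter_mset (\<lambda>i. \<not> g i) M) \<le> size M" by (rule size_filter_mset_lesseq)
  then show ?case using add by (cases "g x") (auto simp: Suc_diff_le)
qed simp

text \<open>As the kinds are distinct, each row belongs to a single entry of P, and the rows of that
  entry are divided by g into agreeing and disagreeing ones.\<close>

lemma pattern_mset_extend:
  assumes "image_mset f M = pattern_mset P" "distinct (map fst P)"
  shows "image_mset (\<lambda>i. f i @ [g i]) M = pattern_mset
    (extend_pattern P (map (\<lambda>x. size (filter_mset (\<lambda>i. f i = fst x \<and> \<not> g i) M)) P))"
  using assms
proof (induction P arbitrary: M)
  case Nil
  then show ?case by (simp add: pattern_mset_def extend_pattern_def)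
next
  case (Cons x P)
  obtain v m where x: "x = (v, m)" by (cases x)
  define M1 where "M1 = filter_mset (\<lambda>i. f i = v) M"
  define M2 where "M2 = filter_mset (\<lambda>i. f i \<noteq> v) M"
  have M: "M = M1 + M2" unfolding M1_def M2_def by (rule multiset_partition)
  have eq: "image_mset f M = replicate_mset m v + pattern_mset P"
    using Cons.prems(1) by (simp add: pattern_mset_def x)
  have v: "v \<notin># pattern_mset P"
  proof -
    have "filter (\<lambda>x. fst x = v) P = []"
      using Cons.prems(2) by (force simp: filter_empty_conv x)
    then have "count (pattern_mset P) v = 0"
      by (simp add: count_pattern_mset pattern_count_def)
    then show ?thesis by (simp add: not_in_iff)
  qed
  have "image_mset f M1 = filter_mset (\<lambda>w. w = v) (image_mset f M)"
    unfolding M1_def by (simp add: filter_mset_image_mset)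
  also have "\<dots> = replicate_mset m v"
    unfolding eq using v by (simp add: filter_mset_eq_conv filter_eq_replicate_mset not_in_iff)
  finally have M1: "size M1 = m" by (metis size_image_mset size_replicate_mset)
  have "image_mset f M2 = filter_mset (\<lambda>w. w \<noteq> v) (image_mset f M)"
    unfolding M2_def by (simp add: filter_mset_image_mset)
  also have "\<dots> = pattern_mset P"
    unfolding eq using v by (intro multiset_eqI) (auto simp: not_in_iff)
  finally have M2: "image_mset f M2 = pattern_mset P" .
  have sz: "size (filter_mset (\<lambda>i. f i = fst y \<and> \<not> g i) M) =
      size (filter_mset (\<lambda>i. f i = fst y \<and> \<not> g i) M2)" if "y \<in> set P" for y
  proof -
    have "fst y \<noteq> v" using Cons.prems(2) that by (force simp: x)
    then have "filter_mset (\<lambda>i. f i = fst y \<and> \<not> g i) M = filter_mset (\<lambda>i. f i = fst y \<and> \<not> g i) M2"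
      unfolding M2_def by (auto simp: filter_filter_mset intro: filter_mset_cong)
    then show ?thesis by simp
  qed
  have 2: "image_mset (\<lambda>i. f i @ [g i]) M2 = pattern_mset
      (extend_pattern P (map (\<lambda>x. size (filter_mset (\<lambda>i. f i = fst x \<and> \<not> g i) M)) P))"
    using Cons.IH[OF M2] Cons.prems(2) sz by (simp cong: map_cong)
  have "image_mset (\<lambda>i. f i @ [g i]) M1 = image_mset (\<lambda>i. v @ [g i]) M1"
    unfolding M1_def by (intro image_mset_cong) auto
  also have "\<dots> = replicate_mset (m - size (filter_mset (\<lambda>i. \<not> g i) M1)) (v @ [True]) +
      replicate_mset (size (filter_mset (\<lambda>i. \<not> g i) M1)) (v @ [False])"
    using image_mset_bool[of "\<lambda>b. v @ [b]" g M1] by (simp add: M1)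
  also have "filter_mset (\<lambda>i. \<not> g i) M1 = filter_mset (\<lambda>i. f i = v \<and> \<not> g i) M"
    unfolding M1_def by (simp add: filter_filter_mset conj_commute)
  finally have 1: "image_mset (\<lambda>i. f i @ [g i]) M1 =
      replicate_mset (m - size (filter_mset (\<lambda>i. f i = v \<and> \<not> g i) M)) (v @ [True]) +
      replicate_mset (size (filter_mset (\<lambda>i. f i = v \<and> \<not> g i) M)) (v @ [False])" .
  have "image_mset (\<lambda>i. f i @ [g i]) M =
      image_mset (\<lambda>i. f i @ [g i]) M1 + image_mset (\<lambda>i. f i @ [g i]) M2"
    by (subst M) simp
  then show ?case unfolding 1 2 by (simp add: x extend_pattern_def pattern_mset_def)
qed

lemma mask_sum_eq:
  "length b = length v \<Longrightarrow>
    mask_sum b v = (\<Sum>t<length v. if b ! t then (if v ! t then 1 else - 1) else 0)"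
proof (induction b v rule: list_induct2)
  case (Cons x xs y ys)
  then show ?case by (cases x) (simp_all add: sum.lessThan_Suc_shift del: sum.lessThan_Suc cong: if_cong)
qed simp

lemma mask_sum_snoc:
  "length b = length v \<Longrightarrow> mask_sum (b @ [True]) (v @ [x]) = mask_sum b v + (if x then 1 else - 1)"
proof (induction b v rule: list_induct2)
  case (Cons y ys z zs)
  then show ?case by (cases y) simp_all
qed simp

definition masked :: "bool list \<Rightarrow> 'c list \<Rightarrow> 'c set" where
  "masked b js = (!) js ` {t. t < length js \<and> b ! t}"

lemma masked_flip:
  assumes "length b = length js" "distinct js" "t < length js"
  shows "masked (b[t := \<not> b ! t]) js = sym_diff (masked b js) {js ! t}"
proof -
  have "{s. s < length js \<and> b[t := \<not> b ! t] ! s} = sym_diff {s. s < length js \<and> b ! s} {t}"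
    using assms by (auto simp: nth_list_update)
  moreover have "inj_on ((!) js) {..<length js}" using assms(2) by (simp add: inj_on_nth)
  then have "(!) js ` sym_diff X Y = sym_diff ((!) js ` X) ((!) js ` Y)"
    if "X \<subseteq> {..<length js}" "Y \<subseteq> {..<length js}" for X Y
    using that by (auto simp: inj_on_def image_iff)
  ultimately show ?thesis
    unfolding masked_def using assms(3) by (simp add: subset_iff)
qed

lemma sum_masked:
  assumes a: "\<And>j. j \<in> set js \<Longrightarrow> a i j = 1 \<or> a i j = (- 1 :: int)"
    and js: "js \<noteq> []" "distinct js" "length b = length js"
  shows "(\<Sum>j\<in>masked b js. a i (hd js) * a i j) = mask_sum b (agreement a i js)"
proof -
  have "(\<Sum>j\<in>masked b js. a i (hd js) * a i j) =
      (\<Sum>t | t < length js \<and> b ! t. a i (hd js) * a i (js ! t))"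
    unfolding masked_def using js(2)
    by (subst sum.reindex) (auto simp: inj_on_def nth_eq_iff_index_eq)
  also have "\<dots> = (\<Sum>t<length js. if b ! t then a i (hd js) * a i (js ! t) else 0)"
    by (subst sum.inter_filter[symmetric]) (auto intro: sum.cong)
  also have "\<dots> = (\<Sum>t<length js. if b ! t then (if agreement a i js ! t then 1 else - 1) else 0)"
  proof (intro sum.cong refl)
    fix t assume "t \<in> {..<length js}"
    then have "js ! t \<in> set js" "agreement a i js ! t = (a i (js ! t) = a i (hd js))"
      by (auto simp: agreement_def)
    with a[of "js ! t"] a[of "hd js"] js(1)
    show "(if b ! t then a i (hd js) * a i (js ! t) else 0) =
        (if b ! t then (if agreement a i js ! t then 1 else - 1) else 0)" by auto
  qed
  also have "\<dots> = mask_sum b (agreement a i js)"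
    using js(3) mask_sum_eq[of b "agreement a i js"] by (simp add: agreement_def)
  finally show ?thesis .
qed

lemma agreement_select:
  assumes a: "\<And>j. j \<in> set js \<Longrightarrow> a i j = 1 \<or> a i j = (- 1 :: int)"
    and sel: "sel \<noteq> []" "\<And>s. s \<in> set sel \<Longrightarrow> s < length js"
  shows "agreement a i (map ((!) js) sel) = select_columns sel (agreement a i js)"
proof -
  have "(a i (js ! s) = a i (js ! hd sel)) \<longleftrightarrow>
      ((a i (js ! s) = a i (hd js)) = (a i (js ! hd sel) = a i (hd js)))" if "s \<in> set sel" for s
  proof -
    have "js ! s \<in> set js" "js ! hd sel \<in> set js" using sel that by (auto intro: nth_mem)
    moreover have "js \<noteq> []" using sel(2)[OF that] by auto
    then have "hd js \<in> set js" by simp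
    ultimately show ?thesis using a by metis
  qed
  then show ?thesis
    using sel by (auto simp: agreement_def select_columns_def hd_map)
qed

lemma realizes_select:
  assumes M: "splitting_matrix R C a" and js: "realizes R C a js Q"
    and sel: "sel \<noteq> []" "distinct sel" "\<And>s. s \<in> set sel \<Longrightarrow> s < length js"
    and same: "same_pattern (map (\<lambda>(v, m). (select_columns sel v, m)) Q) P"
  shows "realizes R C a (map ((!) js) sel) P"
proof -
  have fin: "finite R" using M by (simp add: splitting_matrix_def)
  have pm: "a i j = 1 \<or> a i j = - 1" if "i \<in> R" "j \<in> set js" for i j
    using M js that by (auto simp: splitting_matrix_def realizes_def)
  have "image_mset (\<lambda>i. agreement a i (map ((!) js) sel)) (mset_set R) =
      image_mset (\<lambda>i. select_columns sel (agreement a i js)) (mset_set R)"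
    using pm fin sel by (intro image_mset_cong agreement_select) auto
  also have "\<dots> = image_mset (select_columns sel) (image_mset (\<lambda>i. agreement a i js) (mset_set R))"
    by (simp add: image_mset.compositionality comp_def)
  also have "\<dots> = image_mset (select_columns sel) (pattern_mset Q)"
    using js by (simp add: realizes_def)
  also have "\<dots> = pattern_mset P"
    using same_pattern_mset[OF same] by (simp add: pattern_mset_map)
  finally show ?thesis
    using js sel by (auto simp: realizes_def distinct_map inj_on_def nth_eq_iff_index_eq)
qed


lemma realizes_extend:
  assumes M: "splitting_matrix R C a" and js: "realizes R C a js P"
    and P: "distinct (map fst P)" and l: "l \<in> C" "l \<notin> set js"
  shows "realizes R C a (js @ [l]) (extend_pattern P
    (map (\<lambda>x. card {i \<in> R. agreement a i js = fst x \<and> a i l \<noteq> a i (hd js)}) P))"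
proof -
  have fin: "finite R" using M by (simp add: splitting_matrix_def)
  have "js \<noteq> []" using js by (simp add: realizes_def)
  then have "agreement a i (js @ [l]) = agreement a i js @ [a i l = a i (hd js)]" for i
    by (simp add: agreement_def)
  then have "image_mset (\<lambda>i. agreement a i (js @ [l])) (mset_set R) = pattern_mset (extend_pattern P
    (map (\<lambda>x. size (filter_mset (\<lambda>i. agreement a i js = fst x \<and> \<not> a i l = a i (hd js)) (mset_set R))) P))"
    using pattern_mset_extend[OF _ P, of "\<lambda>i. agreement a i js" "mset_set R"] js
    by (simp add: realizes_def)
  moreover have "size (filter_mset (\<lambda>i. agreement a i js = fst x \<and> \<not> a i l = a i (hd js)) (mset_set R)) =
      card {i \<in> R. agreement a i js = fst x \<and> a i l \<noteq> a i (hd js)}" for x :: "bool list \<times> nat"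
    using fin by (simp add: filter_mset_mset_set)
  ultimately have "image_mset (\<lambda>i. agreement a i (js @ [l])) (mset_set R) = pattern_mset (extend_pattern P
    (map (\<lambda>x. card {i \<in> R. agreement a i js = fst x \<and> a i l \<noteq> a i (hd js)}) P))"
    by (simp only:)
  then show ?thesis using js l by (simp add: realizes_def)
qed

section \<open>Soundness of the certificate check\<close>

lemma prod_extend_pattern:
  fixes g :: "bool list \<Rightarrow> int"
  shows "prod_list (map (\<lambda>(w, m). g w ^ m) (extend_pattern P (map u P))) =
    prod_list (map (\<lambda>x. g (fst x @ [True]) ^ (snd x - u x) * g (fst x @ [False]) ^ u x) P)"
  by (induction P) (auto simp: extend_pattern_def)

lemma map2_map: "map2 f (map g xs) (map h xs) = map (\<lambda>x. f (g x) (h x)) xs"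
  by (induction xs) auto

text \<open>The accumulated counts, flags H and products G are arbitrary, so that the induction can
  pass through \<open>extend_classes\<close> one kind of rows at a time.\<close>

lemma fold_extend_classes:
  assumes "(us, map H odds, map G evens) \<in> set S" "\<And>x. x \<in> set P \<Longrightarrow> u x \<le> snd x"
  shows "(us @ map u P, map (\<lambda>b. H b \<or> (\<exists>x\<in>set P. hit (snd x) (u x) (mask_sum b (fst x)))) odds,
      map (\<lambda>b. G b * prod_list (map (\<lambda>x. (mask_sum b (fst x) + 1) ^ (snd x - u x) *
        (mask_sum b (fst x) - 1) ^ u x) P)) evens)
    \<in> set (fold (\<lambda>(v, m). extend_classes m (map (\<lambda>b. mask_sum b v) odds) (map (\<lambda>b. mask_sum b v) evens)) P S)"
  using assms
proof (induction P arbitrary: us H G S)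
  case (Cons x P)
  obtain v m where x: "x = (v, m)" by (cases x)
  have "u x \<in> set [0..<Suc m]" using Cons.prems(2)[of x] by (auto simp: x)
  define f where "f = (\<lambda>(us, hs, gs). (us @ [u x],
      map2 (\<lambda>h s. h \<or> hit m (u x) s) hs (map (\<lambda>b. mask_sum b v) odds),
      map2 (*) gs (map (\<lambda>s. (s + 1) ^ (m - u x) * (s - 1) ^ u x) (map (\<lambda>b. mask_sum b v) evens))))"
  have "f (us, map H odds, map G evens) = (us @ [u x], map (\<lambda>b. H b \<or> hit m (u x) (mask_sum b v)) odds,
      map (\<lambda>b. G b * ((mask_sum b v + 1) ^ (m - u x) * (mask_sum b v - 1) ^ u x)) evens)"
    by (simp add: f_def map2_map comp_def)
  moreover have "f (us, map H odds, map G evens) \<in> set (map f S)"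
    unfolding set_map using Cons.prems(1) by (rule imageI)
  moreover have "set (map f S) \<subseteq>
      set (extend_classes m (map (\<lambda>b. mask_sum b v) odds) (map (\<lambda>b. mask_sum b v) evens) S)"
    unfolding extend_classes_def f_def set_concat
    by (rule Union_upper, unfold set_map[of _ "[0..<Suc m]"] image_image)
      (rule image_eqI[OF refl \<open>u x \<in> set [0..<Suc m]\<close>])
  ultimately have "(us @ [u x], map (\<lambda>b. H b \<or> hit m (u x) (mask_sum b v)) odds,
      map (\<lambda>b. G b * ((mask_sum b v + 1) ^ (m - u x) * (mask_sum b v - 1) ^ u x)) evens)
    \<in> set (extend_classes m (map (\<lambda>b. mask_sum b v) odds) (map (\<lambda>b. mask_sum b v) evens) S)"
    by auto
  from Cons.IH[OF this] Cons.prems(2) show ?case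
    by (simp add: x disj_assoc mult.assoc)
qed simp

text \<open>Completeness of the enumeration, the direction that soundness needs; columns that never
  occur may be listed as well.\<close>

lemma classesI:
  assumes "\<And>x. x \<in> set P \<Longrightarrow> u x \<le> snd x"
    and "\<And>b. b \<in> set odds \<Longrightarrow> \<exists>x\<in>set P. hit (snd x) (u x) (mask_sum b (fst x))"
  shows "(map u P, map (\<lambda>b. prod_list (map (\<lambda>x. (mask_sum b (fst x) + 1) ^ (snd x - u x) *
        (mask_sum b (fst x) - 1) ^ u x) P)) evens) \<in> set (classes P odds evens)"
proof -
  have "([] @ map u P, map (\<lambda>b. False \<or> (\<exists>x\<in>set P. hit (snd x) (u x) (mask_sum b (fst x)))) odds,
      map (\<lambda>b. 1 * prod_list (map (\<lambda>x. (mask_sum b (fst x) + 1) ^ (snd x - u x) *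
        (mask_sum b (fst x) - 1) ^ u x) P)) evens)
    \<in> set (fold (\<lambda>(v, m). extend_classes m (map (\<lambda>b. mask_sum b v) odds) (map (\<lambda>b. mask_sum b v) evens)) P
       [([], map (\<lambda>b. False) odds, map (\<lambda>b. 1) evens)])"
    by (rule fold_extend_classes) (use assms(1) in auto)
  then show ?thesis
    unfolding classes_def using assms(2) by (force simp: list_all_iff image_iff)
qed

lemma dot_sum:
  assumes "finite L"
  shows "(\<Sum>l\<in>L. dot xs (map (f l) ys)) = dot xs (map (\<lambda>y. \<Sum>l\<in>L. f l y) ys)"
proof (induction xs ys rule: list_induct2')
  case (4 x xs y ys)
  then show ?case by (simp add: sum.distrib sum_distrib_left)
qed auto

lemma keep_SomeD:
  assumes "keep h c x r = Some ys"
  shows "\<exists>xs. r = Some xs \<and> h \<ge> 0 \<and> ys = (if c < h then xs else x # xs)"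
  using assms by (cases r) (auto split: if_splits)

lemma reduce_stepD:
  assumes "reduce_step s c xs = Some ys" "x \<in> set xs"
  shows "step_value s x \<ge> 0 \<and> (step_value s x \<le> c \<longrightarrow> x \<in> set ys)"
  using assms by (induction xs arbitrary: ys) (auto dest!: keep_SomeD split: if_splits)

text \<open>If all values of a step are nonnegative, no column can have a value exceeding their total,
  so the classes with larger values do not occur.\<close>

lemma run_steps_sound:
  assumes L: "finite L" "L \<noteq> {}" and xs: "\<And>l. l \<in> L \<Longrightarrow> (us l, gs l) \<in> set xs"
    and run: "run_steps ss (int (card L)) ts ws (Some xs)"
    and us: "\<And>l. map int (us l) = map (p l) P" and gs: "\<And>l. gs l = map (q l) evens"
    and ws: "ws = map (\<lambda>y. \<Sum>l\<in>L. p l y) P" and ts: "ts = map (\<lambda>b. \<Sum>l\<in>L. q l b) evens"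
  shows False
  using run xs
proof (induction ss arbitrary: xs)
  case Nil
  then show ?case using L(2) by (cases xs) auto
next
  case (Cons s ss)
  obtain ls ms c where s: "s = (ls, ms, c)" by (cases s)
  define d where "d = c * int (card L) + dot ls ts + dot ms ws"
  have "run_steps ss (int (card L)) ts ws (reduce_step s d xs)"
    using Cons.prems(1) by (simp add: s d_def)
  then obtain ys where ys: "reduce_step s d xs = Some ys" "run_steps ss (int (card L)) ts ws (Some ys)"
    by (cases "reduce_step s d xs"; cases ss) auto
  have "(\<Sum>l\<in>L. step_value s (us l, gs l)) = d"
    using L(1) by (simp add: step_value_def s us gs d_def ws ts sum.distrib dot_sum)
  moreover have nn: "step_value s (us l, gs l) \<ge> 0" if "l \<in> L" for l
    using reduce_stepD[OF ys(1)] Cons.prems(2)[OF that] by blast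
  ultimately have "step_value s (us l, gs l) \<le> d" if "l \<in> L" for l
    using member_le_sum[OF that, of "\<lambda>l. step_value s (us l, gs l)"] L(1) by auto
  then have "(us l, gs l) \<in> set ys" if "l \<in> L" for l
    using reduce_stepD[OF ys(1)] Cons.prems(2)[OF that] that by blast
  with Cons.IH[OF ys(2)] show False .
qed


lemma pattern_count_distinct:
  "distinct (map fst P) \<Longrightarrow> x \<in> set P \<Longrightarrow> pattern_count P (fst x) = snd x"
proof (induction P)
  case (Cons y P)
  show ?case
  proof (cases "x = y")
    case True
    have "fst y \<notin> fst ` set P" using Cons.prems(1) by simp
    then have "\<forall>z\<in>set P. fst z \<noteq> fst y" by (metis imageI)
    then have "filter (\<lambda>z. fst z = fst y) P = []" by (simp only: filter_empty_conv)
    with True show ?thesis by (simp add: pattern_count_def)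
  next
    case False
    then have x: "x \<in> set P" using Cons.prems(2) by simp
    moreover have "fst y \<notin> fst ` set P" using Cons.prems(1) by simp
    ultimately have "fst x \<noteq> fst y" by (metis imageI)
    then show ?thesis using Cons.IH x Cons.prems(1) by (simp add: pattern_count_def)
  qed
qed simp

lemma count_image_size: "count (image_mset f M) v = size (filter_mset (\<lambda>i. f i = v) M)"
  by (induction M) auto

lemma realizes_card:
  assumes "finite R" "realizes R C a js P"
  shows "card {i \<in> R. agreement a i js = v} = pattern_count P v"
proof -
  have "pattern_count P v = count (image_mset (\<lambda>i. agreement a i js) (mset_set R)) v"
    using assms(2) by (simp add: realizes_def count_pattern_mset)
  also have "\<dots> = size (filter_mset (\<lambda>i. agreement a i js = v) (mset_set R))"
    by (rule count_image_size)
  also have "\<dots> = card {i \<in> R. agreement a i js = v}"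
    using assms(1) by (simp add: filter_mset_mset_set)
  finally show ?thesis by simp
qed

text \<open>The outer columns of a realisation would survive every step: the totals of their
  products are those of the neighbour identities, the totals of their counts are those of the row
  sums, and none of them completes an excluded child.\<close>

lemma check_entry_sound:
  assumes M: "splitting_matrix R C a" and n: "card R = n"
    and Ps: "\<And>i js. i < length Ps \<Longrightarrow> \<not> realizes R C a js (Ps ! i)"
    and chk: "check_entry n Ps (P, ch, odds, evens, steps)"
  shows "\<not> realizes R C a js P"
proof
  assume js: "realizes R C a js P"
  define k where "k = length (fst (hd P))"
  have P: "P \<noteq> []" "k < 2 * n" "distinct (map fst P)"
    and Pk: "\<And>x. x \<in> set P \<Longrightarrow> length (fst x) = k \<and> 0 < snd x"
    and odds: "\<And>b. b \<in> set odds \<Longrightarrow> length b = k \<and> odd (length (filter id b))"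
    and evens: "\<And>b. b \<in> set evens \<Longrightarrow> length b = k"
    and ch: "\<And>c. c \<in> set ch \<Longrightarrow> child_ok Ps P k c"
    and run: "run_steps steps (2 * int n - int k) (own_terms P evens k) (disagreements n P)
        (Some (filter (\<lambda>x. fst x \<notin> set (map fst ch)) (classes P odds evens)))"
    using chk by (auto simp: check_entry_def k_def Let_def list_all_iff)
  have fin: "finite R" "finite C" and cardC: "card C = 2 * n"
    using M n by (auto simp: splitting_matrix_def)
  have js': "js \<noteq> []" "distinct js" "set js \<subseteq> C" using js by (auto simp: realizes_def)
  have pm: "a i j = 1 \<or> a i j = - 1" if "i \<in> R" "j \<in> C" for i j
    using M that by (auto simp: splitting_matrix_def)
  have hd: "hd js \<in> C" using js' by auto
  have occ: "\<exists>x\<in>set P. fst x = agreement a i js" if "i \<in> R" for i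
  proof (rule ccontr)
    assume "\<not> ?thesis"
    then have "filter (\<lambda>x. fst x = agreement a i js) P = []" by (auto simp: filter_empty_conv)
    then have "card {i' \<in> R. agreement a i' js = agreement a i js} = 0"
      using realizes_card[OF fin(1) js] by (simp add: pattern_count_def)
    then show False using fin(1) that by auto
  qed
  have cnt: "card {i \<in> R. agreement a i js = fst x} = snd x" if "x \<in> set P" for x
    using realizes_card[OF fin(1) js] pattern_count_distinct[OF P(3) that] by simp
  \<comment> \<open>The positive multiplicity of the first entry yields an actual row, whose
    agreement vector has one entry per chosen column.\<close>
  have lenjs: "length js = k"
  proof -
    have "card {i \<in> R. agreement a i js = fst (hd P)} > 0"
      using cnt[of "hd P"] Pk[of "hd P"] P(1) by simp
    then obtain i where "agreement a i js = fst (hd P)" by (auto simp: card_gt_0_iff)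
    then show ?thesis by (metis agreement_def k_def length_map)
  qed
  define L where "L = C - set js"
  have L: "finite L" "C = set js \<union> L" "set js \<inter> L = {}" using fin js' by (auto simp: L_def)
  have cardL: "int (card L) = 2 * int n - int k"
    using js' cardC lenjs fin P(2) by (simp add: L_def card_Diff_subset distinct_card)
  then have "L \<noteq> {}" using P(2) by auto
  define a' where "a' i j = a i (hd js) * a i j" for i j
  have M': "splitting_matrix R C a'"
    unfolding a'_def using M pm hd by (intro splitting_matrix_scale) auto
  have a'pm: "a' i j = (if a i j = a i (hd js) then 1 else - 1)" if "i \<in> R" "j \<in> C" for i j
    using pm[OF that] pm[OF that(1) hd] by (auto simp: a'_def)
  have sm: "(\<Sum>j\<in>masked b js. a' i j) = mask_sum b (agreement a i js)" if "i \<in> R" "length b = k" for i b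
    unfolding a'_def using js' pm that lenjs by (intro sum_masked) auto
  have subm: "masked b js \<subseteq> set js" for b by (auto simp: masked_def)
  then have finm: "finite (masked b js)" for b by (rule finite_subset) simp
  define u where "u l x = card {i \<in> R. agreement a i js = fst x \<and> a i l \<noteq> a i (hd js)}" for l and x :: "bool list \<times> nat"
  define q where "q l b = prod_list (map (\<lambda>x. (mask_sum b (fst x) + 1) ^ (snd x - u l x) *
        (mask_sum b (fst x) - 1) ^ u l x) P)" for l b
  have u_le: "u l x \<le> snd x" if "x \<in> set P" for l x
    unfolding u_def cnt[OF that, symmetric] using fin(1) by (intro card_mono) auto
  have ins: "(\<Sum>j\<in>insert l (masked b js). a' i j) = mask_sum b (agreement a i js) + a' i l"
    if "i \<in> R" "l \<in> L" "length b = k" for i l b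
  proof -
    have "l \<notin> masked b js" using subm[of b] that(2) by (auto simp: L_def)
    then show ?thesis using sm[OF that(1,3)] finm by simp
  qed
  \<comment> \<open>An odd set of pattern columns together with l is even and hence split by some
    row, which had sum 1 or -1 before l was added.\<close>
  have cls: "(map (u l) P, map (q l) evens) \<in> set (classes P odds evens)" if l: "l \<in> L" for l
    unfolding q_def
  proof (rule classesI)
    fix b assume "b \<in> set odds"
    then have b: "length b = k" "odd (length (filter id b))" using odds by auto
    have "card (masked b js) = card {t. t < length js \<and> b ! t}"
      unfolding masked_def using js'(2) by (intro card_image) (auto simp: inj_on_def nth_eq_iff_index_eq)
    also have "\<dots> = length (filter id b)"
      using b(1) lenjs by (simp add: length_filter_conv_card)
    finally have "odd (card (masked b js))" using b(2) by simp
    moreover have "l \<notin> masked b js" using subm[of b] l by (auto simp: L_def)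
    ultimately have "even (card (insert l (masked b js)))" using finm[of b] by simp
    moreover have "insert l (masked b js) \<subseteq> C" using subm[of b] js'(3) l by (auto simp: L_def)
    ultimately obtain i where i: "i \<in> R" "(\<Sum>j\<in>insert l (masked b js). a' i j) = 0"
      using M' unfolding splitting_matrix_def by blast
    have eq: "mask_sum b (agreement a i js) + a' i l = 0" using i ins[OF i(1) l b(1)] by simp
    obtain x where x: "x \<in> set P" "fst x = agreement a i js" using occ[OF i(1)] by blast
    have lC: "l \<in> C" using l by (simp add: L_def)
    have "hit (snd x) (u l x) (mask_sum b (fst x))"
    proof (cases "a i l = a i (hd js)")
      case True
      then have "{i \<in> R. agreement a i js = fst x \<and> a i l \<noteq> a i (hd js)} \<subset> {i \<in> R. agreement a i js = fst x}"
        using i(1) x(2) by auto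
      then have "u l x < snd x"
        unfolding u_def cnt[OF x(1), symmetric] using fin(1) by (intro psubset_card_mono) auto
      then show ?thesis using eq a'pm[OF i(1) lC] True x(2) by (simp add: hit_def)
    next
      case False
      then have "0 < u l x" unfolding u_def using fin(1) i(1) x(2) by (auto simp: card_gt_0_iff)
      then show ?thesis using eq a'pm[OF i(1) lC] False x(2) by (simp add: hit_def)
    qed
    then show "\<exists>x\<in>set P. hit (snd x) (u l x) (mask_sum b (fst x))" using x(1) by blast
  qed (rule u_le)
  have ext: "realizes R C a (js @ [l]) (extend_pattern P (map (u l) P))" if "l \<in> L" for l
    using realizes_extend[OF M js P(3), of l] that unfolding u_def by (simp add: L_def)
  have nochild: "map (u l) P \<notin> set (map fst ch)" if l: "l \<in> L" for l
  proof
    assume "map (u l) P \<in> set (map fst ch)"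
    then obtain sel i where "(map (u l) P, sel, i) \<in> set ch" by auto
    from ch[OF this] have *: "i < length Ps" "sel \<noteq> []" "distinct sel" "\<And>s. s \<in> set sel \<Longrightarrow> s \<le> k"
      "same_pattern (map (\<lambda>(v, m). (select_columns sel v, m)) (extend_pattern P (map (u l) P))) (Ps ! i)"
      by (auto simp: child_ok_def list_all_iff)
    have "realizes R C a (map ((!) (js @ [l])) sel) (Ps ! i)"
      using * lenjs by (intro realizes_select[OF M ext[OF l]]) (auto simp: less_Suc_eq_le)
    with Ps[OF *(1)] show False by blast
  qed
  \<comment> \<open>The neighbour identity at the set of columns given by b, divided into flips of
    pattern columns and additions of outer columns.\<close>
  have own: "own_terms P evens k = map (\<lambda>b. \<Sum>l\<in>L. q l b) evens"
    unfolding own_terms_def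
  proof (intro map_cong refl)
    fix b assume "b \<in> set evens"
    then have b: "length b = k" by (rule evens)
    define F where "F B = (\<Prod>i\<in>R. \<Sum>j\<in>B. a' i j)" for B
    have Fm: "F (masked b' js) = prod_list (map (\<lambda>(v, m). mask_sum b' v ^ m) P)" if "length b' = k" for b'
    proof -
      have "F (masked b' js) = (\<Prod>i\<in>R. mask_sum b' (agreement a i js))"
        unfolding F_def using sm that by (intro prod.cong) auto
      also have "\<dots> = prod_list (map (\<lambda>(v, m). mask_sum b' v ^ m) P)"
        using js by (intro prod_pattern) (simp add: realizes_def)
      finally show ?thesis .
    qed
    have Fl: "F (sym_diff (masked b js) {l}) = q l b" if l: "l \<in> L" for l
    proof -
      have "sym_diff (masked b js) {l} = insert l (masked b js)" using subm[of b] l by (auto simp: L_def)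
      then have "F (sym_diff (masked b js) {l}) = (\<Prod>i\<in>R. mask_sum (b @ [True]) (agreement a i (js @ [l])))"
      proof -
        have "(\<Sum>j\<in>insert l (masked b js). a' i j) = mask_sum (b @ [True]) (agreement a i (js @ [l]))"
          if i: "i \<in> R" for i
        proof -
          have "agreement a i (js @ [l]) = agreement a i js @ [a i l = a i (hd js)]"
            using js'(1) by (simp add: agreement_def)
          moreover have "length b = length (agreement a i js)" using b lenjs by (simp add: agreement_def)
          ultimately show ?thesis
            using ins[OF i l b] a'pm[OF i, of l] l by (simp add: mask_sum_snoc L_def)
        qed
        then show ?thesis
          using \<open>sym_diff (masked b js) {l} = insert l (masked b js)\<close> by (simp add: F_def)
      qed
      also have "\<dots> = prod_list (map (\<lambda>(w, m). mask_sum (b @ [True]) w ^ m) (extend_pattern P (map (u l) P)))"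
        using ext[OF l] by (intro prod_pattern) (simp add: realizes_def)
      also have "\<dots> = q l b"
        unfolding prod_extend_pattern q_def using Pk b
        by (intro arg_cong[of _ _ prod_list] map_cong refl) (simp add: mask_sum_snoc)
      finally show ?thesis .
    qed
    have "(\<Sum>c\<in>C. F (sym_diff (masked b js) {c})) = 0"
      unfolding F_def using subm[of b] js'(3) by (intro splitting_matrix_neighbours[OF M']) auto
    moreover have "(\<Sum>c\<in>C. F (sym_diff (masked b js) {c})) =
        (\<Sum>c\<in>set js. F (sym_diff (masked b js) {c})) + (\<Sum>c\<in>L. F (sym_diff (masked b js) {c}))"
      using L by (simp only: L(2)) (rule sum.union_disjoint; simp)
    moreover have "(\<Sum>c\<in>L. F (sym_diff (masked b js) {c})) = (\<Sum>c\<in>L. q c b)"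
      using Fl by (rule sum.cong[OF refl])
    moreover have "(\<Sum>c\<in>set js. F (sym_diff (masked b js) {c})) =
        (\<Sum>t\<in>{..<k}. F (sym_diff (masked b js) {js ! t}))"
      using js'(2) lenjs by (intro sum.reindex_bij_betw[symmetric] bij_betw_nth) auto
    moreover have "\<dots> = (\<Sum>t\<in>{..<k}. prod_list (map (\<lambda>(v, m). mask_sum (b[t := \<not> b ! t]) v ^ m) P))"
    proof (intro sum.cong refl)
      fix t assume t: "t \<in> {..<k}"
      have "F (sym_diff (masked b js) {js ! t}) = F (masked (b[t := \<not> b ! t]) js)"
        using t b lenjs js'(2) by (subst masked_flip) auto
      also have "\<dots> = prod_list (map (\<lambda>(v, m). mask_sum (b[t := \<not> b ! t]) v ^ m) P)"
        by (rule Fm) (simp add: b)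
      finally show "F (sym_diff (masked b js) {js ! t}) =
        prod_list (map (\<lambda>(v, m). mask_sum (b[t := \<not> b ! t]) v ^ m) P)" .
    qed
    ultimately show "- sum_list (map (\<lambda>t. prod_list (map (\<lambda>(v, m). mask_sum (b[t := \<not> b ! t]) v ^ m) P)) [0..<k])
        = (\<Sum>l\<in>L. q l b)"
      by (simp add: interv_sum_list_conv_sum_set_nat atLeast0LessThan)
  qed
  \<comment> \<open>Double counting of the disagreements between the rows of one kind and the outer
    columns.\<close>
  have dis: "disagreements n P = map (\<lambda>x. \<Sum>l\<in>L. int (u l x)) P"
    unfolding disagreements_def
  proof (intro map_cong refl)
    fix x assume x: "x \<in> set P"
    define I where "I = {i \<in> R. agreement a i js = fst x}"
    have finI: "finite I" using fin(1) by (simp add: I_def)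
    have each: "(\<Sum>l\<in>L. if a i l \<noteq> a i (hd js) then 1 else 0) = int n - int (length (filter Not (fst x)))"
      if i: "i \<in> I" for i
    proof -
      have iR: "i \<in> R" and ag: "fst x = agreement a i js" using i by (auto simp: I_def)
      have "2 * (\<Sum>l\<in>C. if a i l \<noteq> a i (hd js) then 1 else 0 :: int) = (\<Sum>l\<in>C. 1 - a' i l)"
        unfolding sum_distrib_left using a'pm[OF iR] by (intro sum.cong) auto
      also have "\<dots> = 2 * int n"
        using M' iR cardC by (simp add: splitting_matrix_def sum_subtractf)
      finally have "(\<Sum>l\<in>C. if a i l \<noteq> a i (hd js) then 1 else 0 :: int) = int n" by simp
      moreover have "(\<Sum>l\<in>C. if a i l \<noteq> a i (hd js) then 1 else 0 :: int) =
          (\<Sum>l\<in>set js. if a i l \<noteq> a i (hd js) then 1 else 0) + (\<Sum>l\<in>L. if a i l \<noteq> a i (hd js) then 1 else 0)"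
        using L by (simp only: L(2)) (rule sum.union_disjoint; simp)
      moreover have "(\<Sum>l\<in>set js. if a i l \<noteq> a i (hd js) then 1 else 0 :: int) = int (length (filter Not (fst x)))"
      proof -
        have "(\<Sum>l\<in>set js. if a i l \<noteq> a i (hd js) then 1 else 0 :: int) =
            int (card {l \<in> set js. a i l \<noteq> a i (hd js)})"
          by (simp add: sum.If_cases Int_def)
        also have "{l \<in> set js. a i l \<noteq> a i (hd js)} = set (filter (\<lambda>l. a i l \<noteq> a i (hd js)) js)" by auto
        also have "card \<dots> = length (filter (\<lambda>l. a i l \<noteq> a i (hd js)) js)"
          using js'(2) by (intro distinct_card) simp
        finally show ?thesis by (simp add: ag agreement_def filter_map comp_def)
      qed
      ultimately show ?thesis by simp
    qed
    have "(\<Sum>l\<in>L. int (u l x)) = (\<Sum>l\<in>L. \<Sum>i\<in>I. if a i l \<noteq> a i (hd js) then 1 else 0)"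
    proof (intro sum.cong refl)
      fix l
      have "{i \<in> R. agreement a i js = fst x \<and> a i l \<noteq> a i (hd js)} = {i \<in> I. a i l \<noteq> a i (hd js)}"
        by (auto simp: I_def)
      then show "int (u l x) = (\<Sum>i\<in>I. if a i l \<noteq> a i (hd js) then 1 else 0)"
        using finI by (simp add: u_def sum.If_cases Int_def)
    qed
    also have "\<dots> = (\<Sum>i\<in>I. \<Sum>l\<in>L. if a i l \<noteq> a i (hd js) then 1 else 0)"
      by (rule sum.swap)
    also have "\<dots> = int (snd x) * (int n - int (length (filter Not (fst x))))"
      using each cnt[OF x] by (simp add: I_def)
    finally show "(case x of (v, m) \<Rightarrow> int m * (int n - int (length (filter Not v)))) = (\<Sum>l\<in>L. int (u l x))"
      by (simp add: case_prod_beta)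
  qed
  show False
  proof (rule run_steps_sound[OF L(1) \<open>L \<noteq> {}\<close>, of "\<lambda>l. map (u l) P" "\<lambda>l. map (q l) evens"
        _ steps _ _ "\<lambda>l x. int (u l x)" P q evens])
    show "(map (u l) P, map (q l) evens) \<in> set (filter (\<lambda>x. fst x \<notin> set (map fst ch)) (classes P odds evens))"
      if "l \<in> L" for l using cls[OF that] nochild[OF that] by simp
    show "run_steps steps (int (card L)) (own_terms P evens k) (disagreements n P)
        (Some (filter (\<lambda>x. fst x \<notin> set (map fst ch)) (classes P odds evens)))"
      using run by (simp only: cardL)
  qed (simp_all add: own dis)
qed

lemma check_entries_sound:
  assumes M: "splitting_matrix R C a" and n: "card R = n"
    and Ps: "\<And>i js. i < length Ps \<Longrightarrow> \<not> realizes R C a js (Ps ! i)"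
    and chk: "check_entries n Ps es" and e: "e \<in> set es"
  shows "\<not> realizes R C a js (fst e)"
  using Ps chk e
proof (induction es arbitrary: Ps)
  case (Cons e' es)
  obtain P ch odds evens steps where e': "e' = (P, ch, odds, evens, steps)" by (cases e')
  have new: "\<not> realizes R C a js (fst e')" for js
    using check_entry_sound[OF M n Cons.prems(1), of P ch odds evens steps js] Cons.prems(2)
    by (simp add: e')
  then have "\<not> realizes R C a js ((Ps @ [fst e']) ! i)" if "i < length (Ps @ [fst e'])" for i js
    using Cons.prems(1) that by (auto simp: nth_append less_Suc_eq)
  from Cons.IH[OF this] Cons.prems(2,3) new show ?case by auto
qed simp

section \<open>Cyclic matrices\<close>

definition has_chain :: "'r set \<Rightarrow> 'c set \<Rightarrow> ('r \<Rightarrow> 'c \<Rightarrow> int) \<Rightarrow> bool" where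
  "has_chain R C a \<longleftrightarrow> (\<exists>p\<in>C. \<exists>q\<in>C. \<exists>s\<in>C. \<exists>r\<in>R. \<exists>t\<in>R. r \<noteq> t \<and>
     (\<forall>i\<in>R. a i q = (if i = r then - a i p else a i p)) \<and>
     (\<forall>i\<in>R. a i s = (if i = t then - a i q else a i q)))"

lemma has_chain_if_realizes:
  assumes M: "splitting_matrix R C a" and js: "realizes R C a js (chain_pattern (card R))"
  shows "has_chain R C a"
proof -
  have fin: "finite R" using M by (simp add: splitting_matrix_def)
  have cnt: "card {i \<in> R. agreement a i js = v} = pattern_count (chain_pattern (card R)) v" for v
    using realizes_card[OF fin js] .
  have "pattern_count (chain_pattern m) [True, False, False] = 1"
    "pattern_count (chain_pattern m) [True, False, True] = 1" for m
    by (simp_all add: pattern_count_def chain_pattern_def)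
  then have c: "card {i \<in> R. agreement a i js = [True, False, False]} = 1"
    "card {i \<in> R. agreement a i js = [True, False, True]} = 1"
    by (simp_all only: cnt)
  obtain r where rt1: "{i \<in> R. agreement a i js = [True, False, False]} = {r}"
    using c(1) by (rule card_1_singletonE)
  obtain t where rt2: "{i \<in> R. agreement a i js = [True, False, True]} = {t}"
    using c(2) by (rule card_1_singletonE)
  note rt = rt1 rt2
  then have "agreement a r js = [True, False, False]" by blast
  then have "length js = 3" unfolding agreement_def by (metis One_nat_def Suc_1 length_Cons length_map list.size(3) numeral_3_eq_3)
  then obtain p s q where jsq: "js = [p, s, q]"
    by (auto simp: numeral_3_eq_3 length_Suc_conv)
  have psq: "p \<in> C" "s \<in> C" "q \<in> C" using js by (auto simp: realizes_def jsq)
  have pm: "a i j = 1 \<or> a i j = - 1" if "i \<in> R" "j \<in> C" for i j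
    using M that by (auto simp: splitting_matrix_def)
  have rest: "agreement a i js = [True, True, True]" if i: "i \<in> R" "i \<noteq> r" "i \<noteq> t" for i
  proof (rule ccontr)
    assume n: "\<not> ?thesis"
    have "agreement a i js \<noteq> [True, False, False]" "agreement a i js \<noteq> [True, False, True]"
      using rt i by auto
    with n have "pattern_count (chain_pattern (card R)) (agreement a i js) = 0"
      by (simp add: pattern_count_def chain_pattern_def)
    then have "card {i' \<in> R. agreement a i' js = agreement a i js} = 0" by (simp only: cnt)
    then show False using fin i(1) by auto
  qed
  have r: "r \<in> R" "a r s \<noteq> a r p" "a r q \<noteq> a r p" using rt(1) by (auto simp: jsq agreement_def)
  have t: "t \<in> R" "a t s \<noteq> a t p" "a t q = a t p" using rt(2) by (auto simp: jsq agreement_def)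
  have o: "a i s = a i p" "a i q = a i p" if "i \<in> R" "i \<noteq> r" "i \<noteq> t" for i
    using rest[OF that] by (auto simp: jsq agreement_def)
  have "a r s = - a r p" "a r q = - a r p" "a t s = - a t p"
    using r t pm psq by (metis minus_equation_iff)+
  note neg = this
  have ch1: "\<forall>i\<in>R. a i q = (if i = r then - a i p else a i p)"
    using neg t(3) o(2) by auto
  have ch2: "\<forall>i\<in>R. a i s = (if i = t then - a i q else a i q)"
  proof
    fix i assume "i \<in> R"
    then show "a i s = (if i = t then - a i q else a i q)"
      using neg t(3) o by (cases "i = r"; cases "i = t") auto
  qed
  have "r \<noteq> t" using r(3) t(3) by auto
  with ch1 ch2 psq r(1) t(1) show ?thesis unfolding has_chain_def by blast
qed

lemma has_chain_certificate:
  assumes M: "splitting_matrix R C a"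
    and chk: "check_entries (card R) [chain_pattern (card R)] es"
    and js: "realizes R C a js P" "P \<in> fst ` set es"
  shows "has_chain R C a"
proof (rule ccontr)
  assume no: "\<not> has_chain R C a"
  obtain e where e: "e \<in> set es" "P = fst e" using js(2) by auto
  have "\<not> realizes R C a js (fst e)"
  proof (rule check_entries_sound[OF M refl _ chk e(1)])
    show "\<not> realizes R C a js' ([chain_pattern (card R)] ! i)"
      if "i < length [chain_pattern (card R)]" for i js'
      using no has_chain_if_realizes[OF M, of js'] that by auto
  qed
  with js(1) e(2) show False by simp
qed

text \<open>Any single column realises the one-column pattern, so a certificate that excludes this
  pattern refutes the absence of chains.\<close>

lemma has_chain_certificate_column:
  assumes M: "splitting_matrix R C a" and R: "R \<noteq> {}"
    and chk: "check_entries (card R) [chain_pattern (card R)] es"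
    and P: "[([True], card R)] \<in> fst ` set es"
  shows "has_chain R C a"
proof -
  have "finite R" using M by (simp add: splitting_matrix_def)
  with R M have "card C \<noteq> 0" by (auto simp: splitting_matrix_def)
  then obtain p where "p \<in> C" by fastforce
  then have "realizes R C a [p] [([True], card R)]"
    using \<open>finite R\<close> by (simp add: realizes_def agreement_def pattern_mset_def image_mset_const_eq)
  then show ?thesis using has_chain_certificate[OF M chk _ P] by blast
qed

text \<open>The variant for n = 4: a single column also occurs in the exceptional matrix, which has
  no chain, so an antipodal pair takes its place.\<close>

lemma has_chain_certificate_antipodal:
  assumes M: "splitting_matrix R C a" and R: "R \<noteq> {}"
    and chk: "check_entries (card R) [chain_pattern (card R)] es"
    and P: "[([True, False], card R)] \<in> fst ` set es"
    and pq: "p \<in> C" "q \<in> C" "\<And>i. i \<in> R \<Longrightarrow> a i q = - a i p"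
  shows "has_chain R C a"
proof -
  have fin: "finite R" using M by (simp add: splitting_matrix_def)
  have pm: "a i p = 1 \<or> a i p = - 1" if "i \<in> R" for i
    using M that pq(1) by (auto simp: splitting_matrix_def)
  have ne: "p \<noteq> q" using pq(3) pm R by fastforce
  have "image_mset (\<lambda>i. agreement a i [p, q]) (mset_set R) = image_mset (\<lambda>i. [True, False]) (mset_set R)"
  proof (rule image_mset_cong)
    fix i assume "i \<in># mset_set R"
    then have "i \<in> R" using fin by simp
    from pq(3)[OF this] pm[OF this] show "agreement a i [p, q] = [True, False]"
      by (auto simp: agreement_def)
  qed
  then have "realizes R C a [p, q] [([True, False], card R)]"
    using fin pq ne by (simp add: realizes_def pattern_mset_def image_mset_const_eq)
  then show ?thesis using has_chain_certificate[OF M chk _ P] by blast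
qed

section \<open>Cyclic arrangements of the columns\<close>

text \<open>The columns lie on a cycle of length 2n, and \<open>\<rho> t\<close> is the only row
  that changes sign between \<open>d t\<close> and \<open>d (t + 1)\<close>. Period n for
  \<open>\<rho>\<close> makes each row change at two opposite steps. Indexing by all integers turns
  shifts and reflections into substitutions.\<close>

definition standard_matrix :: "'r set \<Rightarrow> 'c set \<Rightarrow> ('r \<Rightarrow> 'c \<Rightarrow> int) \<Rightarrow> (int \<Rightarrow> 'c) \<Rightarrow> (int \<Rightarrow> 'r) \<Rightarrow> bool" where
  "standard_matrix R C a d \<rho> \<longleftrightarrow> range d = C \<and> range \<rho> = R \<and>
     (\<forall>t. d (t + 2 * int (card R)) = d t) \<and> (\<forall>t. \<rho> (t + int (card R)) = \<rho> t) \<and>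
     (\<forall>t. \<forall>i\<in>R. a i (d (t + 1)) = (if i = \<rho> t then - a i (d t) else a i (d t)))"

lemma range_surj: "surj g \<Longrightarrow> range (\<lambda>t. f (g t)) = range f"
  by (simp flip: image_image)

lemma standard_matrix_shift:
  assumes "standard_matrix R C a d \<rho>"
  shows "standard_matrix R C a (\<lambda>t. d (t + s)) (\<lambda>t. \<rho> (t + s))"
proof -
  have "surj (\<lambda>t. t + s)" by (rule surjI[of _ "\<lambda>t. t - s"]) simp
  then have "range (\<lambda>t. d (t + s)) = range d" "range (\<lambda>t. \<rho> (t + s)) = range \<rho>"
    by (rule range_surj)+
  moreover have "d (t + 2 * int (card R) + s) = d (t + s)" for t
  proof -
    have "d ((t + s) + 2 * int (card R)) = d (t + s)"
      using assms unfolding standard_matrix_def by blast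
    then show ?thesis by (simp add: algebra_simps)
  qed
  moreover have "\<rho> (t + int (card R) + s) = \<rho> (t + s)" for t
  proof -
    have "\<rho> ((t + s) + int (card R)) = \<rho> (t + s)"
      using assms unfolding standard_matrix_def by blast
    then show ?thesis by (simp add: algebra_simps)
  qed
  moreover have "a i (d (t + 1 + s)) = (if i = \<rho> (t + s) then - a i (d (t + s)) else a i (d (t + s)))"
    if "i \<in> R" for i t
  proof -
    have "a i (d ((t + s) + 1)) = (if i = \<rho> (t + s) then - a i (d (t + s)) else a i (d (t + s)))"
      using assms that unfolding standard_matrix_def by blast
    moreover have "(t + s) + 1 = t + 1 + s" by simp
    ultimately show ?thesis by (simp only:)
  qed
  ultimately show ?thesis using assms unfolding standard_matrix_def by simp
qed

text \<open>The new step from t to t + 1 is the old step from -t - 1 to -t run backwards, whence the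
  offset in \<open>\<rho>\<close>.\<close>

lemma standard_matrix_reflect:
  assumes "standard_matrix R C a d \<rho>"
  shows "standard_matrix R C a (\<lambda>t. d (- t)) (\<lambda>t. \<rho> (- t - 1))"
proof -
  have u: "surj (uminus :: int \<Rightarrow> int)" by (rule surjI[of _ uminus]) simp
  have v: "surj (\<lambda>t. - t - 1 :: int)" by (rule surjI[of _ "\<lambda>t. - t - 1"]) simp
  have "range (\<lambda>t. d (- t)) = range d" using range_surj[OF u, of d] .
  moreover have "range (\<lambda>t. \<rho> (- t - 1)) = range \<rho>" using range_surj[OF v, of \<rho>] .
  moreover have "d (- (t + 2 * int (card R))) = d (- t)" for t
  proof -
    have "d (- (t + 2 * int (card R)) + 2 * int (card R)) = d (- (t + 2 * int (card R)))"
      using assms unfolding standard_matrix_def by blast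
    then show ?thesis by (simp add: algebra_simps)
  qed
  moreover have "\<rho> (- (t + int (card R)) - 1) = \<rho> (- t - 1)" for t
  proof -
    have "\<rho> ((- (t + int (card R)) - 1) + int (card R)) = \<rho> (- (t + int (card R)) - 1)"
      using assms unfolding standard_matrix_def by blast
    moreover have "(- (t + int (card R)) - 1) + int (card R) = - t - 1" by simp
    ultimately show ?thesis by (simp only:)
  qed
  moreover have "a i (d (- (t + 1))) = (if i = \<rho> (- t - 1) then - a i (d (- t)) else a i (d (- t)))"
    if "i \<in> R" for i t
  proof -
    have "a i (d ((- t - 1) + 1)) = (if i = \<rho> (- t - 1) then - a i (d (- t - 1)) else a i (d (- t - 1)))"
      using assms that unfolding standard_matrix_def by blast
    moreover have "(- t - 1) + 1 = - t" "- (t + 1) = - t - 1" by simp_all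
    moreover have "a i (d (- t - 1)) = - a i (d (- t)) \<longleftrightarrow> a i (d (- t)) = - a i (d (- t - 1))"
      by auto
    ultimately show ?thesis by (simp split: if_splits)
  qed
  ultimately show ?thesis using assms unfolding standard_matrix_def by simp
qed

lemma periodic_mod:
  fixes f :: "int \<Rightarrow> 'a"
  assumes period: "\<And>t. f (t + N) = f t" and N: "N > 0"
  shows "f (t mod N) = f t"
proof -
  have nat: "f (t + N * int m) = f t" for t m
  proof (induction m)
    case (Suc m)
    have "f ((t + N * int m) + N) = f (t + N * int m)" by (rule period)
    moreover have "(t + N * int m) + N = t + N * int (Suc m)" by (simp add: algebra_simps)
    ultimately show ?case using Suc by simp
  qed simp
  show ?thesis
  proof (cases "t div N \<ge> 0")
    case True
    have "f (t mod N + N * int (nat (t div N))) = f (t mod N)" by (rule nat)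
    then show ?thesis using True by simp
  next
    case False
    have "f (t + N * int (nat (- (t div N)))) = f t" by (rule nat)
    then show ?thesis using False by (simp add: minus_mult_div_eq_mod)
  qed
qed

lemma inj_on_period:
  fixes f :: "int \<Rightarrow> 'a"
  assumes period: "\<And>t. f (t + int N) = f t" and N: "N > 0" and card: "card (range f) = N"
  shows "f ` {0..<int N} = range f" "inj_on f {0..<int N}"
proof -
  have "f t \<in> f ` {0..<int N}" for t
    using periodic_mod[of f "int N" t] period N by (intro image_eqI[of _ _ "t mod int N"]) auto
  then show im: "f ` {0..<int N} = range f" by auto
  show "inj_on f {0..<int N}"
    by (rule eq_card_imp_inj_on) (simp_all add: im card)
qed

text \<open>The first n steps change distinct rows, so no entry changes back.\<close>

lemma standard_matrix_steps:
  assumes std: "standard_matrix R C a d \<rho>" and R: "card R > 0" and z: "z \<le> card R" and i: "i \<in> R"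
  shows "a i (d (int z)) = (if i \<in> \<rho> ` {0..<int z} then - a i (d 0) else a i (d 0))"
  using z
proof (induction z)
  case (Suc z)
  have inj: "inj_on \<rho> {0..<int (card R)}"
    using std R by (intro inj_on_period(2)) (auto simp: standard_matrix_def)
  have "{0..<int (Suc z)} = insert (int z) {0..<int z}" by auto
  then have im: "\<rho> ` {0..<int (Suc z)} = insert (\<rho> (int z)) (\<rho> ` {0..<int z})" by simp
  have new: "\<rho> (int z) \<notin> \<rho> ` {0..<int z}"
    using inj_onD[OF inj, of "int z"] Suc.prems by force
  have "a i (d (int z + 1)) = (if i = \<rho> (int z) then - a i (d (int z)) else a i (d (int z)))"
    using std i unfolding standard_matrix_def by blast
  moreover have "d (int (Suc z)) = d (int z + 1)" by (simp add: add.commute)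
  moreover have "a i (d (int z)) = (if i \<in> \<rho> ` {0..<int z} then - a i (d 0) else a i (d 0))"
    using Suc by simp
  ultimately show ?case unfolding im using new by auto
qed simp

text \<open>Columns that differ in a single row are neighbours on the cycle, because y <= n steps
  change exactly y rows. Shifting moves \<open>c\<close> to position 0, and a reflection, if
  necessary, brings \<open>c'\<close> within n steps.\<close>

lemma standard_matrix_edge:
  assumes M: "splitting_matrix R C a" and std: "standard_matrix R C a d \<rho>"
    and c: "c \<in> C" "c' \<in> C" and r: "r \<in> R"
    and cc': "\<And>i. i \<in> R \<Longrightarrow> a i c' = (if i = r then - a i c else a i c)"
  obtains d' \<rho>' where "standard_matrix R C a d' \<rho>'" "d' 0 = c" "d' 1 = c'" "\<rho>' 0 = r"
proof -
  define n where "n = card R"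
  have n: "n > 0" using M r by (auto simp: n_def splitting_matrix_def card_gt_0_iff)
  have cardC: "card C = 2 * n" using M by (simp add: n_def splitting_matrix_def)
  have nz: "a i c \<noteq> 0" if "i \<in> R" for i using M that c by (force simp: splitting_matrix_def)
  obtain x where x: "c = d x" using c(1) std by (auto simp: standard_matrix_def)
  define d1 \<rho>1 where "d1 = (\<lambda>t. d (t + x))" and "\<rho>1 = (\<lambda>t. \<rho> (t + x))"
  have std1: "standard_matrix R C a d1 \<rho>1"
    unfolding d1_def \<rho>1_def by (rule standard_matrix_shift[OF std])
  have d10: "d1 0 = c" by (simp add: d1_def x)
  have "d1 ` {0..<int (2 * n)} = range d1"
    using std1 n cardC by (intro inj_on_period(1)) (auto simp: standard_matrix_def n_def)
  then have "c' \<in> d1 ` {0..<int (2 * n)}" using c(2) std1 by (simp add: standard_matrix_def)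
  then obtain z where z: "c' = d1 z" "0 \<le> z" "z < 2 * int n" by auto
  have "c \<noteq> c'" using cc'[OF r] nz[OF r] by auto
  then have "z \<noteq> 0" using z d10 by auto
  have "\<exists>d' \<rho>' y. standard_matrix R C a d' \<rho>' \<and> d' 0 = c \<and> d' (int y) = c' \<and> y \<le> n"
  proof (cases "z \<le> int n")
    case True
    with z std1 d10 show ?thesis
      by (intro exI[of _ d1] exI[of _ \<rho>1] exI[of _ "nat z"]) auto
  next
    case False
    have "d1 ((z - 2 * int n) + 2 * int n) = d1 (z - 2 * int n)"
      using std1 unfolding standard_matrix_def n_def by blast
    then have "d1 (- int (nat (2 * int n - z))) = c'" using z by simp
    with False standard_matrix_reflect[OF std1] d10 show ?thesis
      by (intro exI[of _ "\<lambda>t. d1 (- t)"] exI[of _ "\<lambda>t. \<rho>1 (- t - 1)"] exI[of _ "nat (2 * int n - z)"]) auto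
  qed
  then obtain d' \<rho>' y where std': "standard_matrix R C a d' \<rho>'" and d': "d' 0 = c" "d' (int y) = c'"
    and y: "y \<le> n" by blast
  have inj: "inj_on \<rho>' {0..<int n}"
    using std' n unfolding n_def by (intro inj_on_period(2)) (auto simp: standard_matrix_def)
  have "\<rho>' ` {0..<int y} = {r}"
  proof -
    have "i \<in> \<rho>' ` {0..<int y} \<longleftrightarrow> i = r" if "i \<in> R" for i
      using standard_matrix_steps[OF std' _ _ that, of y] n y cc'[OF that] nz[OF that]
      by (auto simp: d' n_def split: if_splits)
    moreover have "\<rho>' ` {0..<int y} \<subseteq> R" using std' by (auto simp: standard_matrix_def)
    ultimately show ?thesis using r by blast
  qed
  moreover have "card (\<rho>' ` {0..<int y}) = y"
    using inj_on_subset[OF inj, of "{0..<int y}"] y by (subst card_image) auto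
  ultimately have y1: "y = 1" by simp
  with \<open>\<rho>' ` {0..<int y} = {r}\<close> have "\<rho>' 0 = r" by auto
  show thesis
    by (rule that[OF std' d'(1)]) (use d'(2) y1 \<open>\<rho>' 0 = r\<close> in simp_all)
qed

text \<open>On the smaller cycle p and s are neighbours joined by a change of row t. Row r copies t
  there up to sign, so it changes at the same two opposite steps. Inserting q at one of them and
  \<open>q'\<close> at the other separates the two changes, that of r coming directly before that of
  t.\<close>

lemma standard_matrix_insert:
  assumes M: "splitting_matrix R C a" and mem: "p \<in> C" "q \<in> C" "q' \<in> C" "r \<in> R" "t \<in> R" "r \<noteq> t"
    and pq: "\<And>i. i \<in> R \<Longrightarrow> a i q = (if i = r then - a i p else a i p)"
    and qs: "\<And>i. i \<in> R \<Longrightarrow> a i s = (if i = t then - a i q else a i q)"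
    and q': "\<And>i. i \<in> R \<Longrightarrow> a i q' = - a i q"
    and rt: "\<And>l. l \<in> C \<Longrightarrow> l \<noteq> q \<Longrightarrow> l \<noteq> q' \<Longrightarrow> a r l * a r p = a t l * a t p"
    and std: "standard_matrix (R - {r}) (C - {q, q'}) a d \<rho>"
    and start: "d 0 = p" "d 1 = s" "\<rho> 0 = t"
  shows "\<exists>d \<rho>. standard_matrix R C a d \<rho>"
proof -
  define m where "m = int (card (R - {r}))"
  define n where "n = m + 1"
  have fin: "finite R" using M by (simp add: splitting_matrix_def)
  have "t \<in> R - {r}" using mem by auto
  then have cR': "card (R - {r}) > 0" using fin by (auto simp: card_gt_0_iff)
  then have m: "m \<ge> 1" unfolding m_def by linarith
  have n: "n = int (card R)" using card_Suc_Diff1[OF fin mem(4)] unfolding n_def m_def by linarith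
  have pm: "a i j = 1 \<or> a i j = - 1" if "i \<in> R" "j \<in> C" for i j
    using M that by (auto simp: splitting_matrix_def)
  have rd: "range d = C - {q, q'}" and r\<rho>: "range \<rho> = R - {r}"
    and pd: "\<And>x. d (x + 2 * m) = d x" and p\<rho>: "\<And>x. \<rho> (x + m) = \<rho> x"
    and step: "\<And>x i. i \<in> R \<Longrightarrow> i \<noteq> r \<Longrightarrow> a i (d (x + 1)) = (if i = \<rho> x then - a i (d x) else a i (d x))"
    using std by (auto simp: standard_matrix_def m_def)
  have dC: "d x \<in> C" "d x \<noteq> q" "d x \<noteq> q'" for x using rd by auto
  have \<rho>R: "\<rho> x \<in> R" "\<rho> x \<noteq> r" for x using r\<rho> by auto
  have inj: "inj_on \<rho> {0..<m}"
    unfolding m_def using cR' p\<rho> r\<rho> by (intro inj_on_period(2)) (auto simp: m_def)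
  have ne0: "\<rho> x \<noteq> t" if "0 < x" "x < m" for x
    using inj_onD[OF inj, of x 0] that start(3) by auto
  have anti: "a i (d m) = - a i p" if "i \<in> R" "i \<noteq> r" for i
  proof -
    have "\<rho> ` {0..<m} = R - {r}"
      unfolding m_def using inj_on_period(1)[of \<rho> "card (R - {r})"] p\<rho> r\<rho> cR' by (simp add: m_def)
    then show ?thesis
      using standard_matrix_steps[OF std cR' order_refl, of i] that start(1) by (simp add: m_def)
  qed
  have row_r: "a r (d x) = a t (d x) * a t p * a r p" for x
    using rt[OF dC[of x]] pm[OF mem(4,1)] by auto
  \<comment> \<open>Positions 0 and 1 hold p and q, positions 2 to n hold \<open>d 1\<close> to
    \<open>d m\<close>, position n + 1 holds \<open>q'\<close>, and the rest continues with
    \<open>d (m + 1)\<close>; the shifts by 1 and 2 count the insertions passed.\<close>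
  define f where "f k = (if k = 0 then p else if k = 1 then q else if k \<le> n then d (k - 1)
      else if k = n + 1 then q' else d (k - 2))" for k
  define g where "g k = (if k = 0 then r else \<rho> (k - 1))" for k
  define e where "e x = f (x mod (2 * n))" for x
  define \<sigma> where "\<sigma> x = g (x mod n)" for x
  have n2: "n \<ge> 2" using m by (simp add: n_def)
  have main: "a i (f ((k + 1) mod (2 * n))) = (if i = g (k mod n) then - a i (f k) else a i (f k))"
    if k: "0 \<le> k" "k < 2 * n" and i: "i \<in> R" for k i
  proof -
    have low: "f k = d (k - 1)" if "2 \<le> k" "k \<le> n" for k using that by (simp add: f_def)
    have high: "f ((k + 1) mod (2 * n)) = d (k - 1)" if "n < k" "k < 2 * n"
    proof (cases "k + 1 = 2 * n")
      case True
      have "d (0 + 2 * m) = p" using pd[of 0] start(1) by simp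
      moreover have "k - 1 = 0 + 2 * m" using True by (simp add: n_def)
      ultimately show ?thesis using True by (simp add: f_def)
    next
      case False
      then have "(k + 1) mod (2 * n) = k + 1" using that n2 by simp
      then show ?thesis using that n2 by (simp add: f_def)
    qed
    consider "k = 0" | "k = 1" | "2 \<le> k" "k < n" | "k = n" | "k = n + 1" | "n + 2 \<le> k" using k by linarith
    then show ?thesis
    proof cases
      case 1
      then show ?thesis using n2 pq[OF i] by (simp add: f_def g_def)
    next
      case 2
      then have "f ((k + 1) mod (2 * n)) = s" "g (k mod n) = t" "f k = q"
        using n2 start by (simp_all add: f_def g_def)
      then show ?thesis using qs[OF i] by simp
    next
      case 3
      then have *: "f ((k + 1) mod (2 * n)) = d k" "f k = d (k - 1)" "g (k mod n) = \<rho> (k - 1)"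
        by (simp_all add: f_def g_def)
      have "\<rho> (k - 1) \<noteq> t" using 3 by (intro ne0) (simp_all add: n_def)
      then have "a t (d k) = a t (d (k - 1))" using step[of t "k - 1"] mem by simp
      then show ?thesis unfolding *
        using step[OF i, of "k - 1"] row_r[of k] row_r[of "k - 1"] \<rho>R(2)[of "k - 1"] by (cases "i = r") auto
    next
      case 4
      then have *: "f ((k + 1) mod (2 * n)) = q'" "f k = d m" "g (k mod n) = r"
        using n2 by (simp_all add: f_def g_def n_def)
      have "a r (d m) = - a r p"
        using row_r[of m] anti[of t] mem pm[OF mem(5,1)] by auto
      then show ?thesis unfolding * using q'[OF i] pq[OF i] anti[OF i] by auto
    next
      case 5
      have k1: "k mod n = 1" using 5 n2 by (simp add: mod_add_self1)
      have "f ((k + 1) mod (2 * n)) = d (k - 1)" using 5 n2 k by (intro high) simp_all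
      moreover have "k - 1 = m + 1" using 5 by (simp add: n_def)
      ultimately have "f ((k + 1) mod (2 * n)) = d (m + 1)" by (simp only:)
      moreover have "f k = q'" "g (k mod n) = t"
        using 5 n2 start(3) unfolding k1 by (simp_all add: f_def g_def)
      ultimately have *: "f ((k + 1) mod (2 * n)) = d (m + 1)" "f k = q'" "g (k mod n) = t"
        by (simp_all only:)
      have \<rho>m: "\<rho> m = t" using p\<rho>[of 0] start(3) by simp
      then have "a t (d (m + 1)) = a t p" using step[of t m] anti[of t] mem by simp
      then have "a r (d (m + 1)) = a r p" using row_r[of "m + 1"] pm[OF mem(5,1)] by auto
      then show ?thesis unfolding *
        using step[OF i, of m] anti[OF i] q'[OF i] pq[OF i] \<rho>m mem(6) by (cases "i = r") auto
    next
      case 6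
      have "k mod n = (k - n) mod n" by simp
      also have "\<dots> = k - n" using 6 k n2 by (intro mod_pos_pos_trivial) simp_all
      finally have kn: "k mod n = k - n" .
      have *: "f ((k + 1) mod (2 * n)) = d (k - 1)" "f k = d (k - 2)"
        using high 6 k n2 by (simp_all add: f_def)
      have "g (k mod n) = \<rho> (k - n - 1)" unfolding kn using 6 by (simp add: g_def)
      also have "\<dots> = \<rho> (k - 2)" using p\<rho>[of "k - n - 1"] by (simp add: n_def)
      finally have g: "g (k mod n) = \<rho> (k - 2)" .
      have "\<rho> (k - n - 1) \<noteq> t" using 6 k by (intro ne0) (simp_all add: n_def)
      then have "\<rho> (k - 2) \<noteq> t" using p\<rho>[of "k - n - 1"] by (simp add: n_def)
      then have "a t (d (k - 1)) = a t (d (k - 2))" using step[of t "k - 2"] mem by simp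
      then show ?thesis unfolding * g
        using step[OF i, of "k - 2"] row_r[of "k - 1"] row_r[of "k - 2"] \<rho>R(2)[of "k - 2"] by (cases "i = r") auto
    qed
  qed
  have "standard_matrix R C a e \<sigma>"
    unfolding standard_matrix_def n[symmetric]
  proof (intro conjI allI ballI)
    show "range e = C"
    proof
      show "range e \<subseteq> C" using mem dC by (auto simp: e_def f_def)
      show "C \<subseteq> range e"
      proof
        fix l assume l: "l \<in> C"
        have e: "e x = f x" if "0 \<le> x" "x < 2 * n" for x using that by (simp add: e_def)
        consider "l = q" | "l = q'" | "l \<in> range d" using l rd by auto
        then show "l \<in> range e"
        proof cases
          case 1
          then have "l = e 1" using n2 by (simp add: e f_def)
          then show ?thesis by blast
        next
          case 2
          then have "l = e (n + 1)" using n2 by (simp add: e f_def)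
          then show ?thesis by blast
        next
          case 3
          then obtain x where "l = d x" by auto
          then have x: "l = d (x mod (2 * m))" using periodic_mod[of d "2 * m" x] pd m by simp
          define k where "k = x mod (2 * m)"
          have k: "0 \<le> k" "k < 2 * m" using m by (simp_all add: k_def)
          consider "k = 0" | "1 \<le> k" "k \<le> m" | "m < k" using k by linarith
          then have "l = e (if k = 0 then 0 else if k \<le> m then k + 1 else k + 2)"
            unfolding x k_def[symmetric] using k start(1) n2
            by cases (simp_all add: e f_def n_def)
          then show ?thesis by blast
        qed
      qed
    qed
    show "range \<sigma> = R"
    proof
      show "range \<sigma> \<subseteq> R" using mem \<rho>R by (auto simp: \<sigma>_def g_def)
      show "R \<subseteq> range \<sigma>"
      proof
        fix i assume "i \<in> R"
        then consider "i = r" | "i \<in> range \<rho>" using r\<rho> by auto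
        then show "i \<in> range \<sigma>"
        proof cases
          case 1
          then have "i = \<sigma> 0" by (simp add: \<sigma>_def g_def)
          then show ?thesis by blast
        next
          case 2
          then obtain x where "i = \<rho> x" by auto
          then have x: "i = \<rho> (x mod m)" using periodic_mod[of \<rho> m x] p\<rho> m by simp
          have "0 \<le> x mod m" "x mod m < m" using m by simp_all
          then have "(x mod m + 1) mod n = x mod m + 1" by (simp add: n_def)
          then have "i = \<sigma> (x mod m + 1)"
            unfolding x using \<open>0 \<le> x mod m\<close> by (simp add: \<sigma>_def g_def)
          then show ?thesis by blast
        qed
      qed
    qed
    show "e (x + 2 * n) = e x" for x by (simp add: e_def)
    show "\<sigma> (x + n) = \<sigma> x" for x by (simp add: \<sigma>_def)
    fix x i assume i: "i \<in> R"
    have "x mod (2 * n) mod n = x mod n" by (simp add: mod_mod_cancel)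
    moreover have "(x mod (2 * n) + 1) mod (2 * n) = (x + 1) mod (2 * n)" by (simp add: mod_simps)
    ultimately show "a i (e (x + 1)) = (if i = \<sigma> x then - a i (e x) else a i (e x))"
      using main[of "x mod (2 * n)" i] i n2 by (simp add: e_def \<sigma>_def)
  qed
  then show ?thesis by blast
qed

section \<open>The exceptional matrix\<close>

text \<open>Off q and \<open>q'\<close> the rows r and t agree up to sign, so a set split by r is
  also split by t; the antipodal columns cancel in every row sum.\<close>

lemma splitting_matrix_reduce:
  assumes M: "splitting_matrix R C a" and mem: "p \<in> C" "q \<in> C" "q' \<in> C" "r \<in> R" "t \<in> R" "r \<noteq> t"
    and q': "\<And>i. i \<in> R \<Longrightarrow> a i q' = - a i q"
    and rt: "\<And>l. l \<in> C \<Longrightarrow> l \<noteq> q \<Longrightarrow> l \<noteq> q' \<Longrightarrow> a r l * a r p = a t l * a t p"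
  shows "splitting_matrix (R - {r}) (C - {q, q'}) a"
proof -
  have fin: "finite R" "finite C" using M by (auto simp: splitting_matrix_def)
  have pm: "a i j = 1 \<or> a i j = - 1" if "i \<in> R" "j \<in> C" for i j
    using M that by (auto simp: splitting_matrix_def)
  have ne: "q \<noteq> q'" using q'[OF mem(4)] pm[OF mem(4,2)] by auto
  have sum0: "(\<Sum>j\<in>C - {q, q'}. a i j) = 0" if i: "i \<in> R" for i
  proof -
    have "(\<Sum>j\<in>C. a i j) = a i q + (a i q' + (\<Sum>j\<in>C - {q} - {q'}. a i j))"
      using fin mem ne by (simp add: sum.remove[of C q] sum.remove[of "C - {q}" q'])
    moreover have "C - {q} - {q'} = C - {q, q'}" by auto
    ultimately show ?thesis using M i q'[OF i] by (simp add: splitting_matrix_def)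
  qed
  have split: "\<exists>i\<in>R - {r}. (\<Sum>j\<in>B. a i j) = 0" if B: "B \<subseteq> C - {q, q'}" "even (card B)" for B
  proof -
    have "B \<subseteq> C" using B(1) by auto
    then obtain i where i: "i \<in> R" "(\<Sum>j\<in>B. a i j) = 0"
      using M B(2) unfolding splitting_matrix_def by blast
    show ?thesis
    proof (cases "i = r")
      case True
      have "(\<Sum>j\<in>B. a t j) * a t p = (\<Sum>j\<in>B. a r j) * a r p"
        unfolding sum_distrib_right
      proof (intro sum.cong refl)
        fix x assume "x \<in> B"
        then have "x \<in> C" "x \<noteq> q" "x \<noteq> q'" using B(1) by auto
        then show "a t x * a t p = a r x * a r p" using rt by simp
      qed
      then have "(\<Sum>j\<in>B. a t j) = 0" using i(2) True pm[OF mem(5,1)] by auto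
      then show ?thesis using mem by auto
    next
      case False
      then show ?thesis using i by auto
    qed
  qed
  have "card (C - {q, q'}) = card C - 2"
    using fin mem ne by (subst card_Diff_subset) auto
  moreover have "card R > 0" using fin mem(4) by (auto simp: card_gt_0_iff)
  ultimately have "card (C - {q, q'}) = 2 * card (R - {r})"
    using M mem(4) by (simp add: splitting_matrix_def)
  then show ?thesis
    unfolding splitting_matrix_def using fin pm sum0 split by blast
qed

text \<open>One of the three rows in the product is determined up to sign by the other two. As the 8
  columns of a splitting matrix are distinct, u and these two rows show all 8 sign triples, so the
  matrix is unique up to row signs and the order of rows and columns.\<close>

definition exceptional_matrix :: "'r set \<Rightarrow> 'c set \<Rightarrow> ('r \<Rightarrow> 'c \<Rightarrow> int) \<Rightarrow> bool" where
  "exceptional_matrix R C a \<longleftrightarrow> card R = 4 \<and> (\<exists>u\<in>R. \<exists>\<eta>. \<forall>j\<in>C. (\<Prod>i\<in>R - {u}. a i j) = \<eta>)"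

lemma standard_matrix_1:
  assumes M: "splitting_matrix R C a" and R: "card R = 1"
  shows "\<exists>d \<rho>. standard_matrix R C a d \<rho>"
proof -
  obtain r where r: "R = {r}" using R by (auto simp: card_1_singleton_iff)
  have "card C = 2" using M R by (simp add: splitting_matrix_def)
  then obtain p q where pq: "C = {p, q}" "p \<noteq> q" by (auto simp: card_2_iff)
  have "a r p + a r q = 0" using M pq by (simp add: splitting_matrix_def r)
  then have neg: "a r q = - a r p" by simp
  define d where "d x = (if even x then p else q)" for x :: int
  have "d 0 = p" "d 1 = q" by (simp_all add: d_def)
  then have "C \<subseteq> range d" unfolding pq by (metis empty_subsetI insert_subset rangeI)
  then have "range d = C" by (auto simp: pq d_def)
  then have "standard_matrix R C a d (\<lambda>_. r)"
    unfolding standard_matrix_def using neg by (auto simp: r d_def)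
  then show ?thesis by blast
qed

lemma image_eq_if_card_eq:
  fixes f :: "'c \<Rightarrow> 'd"
  assumes "inj_on f C" "f ` C \<subseteq> T" "finite T" "card T = card C"
  shows "f ` C = T"
  using assms by (intro card_subset_eq) (auto simp: card_image)

text \<open>Four distinct columns with two rows exhaust all sign pairs.\<close>

lemma has_chain_2:
  assumes M: "splitting_matrix R C a" and R: "card R = 2"
  shows "has_chain R C a"
proof -
  obtain r t where rt: "R = {r, t}" "r \<noteq> t" using R by (auto simp: card_2_iff)
  have pm: "a i j = 1 \<or> a i j = - 1" if "i \<in> R" "j \<in> C" for i j
    using M that by (auto simp: splitting_matrix_def)
  define f where "f j = (a r j, a t j)" for j
  have "inj_on f C"
  proof (rule inj_onI, rule ccontr)
    fix j l assume "j \<in> C" "l \<in> C" "f j = f l" "j \<noteq> l"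
    then show False
      using splitting_matrix_distinct[OF M, of j l] pm[of r j] pm[of t j] by (auto simp: rt f_def)
  qed
  then have "f ` C = {1, - 1} \<times> {1, - 1}"
    using pm M R by (intro image_eq_if_card_eq) (auto simp: f_def rt splitting_matrix_def)
  then have "(1, 1) \<in> f ` C" "(- 1, 1) \<in> f ` C" "(- 1, - 1) \<in> f ` C" by auto
  then obtain p q s where pqs: "p \<in> C" "q \<in> C" "s \<in> C"
    and f: "f p = (1, 1)" "f q = (- 1, 1)" "f s = (- 1, - 1)"
    by (elim imageE) simp
  have "\<forall>i\<in>R. a i q = (if i = r then - a i p else a i p)"
    "\<forall>i\<in>R. a i s = (if i = t then - a i q else a i q)"
    using f rt(2) by (auto simp: rt(1) f_def)
  moreover have "r \<in> R" "t \<in> R" by (simp_all add: rt(1))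
  ultimately show ?thesis unfolding has_chain_def using pqs rt(2) by blast
qed

lemma four_signs:
  fixes a b c e :: int
  assumes "a = 1 \<or> a = - 1" "b = 1 \<or> b = - 1" "c = 1 \<or> c = - 1" "e = 1 \<or> e = - 1"
    and "- a - b - c = 1 \<or> - a - b - c = - 1" "- a - b - e = 1 \<or> - a - b - e = - 1"
    and "- a - c - e = 1 \<or> - a - c - e = - 1"
  shows "b = a \<and> c = - a \<and> e = - a \<or> b = - a \<and> c = a \<and> e = - a \<or>
    b = - a \<and> c = - a \<and> e = a \<or> b = - a \<and> c = - a \<and> e = - a"
  using assms by presburger

text \<open>The equations say that the Fourier coefficients of f of degrees 0 and 1 vanish. They
  determine f from its values at the points with at most one -1, and the signs then leave only the
  characters of degrees 2 and 3, up to a constant sign.\<close>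

lemma eight_signs:
  fixes f :: "int \<Rightarrow> int \<Rightarrow> int \<Rightarrow> int"
  assumes "\<And>x y z. f x y z = 1 \<or> f x y z = - 1"
    and "f 1 1 1 + f 1 1 (-1) + f 1 (-1) 1 + f 1 (-1) (-1) + f (-1) 1 1 + f (-1) 1 (-1) + f (-1) (-1) 1 + f (-1) (-1) (-1) = 0"
    and "f 1 1 1 + f 1 1 (-1) + f 1 (-1) 1 + f 1 (-1) (-1) - f (-1) 1 1 - f (-1) 1 (-1) - f (-1) (-1) 1 - f (-1) (-1) (-1) = 0"
    and "f 1 1 1 + f 1 1 (-1) - f 1 (-1) 1 - f 1 (-1) (-1) + f (-1) 1 1 + f (-1) 1 (-1) - f (-1) (-1) 1 - f (-1) (-1) (-1) = 0"
    and "f 1 1 1 - f 1 1 (-1) + f 1 (-1) 1 - f 1 (-1) (-1) + f (-1) 1 1 - f (-1) 1 (-1) + f (-1) (-1) 1 - f (-1) (-1) (-1) = 0"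
  obtains "\<forall>x\<in>{1,-1}. \<forall>y\<in>{1,-1}. \<forall>z\<in>{1,-1}. f x y z = f 1 1 1 * (x * y)"
    | "\<forall>x\<in>{1,-1}. \<forall>y\<in>{1,-1}. \<forall>z\<in>{1,-1}. f x y z = f 1 1 1 * (x * z)"
    | "\<forall>x\<in>{1,-1}. \<forall>y\<in>{1,-1}. \<forall>z\<in>{1,-1}. f x y z = f 1 1 1 * (y * z)"
    | "\<forall>x\<in>{1,-1}. \<forall>y\<in>{1,-1}. \<forall>z\<in>{1,-1}. f x y z = f 1 1 1 * (x * y * z)"
proof -
  have eqs: "f 1 (-1) (-1) = - f 1 1 1 - f 1 1 (-1) - f 1 (-1) 1"
    "f (-1) 1 (-1) = - f 1 1 1 - f 1 1 (-1) - f (-1) 1 1"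
    "f (-1) (-1) 1 = - f 1 1 1 - f 1 (-1) 1 - f (-1) 1 1"
    "f (-1) (-1) (-1) = 2 * f 1 1 1 + f 1 1 (-1) + f 1 (-1) 1 + f (-1) 1 1"
    using assms(2-5) by linarith+
  from four_signs[OF assms(1)[of 1 1 1] assms(1)[of 1 1 "-1"] assms(1)[of 1 "-1" 1] assms(1)[of "-1" 1 1]
    assms(1)[of 1 "-1" "-1", unfolded eqs] assms(1)[of "-1" 1 "-1", unfolded eqs]
    assms(1)[of "-1" "-1" 1, unfolded eqs]]
  show thesis
  proof (elim disjE conjE)
    assume "f 1 1 (-1) = f 1 1 1" "f 1 (-1) 1 = - f 1 1 1" "f (-1) 1 1 = - f 1 1 1"
    then show thesis by (intro that(1)) (simp add: eqs)
  next
    assume "f 1 1 (-1) = - f 1 1 1" "f 1 (-1) 1 = f 1 1 1" "f (-1) 1 1 = - f 1 1 1"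
    then show thesis by (intro that(2)) (simp add: eqs)
  next
    assume "f 1 1 (-1) = - f 1 1 1" "f 1 (-1) 1 = - f 1 1 1" "f (-1) 1 1 = f 1 1 1"
    then show thesis by (intro that(3)) (simp add: eqs)
  next
    assume "f 1 1 (-1) = - f 1 1 1" "f 1 (-1) 1 = - f 1 1 1" "f (-1) 1 1 = - f 1 1 1"
    then show thesis by (intro that(4)) (simp add: eqs)
  qed
qed

text \<open>Up to sign a column is the triple of its products with row w. Without equal or antipodal
  columns the 8 columns correspond to the 8 triples, row w becomes a sign function f on the cube,
  and the four row sums are its Fourier coefficients of degrees 0 and 1. If f is a character of
  degree 2, the row left out of the constant product is x, y or z; if the degree is 3, it is
  w.\<close>

lemma exceptional_matrix_if_no_antipodes:
  assumes M: "splitting_matrix R C a" and R: "card R = 4"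
    and no: "\<And>p q. p \<in> C \<Longrightarrow> q \<in> C \<Longrightarrow> \<exists>i\<in>R. a i q \<noteq> - a i p"
  shows "exceptional_matrix R C a"
proof -
  obtain w x y z where R': "R = {w, x, y, z}" and ne: "w \<noteq> x" "w \<noteq> y" "w \<noteq> z" "x \<noteq> y" "x \<noteq> z" "y \<noteq> z"
    using R by (auto simp: card_Suc_eq numeral_eq_Suc)
  have inR: "w \<in> R" "x \<in> R" "y \<in> R" "z \<in> R" by (simp_all add: R')
  have pm: "a i j = 1 \<or> a i j = - 1" if "i \<in> R" "j \<in> C" for i j
    using M that unfolding splitting_matrix_def by blast
  have cardC: "card C = 8" using M R by (simp add: splitting_matrix_def)
  define \<phi> where "\<phi> j = (a w j * a x j, a w j * a y j, a w j * a z j)" for j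
  define T where "T = ({1, - 1} \<times> {1, - 1} \<times> {1, - 1} :: (int \<times> int \<times> int) set)"
  have T': "T = {(1, 1, 1), (1, 1, -1), (1, -1, 1), (1, -1, -1), (-1, 1, 1), (-1, 1, -1), (-1, -1, 1), (-1, -1, -1)}"
    by (auto simp: T_def)
  have memT: "(s, t, u) \<in> T \<longleftrightarrow> (s = 1 \<or> s = - 1) \<and> (t = 1 \<or> t = - 1) \<and> (u = 1 \<or> u = - 1)" for s t u
    by (auto simp: T_def)
  have mult: "s * t = 1 \<or> s * t = - 1" if "s = 1 \<or> s = - 1" "t = 1 \<or> t = - 1" for s t :: int
    using that by auto
  have inj: "inj_on \<phi> C"
  proof (rule inj_onI, rule ccontr)
    fix j l assume jl: "j \<in> C" "l \<in> C" "\<phi> j = \<phi> l" "j \<noteq> l"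
    note w = pm[OF inR(1) jl(1)] pm[OF inR(1) jl(2)]
    have h: "a w j * a x j = a w l * a x l" "a w j * a y j = a w l * a y l" "a w j * a z j = a w l * a z l"
      using jl(3) by (simp_all add: \<phi>_def)
    show False
    proof (cases "a w j = a w l")
      case True
      then have "a x l = a x j" "a y l = a y j" "a z l = a z j" using h w by auto
      then have eq: "a i l = a i j" if "i \<in> R" for i using True that unfolding R' by auto
      obtain i where i: "i \<in> R" "a i l = - a i j"
        using splitting_matrix_distinct[OF M jl(1,2,4)] by blast
      show False using eq[OF i(1)] i(2) pm[OF i(1) jl(1)] by linarith
    next
      case False
      then have wl: "a w l = - a w j" using w by auto
      then have "a x l = - a x j" "a y l = - a y j" "a z l = - a z j" using h w(1) by auto
      then have "a i l = - a i j" if "i \<in> R" for i using wl that unfolding R' by auto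
      then show False using no[OF jl(1,2)] by blast
    qed
  qed
  have "\<phi> ` C \<subseteq> T"
  proof (rule image_subsetI)
    fix j assume j: "j \<in> C"
    show "\<phi> j \<in> T" unfolding \<phi>_def memT
      using mult[OF pm[OF inR(1) j] pm[OF inR(2) j]] mult[OF pm[OF inR(1) j] pm[OF inR(3) j]]
        mult[OF pm[OF inR(1) j] pm[OF inR(4) j]] by blast
  qed
  moreover have "finite T" "card T = card C" unfolding cardC T' by simp_all
  ultimately have im: "\<phi> ` C = T" using image_eq_if_card_eq[OF inj] by blast
  define g where "g = the_inv_into C \<phi>"
  have g: "bij_betw g T C"
    unfolding g_def using inj im by (intro bij_betw_the_inv_into) (simp add: bij_betw_def)
  have \<phi>g: "\<phi> (g s) = s" if "s \<in> T" for s
    unfolding g_def using inj im that by (intro f_the_inv_into_f) simp_all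
  have gC: "g s \<in> C" if "s \<in> T" for s using g that unfolding bij_betw_def by blast
  \<comment> \<open>The value 1 off \<open>T\<close> is a default that keeps f a sign function at
    all integers, as \<open>eight_signs\<close> requires.\<close>
  define f where "f s t u = (if (s, t, u) \<in> T then a w (g (s, t, u)) else 1)" for s t u
  have f1: "f s t u = 1 \<or> f s t u = - 1" for s t u
    using pm[OF inR(1) gC[of "(s, t, u)"]] unfolding f_def by presburger
  have col: "a w (g (s, t, u)) = f s t u" "a x (g (s, t, u)) = f s t u * s"
    "a y (g (s, t, u)) = f s t u * t" "a z (g (s, t, u)) = f s t u * u" if "(s, t, u) \<in> T" for s t u
  proof -
    show w: "a w (g (s, t, u)) = f s t u" using that by (simp add: f_def)
    have "f s t u * a x (g (s, t, u)) = s" "f s t u * a y (g (s, t, u)) = t" "f s t u * a z (g (s, t, u)) = u"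
      using \<phi>g[OF that] by (simp_all add: \<phi>_def w)
    then show "a x (g (s, t, u)) = f s t u * s" "a y (g (s, t, u)) = f s t u * t"
      "a z (g (s, t, u)) = f s t u * u"
      using f1[of s t u] by auto
  qed
  have sumT:
    "h (g (1, 1, 1)) + h (g (1, 1, -1)) + h (g (1, -1, 1)) + h (g (1, -1, -1)) +
      h (g (-1, 1, 1)) + h (g (-1, 1, -1)) + h (g (-1, -1, 1)) + h (g (-1, -1, -1)) = (\<Sum>j\<in>C. h j)" for h :: "'b \<Rightarrow> int"
    unfolding sum.reindex_bij_betw[OF g, of h, symmetric] T' by simp
  have zero: "(\<Sum>j\<in>C. a i j) = 0" if "i \<in> R" for i using M that by (simp add: splitting_matrix_def)
  note eqs = sumT[of "a w", unfolded zero[OF inR(1)]] sumT[of "a x", unfolded zero[OF inR(2)]]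
    sumT[of "a y", unfolded zero[OF inR(3)]] sumT[of "a z", unfolded zero[OF inR(4)]]
  have preimage: "\<exists>s t u. (s, t, u) \<in> T \<and> j = g (s, t, u)" if "j \<in> C" for j
  proof -
    have "j \<in> g ` T" using g that unfolding bij_betw_def by blast
    then show ?thesis by auto
  qed
  have "\<exists>u\<in>R. \<exists>\<eta>. \<forall>j\<in>C. (\<Prod>i\<in>R - {u}. a i j) = \<eta>"
  proof (rule eight_signs[of f])
    show "f s t u = 1 \<or> f s t u = - 1" for s t u by (rule f1)
    show "f 1 1 1 + f 1 1 (-1) + f 1 (-1) 1 + f 1 (-1) (-1) + f (-1) 1 1 + f (-1) 1 (-1) + f (-1) (-1) 1 + f (-1) (-1) (-1) = 0"
      using eqs(1) by (simp add: col memT)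
    show "f 1 1 1 + f 1 1 (-1) + f 1 (-1) 1 + f 1 (-1) (-1) - f (-1) 1 1 - f (-1) 1 (-1) - f (-1) (-1) 1 - f (-1) (-1) (-1) = 0"
      using eqs(2) by (simp add: col memT)
    show "f 1 1 1 + f 1 1 (-1) - f 1 (-1) 1 - f 1 (-1) (-1) + f (-1) 1 1 + f (-1) 1 (-1) - f (-1) (-1) 1 - f (-1) (-1) (-1) = 0"
      using eqs(3) by (simp add: col memT)
    show "f 1 1 1 - f 1 1 (-1) + f 1 (-1) 1 - f 1 (-1) (-1) + f (-1) 1 1 - f (-1) 1 (-1) + f (-1) (-1) 1 - f (-1) (-1) (-1) = 0"
      using eqs(4) by (simp add: col memT)
  next
    assume h: "\<forall>x\<in>{1,-1}. \<forall>y\<in>{1,-1}. \<forall>z\<in>{1,-1}. f x y z = f 1 1 1 * (x * y)"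
    have "(\<Prod>i\<in>R - {z}. a i j) = f 1 1 1" if j: "j \<in> C" for j
    proof -
      from preimage[OF j] obtain s t u where s: "(s, t, u) \<in> T" "j = g (s, t, u)" by blast
      have "f s t u = f 1 1 1 * (s * t)" using h s(1) unfolding memT by blast
      moreover have "s * s = 1" "t * t = 1" "u * u = 1" "f s t u * f s t u = 1"
        using s(1)[unfolded memT] f1[of s t u] by auto
      ultimately have "f s t u * ((f s t u * s) * (f s t u * t)) = f 1 1 1" by algebra
      moreover have "R - {z} = {w, x, y}" using ne by (auto simp: R')
      ultimately show ?thesis using ne by (simp add: s(2) col[OF s(1)])
    qed
    with inR(4) show ?thesis by blast
  next
    assume h: "\<forall>x\<in>{1,-1}. \<forall>y\<in>{1,-1}. \<forall>z\<in>{1,-1}. f x y z = f 1 1 1 * (x * z)"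
    have "(\<Prod>i\<in>R - {y}. a i j) = f 1 1 1" if j: "j \<in> C" for j
    proof -
      from preimage[OF j] obtain s t u where s: "(s, t, u) \<in> T" "j = g (s, t, u)" by blast
      have "f s t u = f 1 1 1 * (s * u)" using h s(1) unfolding memT by blast
      moreover have "s * s = 1" "t * t = 1" "u * u = 1" "f s t u * f s t u = 1"
        using s(1)[unfolded memT] f1[of s t u] by auto
      ultimately have "f s t u * ((f s t u * s) * (f s t u * u)) = f 1 1 1" by algebra
      moreover have "R - {y} = {w, x, z}" using ne by (auto simp: R')
      ultimately show ?thesis using ne by (simp add: s(2) col[OF s(1)])
    qed
    with inR(3) show ?thesis by blast
  next
    assume h: "\<forall>x\<in>{1,-1}. \<forall>y\<in>{1,-1}. \<forall>z\<in>{1,-1}. f x y z = f 1 1 1 * (y * z)"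
    have "(\<Prod>i\<in>R - {x}. a i j) = f 1 1 1" if j: "j \<in> C" for j
    proof -
      from preimage[OF j] obtain s t u where s: "(s, t, u) \<in> T" "j = g (s, t, u)" by blast
      have "f s t u = f 1 1 1 * (t * u)" using h s(1) unfolding memT by blast
      moreover have "s * s = 1" "t * t = 1" "u * u = 1" "f s t u * f s t u = 1"
        using s(1)[unfolded memT] f1[of s t u] by auto
      ultimately have "f s t u * ((f s t u * t) * (f s t u * u)) = f 1 1 1" by algebra
      moreover have "R - {x} = {w, y, z}" using ne by (auto simp: R')
      ultimately show ?thesis using ne by (simp add: s(2) col[OF s(1)])
    qed
    with inR(2) show ?thesis by blast
  next
    assume h: "\<forall>x\<in>{1,-1}. \<forall>y\<in>{1,-1}. \<forall>z\<in>{1,-1}. f x y z = f 1 1 1 * (x * y * z)"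
    have "(\<Prod>i\<in>R - {w}. a i j) = f 1 1 1" if j: "j \<in> C" for j
    proof -
      from preimage[OF j] obtain s t u where s: "(s, t, u) \<in> T" "j = g (s, t, u)" by blast
      have "f s t u = f 1 1 1 * (s * t * u)" using h s(1) unfolding memT by blast
      moreover have "s * s = 1" "t * t = 1" "u * u = 1" "f s t u * f s t u = 1"
        using s(1)[unfolded memT] f1[of s t u] by auto
      ultimately have "(f s t u * s) * ((f s t u * t) * (f s t u * u)) = f 1 1 1" by algebra
      moreover have "R - {w} = {x, y, z}" using ne by (auto simp: R')
      ultimately show ?thesis using ne by (simp add: s(2) col[OF s(1)])
    qed
    with inR(1) show ?thesis by blast
  qed
  with R show ?thesis by (simp add: exceptional_matrix_def)
qed

text \<open>After deletion p and s differ in t alone, so t must be the row outside the constant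
  product. Reinserting r, a copy of t up to sign off q and \<open>q'\<close>, then leaves four
  columns that no row splits.\<close>

lemma exceptional_matrix_chain_False:
  assumes M: "splitting_matrix R C a" and R: "card R = 5"
    and mem: "p \<in> C" "q \<in> C" "s \<in> C" "q' \<in> C" "r \<in> R" "t \<in> R" "r \<noteq> t"
    and pq: "\<And>i. i \<in> R \<Longrightarrow> a i q = (if i = r then - a i p else a i p)"
    and qs: "\<And>i. i \<in> R \<Longrightarrow> a i s = (if i = t then - a i q else a i q)"
    and q': "\<And>i. i \<in> R \<Longrightarrow> a i q' = - a i q"
    and rt: "\<And>l. l \<in> C \<Longrightarrow> l \<noteq> q \<Longrightarrow> l \<noteq> q' \<Longrightarrow> a r l * a r p = a t l * a t p"
    and ex: "exceptional_matrix (R - {r}) (C - {q, q'}) a"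
  shows False
proof -
  have pm: "a i j = 1 \<or> a i j = - 1" if "i \<in> R" "j \<in> C" for i j
    using M that unfolding splitting_matrix_def by blast
  have fin: "finite R" "finite C" using M by (simp_all add: splitting_matrix_def)
  note rp = pm[OF mem(5,1)] and tp = pm[OF mem(6,1)]
  have "p \<noteq> q" using pq[OF mem(5)] rp by auto
  moreover have "p \<noteq> q'" using pq[OF mem(6)] q'[OF mem(6)] tp mem(7) by auto
  moreover have "s \<noteq> q" using pq[OF mem(6)] qs[OF mem(6)] tp mem(7) by auto
  moreover have "s \<noteq> q'" using pq[OF mem(5)] qs[OF mem(5)] q'[OF mem(5)] rp mem(7) by auto
  moreover have qq': "q \<noteq> q'" using pq[OF mem(5)] q'[OF mem(5)] rp by auto
  ultimately have pC: "p \<in> C - {q, q'}" and sC: "s \<in> C - {q, q'}" using mem by auto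
  obtain u \<eta> where u: "u \<in> R - {r}" and prod: "\<And>j. j \<in> C - {q, q'} \<Longrightarrow> (\<Prod>i\<in>R - {r} - {u}. a i j) = \<eta>"
    using ex unfolding exceptional_matrix_def by blast
  have ut: "u = t"
  proof (rule ccontr)
    assume "u \<noteq> t"
    then have tm: "t \<in> R - {r} - {u}" using mem by auto
    have fin': "finite (R - {r} - {u})" using fin by simp
    have "(\<Prod>i\<in>R - {r} - {u} - {t}. a i s) = (\<Prod>i\<in>R - {r} - {u} - {t}. a i p)"
      by (intro prod.cong refl) (use pq qs in auto)
    moreover have "a t s = - a t p" using pq[OF mem(6)] qs[OF mem(6)] mem(7) by auto
    ultimately have "(\<Prod>i\<in>R - {r} - {u}. a i s) = - (\<Prod>i\<in>R - {r} - {u}. a i p)"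
      by (simp add: prod.remove[OF fin' tm])
    then have "\<eta> = 0" using prod[OF pC] prod[OF sC] by simp
    moreover have "(\<Prod>i\<in>R - {r} - {u}. a i p) \<noteq> 0"
      using fin' by (simp add: prod_zero_iff) (use pm[OF _ mem(1)] in force)
    ultimately show False using prod[OF pC] by simp
  qed
  have "card (R - {r} - {t}) = 3" using fin mem R by simp
  then obtain x y z where xyz: "R - {r} - {t} = {x, y, z}" "x \<noteq> y" "x \<noteq> z" "y \<noteq> z"
    by (auto simp: card_Suc_eq numeral_eq_Suc)
  have inR: "x \<in> R" "y \<in> R" "z \<in> R" using xyz(1) by auto
  have ner: "x \<noteq> r" "y \<noteq> r" "z \<noteq> r" "x \<noteq> t" "y \<noteq> t" "z \<noteq> t" using xyz(1) by auto
  have R': "R = {r, t, x, y, z}" using xyz(1) mem by auto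
  define b where "b i j = a i p * a i j" for i j
  have Mb: "splitting_matrix R C b"
    unfolding b_def using M pm mem by (intro splitting_matrix_scale) auto
  have bpm: "b i j = 1 \<or> b i j = - 1" if "i \<in> R" "j \<in> C" for i j
    using Mb that unfolding splitting_matrix_def by blast
  have bq': "b i q' = (if i = r then 1 else - 1)" if "i \<in> R" for i
    using pm[OF that mem(1)] pq[OF that] q'[OF that] by (auto simp: b_def)
  have brt: "b r l = b t l" if "l \<in> C - {q, q'}" for l
    using rt[of l] that by (simp add: b_def mult.commute)
  have bxyz: "b x l * b y l * b z l = 1" if l: "l \<in> C - {q, q'}" for l
  proof -
    have "a x l * a y l * a z l = \<eta>" "a x p * a y p * a z p = \<eta>"
      using prod[OF l] prod[OF pC] xyz(2-4) unfolding ut xyz(1) by simp_all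
    moreover have "b x l * b y l * b z l = (a x p * a y p * a z p) * (a x l * a y l * a z l)"
      by (simp add: b_def)
    moreover have "\<eta> = 1 \<or> \<eta> = - 1"
      using calculation(2) pm[OF inR(1) mem(1)] pm[OF inR(2) mem(1)] pm[OF inR(3) mem(1)] by auto
    ultimately show ?thesis by auto
  qed
  define \<phi> where "\<phi> j = (b t j, b x j, b y j)" for j
  define T where "T = {(1, 1, 1), (1, 1, -1), (1, -1, 1), (1, -1, -1), (-1, 1, 1), (-1, 1, -1), (-1, -1, 1), (-1, -1, -1) :: int \<times> int \<times> int}"
  have inj: "inj_on \<phi> (C - {q, q'})"
  proof (rule inj_onI, rule ccontr)
    fix j l assume jl: "j \<in> C - {q, q'}" "l \<in> C - {q, q'}" "\<phi> j = \<phi> l" "j \<noteq> l"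
    have jC: "j \<in> C" and lC: "l \<in> C" using jl by auto
    have eqs: "b t j = b t l" "b x j = b x l" "b y j = b y l" using jl(3) by (simp_all add: \<phi>_def)
    moreover have "b r j = b r l" using brt[OF jl(1)] brt[OF jl(2)] eqs(1) by simp
    moreover have "b z j = b z l"
      using bxyz[OF jl(1)] bxyz[OF jl(2)] eqs(2,3) bpm[OF inR(1) jC] bpm[OF inR(2) jC] by auto
    ultimately have eq: "b i l = b i j" if "i \<in> R" for i using that unfolding R' by auto
    obtain i where i: "i \<in> R" "b i l = - b i j"
      using splitting_matrix_distinct[OF Mb jC lC jl(4)] by blast
    show False using eq[OF i(1)] i(2) bpm[OF i(1) jC] by linarith
  qed
  have "\<phi> ` (C - {q, q'}) \<subseteq> T"
  proof (rule image_subsetI)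
    fix j assume "j \<in> C - {q, q'}"
    then have j: "j \<in> C" by simp
    show "\<phi> j \<in> T" using bpm[OF mem(6) j] bpm[OF inR(1) j] bpm[OF inR(2) j]
      unfolding \<phi>_def T_def by (elim disjE) simp_all
  qed
  moreover have "card (C - {q, q'}) = 8"
    using M R fin mem qq' by (subst card_Diff_subset) (auto simp: splitting_matrix_def)
  then have "finite T" "card T = card (C - {q, q'})" unfolding T_def by simp_all
  ultimately have im: "\<phi> ` (C - {q, q'}) = T" using image_eq_if_card_eq[OF inj] by blast
  \<comment> \<open>In the rows x, y, z, whose product is 1, these three columns have two entries -1
    in each of the three possible ways; rows t and r are 1 on them. With \<open>q'\<close> added, x,
    y and z sum to -2, t to 2 and r to 4.\<close>
  have "(1, 1, -1) \<in> \<phi> ` (C - {q, q'})" "(1, -1, 1) \<in> \<phi> ` (C - {q, q'})"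
    "(1, -1, -1) \<in> \<phi> ` (C - {q, q'})" unfolding im T_def by simp_all
  then obtain l1 l2 l3 where l: "l1 \<in> C - {q, q'}" "l2 \<in> C - {q, q'}" "l3 \<in> C - {q, q'}"
    and \<phi>l: "\<phi> l1 = (1, 1, -1)" "\<phi> l2 = (1, -1, 1)" "\<phi> l3 = (1, -1, -1)"
    by (elim imageE) simp
  have vals: "b t l1 = 1" "b x l1 = 1" "b y l1 = - 1" "b t l2 = 1" "b x l2 = - 1" "b y l2 = 1"
    "b t l3 = 1" "b x l3 = - 1" "b y l3 = - 1"
    using \<phi>l by (simp_all add: \<phi>_def)
  have zvals: "b z l1 = - 1" "b z l2 = - 1" "b z l3 = 1"
    using bxyz[OF l(1)] bxyz[OF l(2)] bxyz[OF l(3)] by (simp_all add: vals)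
  have ne: "q' \<noteq> l1" "q' \<noteq> l2" "q' \<noteq> l3" "l1 \<noteq> l2" "l1 \<noteq> l3" "l2 \<noteq> l3"
    using l \<phi>l by auto
  have "{q', l1, l2, l3} \<subseteq> C" "card {q', l1, l2, l3} = 4" using ne mem l by auto
  then have "{q', l1, l2, l3} \<subseteq> C" "even (card {q', l1, l2, l3})" by simp_all
  then obtain i where i: "i \<in> R" "(\<Sum>j\<in>{q', l1, l2, l3}. b i j) = 0"
    using Mb unfolding splitting_matrix_def by blast
  have s: "b i q' + (b i l1 + (b i l2 + b i l3)) = 0" using i(2) ne by simp
  have "i = r \<or> i = t \<or> i = x \<or> i = y \<or> i = z" using i(1) R' by blast
  then show False
    using s bq'[OF i(1)] brt[OF l(1)] brt[OF l(2)] brt[OF l(3)] vals zvals ner mem(7)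
    by (elim disjE) simp_all
qed

section \<open>Chains for small orders\<close>

abbreviation (input) T where "T \<equiv> True"
abbreviation (input) F where "F \<equiv> False"

text \<open>The last entry shows how an exclusion works. Disagreement with the given column in 0
  rows is ruled out by the odd set and in 2 rows by the child, so every other column disagrees in 1
  or 3 rows. Each of the five products at the empty set is then -1, whereas the neighbour identity
  requires the total -1.\<close>

definition chain_certificate_3 :: "entry list" where
  "chain_certificate_3 = [
    ([([T,F], 2), ([T,T], 1)],
      [([1, 0], [0, 1, 2], 0)],
      [[T,F], [F,T]],
      [],
      [([], [0, 1], -1)]),
    ([([T], 3)],
      [([2], [0, 1], 1)],
      [[T]],
      [[F]],
      [([-1], [0], -1)])]"

lemma check_chain_certificate_3: "check_entries 3 [chain_pattern 3] chain_certificate_3"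
  by code_simp

definition chain_certificate_4 :: "entry list" where
  "chain_certificate_4 = [
    ([([T,F,F], 1), ([T,F,T], 3)],
      [([0, 1], [2, 3, 0], 0)],
      [[T,F,F], [F,T,F], [F,F,T]],
      [[T,T,F]],
      [([1], [2, 2], -5)]),
    ([([T,F], 4)],
      [([3], [1, 0, 2], 1)],
      [[T,F], [F,T]],
      [[T,T]],
      [([1], [-2], 3)])]"

lemma check_chain_certificate_4: "check_entries 4 [chain_pattern 4] chain_certificate_4"
  by code_simp

definition chain_certificate_5 :: "entry list" where
  "chain_certificate_5 = [
    ([([T,F,F,F], 1), ([T,F,F,T], 1), ([T,F,T,T], 2), ([T,T,T,F], 1)],
      [([1, 1, 1, 0], [1, 2, 4], 0)],
      [[T,F,T,T], [T,T,T,F], [T,F,F,F], [F,T,F,F], [F,F,F,T], [F,T,T,T]],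
      [[F,F,F,F], [T,T,T,T]],
      [([5, -1], [-4, 8, 4, 4], -8)]),
    ([([T,F,F], 2), ([T,F,T], 2), ([T,T,T], 1)],
      [([1, 0, 0], [0, 2, 3], 0), ([1, 0, 1], [0, 1, 2, 3], 1)],
      [[T,T,T], [T,F,F], [F,T,F]],
      [[T,T,F], [T,F,T]],
      [([3, 1], [0, 6, -6], 0)]),
    ([([T,F], 4), ([T,T], 1)],
      [([2, 0], [0, 1, 2], 2)],
      [[T,F], [F,T]],
      [[T,T]],
      [([-1], [0, 4], -3)]),
    ([([T,F,F], 2), ([T,F,T], 3)],
      [([0, 1], [1, 3], 3), ([0, 2], [2, 3], 3)],
      [[T,F,F], [F,T,F], [F,F,T]],
      [[T,F,T]],
      [([-1], [18, 14], -41)]),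
    ([([T,F], 5)],
      [([1], [1, 2], 3), ([3], [1, 0, 2], 4)],
      [[T,F], [F,T]],
      [[T,T]],
      [([1], [0], -1)]),
    ([([T], 5)],
      [([4], [0, 1], 3), ([5], [0, 1], 5)],
      [[T]],
      [[F]],
      [([-1], [-2], 5)])]"

lemma check_chain_certificate_5: "check_entries 5 [chain_pattern 5] chain_certificate_5"
  by code_simp

definition chain_certificate_6 :: "entry list" where
  "chain_certificate_6 = [
    ([([T,F,F,F], 1), ([T,F,F,T], 1), ([T,F,T,T], 1), ([T,T,F,T], 1), ([T,T,T,T], 2)],
      [],
      [[T,T,F,T], [F,T,T,T], [T,F,T,T], [T,F,F,F], [F,T,F,F], [F,F,T,F]],
      [[F,F,F,F], [T,T,F,F], [T,F,T,F], [F,T,T,F], [F,T,F,T], [F,F,T,T]],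
      [([-20, -5, -5, 12, -9, -9], [-8, 48, 16, 16, -112], 208)]),
    ([([T,F,F], 1), ([T,F,T], 2), ([T,T,T], 3)],
      [([1, 1, 0], [0, 3, 2], 0), ([1, 1, 1], [0, 1, 3, 2], 1)],
      [[T,T,T], [T,F,F], [F,T,F]],
      [[T,T,F], [F,T,T]],
      [([-1, -1], [12, 0, 0], 0)]),
    ([([T,F,F,F], 1), ([T,F,F,T], 1), ([T,F,T,T], 2), ([T,T,F,T], 2)],
      [([1, 0, 1, 1], [0, 4, 3], 2)],
      [[T,T,F,T], [T,F,T,T], [F,T,T,T], [T,F,F,F], [F,T,F,F], [F,F,T,F]],
      [[F,F,F,F], [T,T,F,F], [T,F,T,F], [F,T,T,F], [F,T,F,T], [F,F,T,T], [T,T,T,T]],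
      [([18, -21, -21, -6, -21, -21, -4], [0, 168, 48, 48], -144)]),
    ([([T,F,F], 1), ([T,F,T], 3), ([T,T,T], 2)],
      [([0, 1, 0], [2, 3, 0], 0), ([0, 0, 1], [2, 3, 0], 0), ([0, 1, 1], [2, 3, 0], 2), ([0, 0, 2], [2, 3, 0], 2), ([1, 1, 2], [0, 1, 3, 2], 3)],
      [[T,T,T], [T,F,F], [F,T,F]],
      [[F,F,F], [T,T,F], [T,F,T], [F,T,T]],
      [([-87, 11, -7, -13], [-156, 132, 36], -204)]),
    ([([T,F], 1), ([T,T], 5)],
      [([0, 1], [1, 2, 0], 0), ([0, 2], [1, 2, 0], 2), ([0, 3], [1, 2, 0], 4)],
      [[T,F], [F,T]],
      [[T,T]],
      [([-4], [-19, 3], 0)]),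
    ([([T,F,F,F], 1), ([T,F,F,T], 1), ([T,F,T,F], 1), ([T,F,T,T], 1), ([T,T,F,T], 1), ([T,T,T,T], 1)],
      [([0, 1, 0, 0, 0, 0], [0, 4], 5), ([0, 0, 1, 0, 0, 0], [0, 3, 4], 0), ([0, 0, 0, 1, 0, 0], [0, 4], 5), ([1, 1, 0, 1, 0, 0], [1, 4], 5), ([1, 0, 1, 1, 0, 0], [1, 3, 4], 0), ([0, 1, 1, 1, 0, 0], [1, 4], 5)],
      [[T,T,F,T], [T,F,T,T], [F,T,T,T], [T,T,T,F], [T,F,F,F], [F,T,F,F], [F,F,T,F]],
      [[F,F,F,F], [T,T,F,F]],
      [([5, 3], [0, 0, 0, 0, 4, 4], 0)]),
    ([([T,F,F], 1), ([T,F,T], 1), ([T,T,F], 2), ([T,T,T], 2)],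
      [([0, 0, 1, 0], [0, 3], 5), ([1, 1, 1, 0], [1, 3], 5), ([0, 0, 2, 0], [2, 3], 5), ([0, 0, 0, 1], [0, 3], 5), ([1, 1, 0, 1], [1, 3], 5), ([0, 0, 1, 1], [1, 3, 2, 0], 6), ([1, 1, 1, 1], [0, 3, 2, 1], 6), ([1, 0, 2, 1], [2, 3], 5)],
      [[T,T,T], [T,F,F], [F,T,F], [F,F,T]],
      [[F,F,F], [T,T,F], [T,F,T], [F,T,T]],
      [([21, -4, 0, 3], [-24, 12, 60, 96], -174), ([0, -2, -3, -3], [12, -12, -24, -48], 120), ([-29, -1, 3, 7], [-44, 28, 4, 76], -116)]),
    ([([T,F], 3), ([T,T], 3)],
      [([1, 0], [0, 2], 5), ([1, 1], [0, 2, 1], 7), ([3, 1], [1, 2], 5)],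
      [[T,F], [F,T]],
      [[F,F], [T,T]],
      [([-3, 1], [0, 4], -8)]),
    ([([T], 6)],
      [([1], [0, 1], 5), ([3], [0, 1], 8)],
      [[T]],
      [[F]],
      [([3], [2], -7)])]"

lemma check_chain_certificate_6: "check_entries 6 [chain_pattern 6] chain_certificate_6"
  by code_simp

definition chain_certificate_7 :: "entry list" where
  "chain_certificate_7 = [
    ([([T,F,F,F], 1), ([T,F,F,T], 1), ([T,F,T,T], 1), ([T,T,F,T], 1), ([T,T,T,T], 3)],
      [],
      [[T,T,F,T], [F,T,T,T], [T,F,T,T], [T,F,F,F], [F,T,F,F], [F,F,T,F]],
      [[T,F,T,F], [F,T,T,F], [T,F,F,T], [F,T,F,T], [F,F,T,T], [T,T,T,T]],
      [([-60660, 2338452, 460329, -558183, -578403, 287431], [-31025820, -68456028, 2330340, -2037180, -12039228], 87968304)]),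
    ([([T,F,F], 1), ([T,F,T], 2), ([T,T,T], 4)],
      [([0, 1, 0], [2, 3, 0], 0), ([1, 1, 0], [0, 3, 2], 0), ([0, 0, 1], [2, 3, 0], 0), ([1, 1, 1], [0, 1, 3, 2], 1)],
      [[T,T,T], [T,F,F], [F,T,F]],
      [[F,F,F], [T,T,F], [T,F,T], [F,T,T]],
      [([147, -28, -11, -28], [0, -180, -180], 1104)]),
    ([([T,F,F,F,F], 1), ([T,F,F,F,T], 1), ([T,F,F,T,F], 2), ([T,F,F,T,T], 1), ([T,F,T,T,T], 2)],
      [([1, 1, 1, 0, 0], [5, 0, 3], 2), ([0, 0, 0, 1, 0], [5, 3, 0], 2), ([1, 1, 2, 1, 1], [1, 2, 5], 0), ([1, 0, 2, 1, 2], [5, 2, 1], 2)],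
      [[F,T,T,F,T], [T,F,F,T,T], [F,F,T,T,T], [T,F,T,T,F], [T,F,T,F,T], [F,T,T,T,F], [T,F,F,F,F], [F,T,F,F,F]],
      [[T,T,F,F,F], [T,F,T,F,F], [F,T,T,F,F], [F,T,F,T,F], [T,T,T,T,F], [T,F,F,F,T], [F,T,F,F,T], [T,T,T,F,T], [T,T,F,T,T], [T,F,T,T,T]],
      [([-12, 11, -1, 0, 0, -3, -3, 0, 0, 0], [0, -16, 0, -16, -80], 184), ([-9, -3, 0, 3, 1, 0, -3, -1, 5, -1], [0, 0, 0, 0, 24], -24)]),
    ([([T,F,F,F], 2), ([T,F,F,T], 3), ([T,F,T,T], 2)],
      [([2, 2, 0], [4, 1, 2], 2), ([2, 1, 1], [1, 0, 3, 2, 4], 3), ([2, 3, 1], [1, 2, 4], 0), ([2, 2, 2], [4, 2, 1], 2)],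
      [[T,F,T,T], [F,T,T,T], [T,F,F,F], [F,T,F,F]],
      [[T,T,F,F], [T,F,F,T], [F,T,F,T]],
      [([-60, -1, -21], [-132, 12, 12], 84)]),
    ([([T,F,F], 2), ([T,F,T], 5)],
      [([2, 1], [3, 0, 2], 2), ([2, 3], [0, 1, 3, 2], 4)],
      [[T,F,F], [F,T,F], [F,F,T]],
      [[T,T,F], [T,F,T], [F,T,T]],
      [([66, -1, 21], [-204, 12], 156)]),
    ([([T,F,F,F,F], 1), ([T,F,F,F,T], 1), ([T,F,F,T,F], 1), ([T,F,T,F,F], 2), ([T,T,T,F,F], 1), ([T,T,T,F,T], 1)],
      [([1, 0, 0, 0, 0, 0], [0, 2, 5], 2), ([0, 1, 0, 0, 0, 0], [0, 2, 5], 2), ([1, 1, 1, 1, 0, 0], [1, 2, 5], 0), ([1, 0, 1, 1, 1, 0], [5, 1, 4], 2), ([1, 1, 0, 2, 1, 0], [3, 1, 5], 2), ([0, 0, 0, 2, 1, 1], [2, 5, 1], 5), ([1, 0, 0, 2, 1, 1], [3, 4, 5], 2)],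
      [[F,T,T,F,T], [F,T,F,T,T], [T,T,T,F,F], [F,T,T,T,F], [T,F,T,F,T], [T,F,F,F,F], [F,F,F,T,F], [T,F,T,T,F], [F,F,F,F,T], [T,T,F,F,T], [T,F,F,T,T]],
      [[F,F,F,F,F], [T,T,F,F,F], [T,F,T,F,F], [F,T,T,F,F], [T,F,F,T,F], [F,T,F,T,F], [F,F,T,T,F], [T,T,T,T,F], [T,F,F,F,T], [F,T,F,F,T], [F,F,T,F,T], [T,T,T,F,T], [F,F,F,T,T], [T,T,F,T,T], [T,F,T,T,T], [F,T,T,T,T]],
      [([-16559, -1899, 283, 57, 6485, 79, -1995, -891, 939, 57, -2785, 59, 665, -295, -2969, 81], [-1072, -2960, 20784, -2960, 352, 8128], 8568)]),
    ([([T,F,F,F,F], 1), ([T,F,F,F,T], 1), ([T,F,F,T,F], 1), ([T,F,T,F,T], 3), ([T,T,T,F,F], 1)],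
      [([1, 1, 0, 2, 1], [5, 1, 3], 2)],
      [[F,T,T,T,F], [F,T,T,F,T], [T,F,T,F,T], [F,T,F,T,T], [F,F,T,T,T], [T,F,F,F,F], [F,F,F,T,F], [T,T,F,T,F], [F,F,F,F,T], [T,F,F,T,T]],
      [[T,T,F,F,F], [F,T,T,F,F], [T,F,F,T,F], [F,T,F,T,F], [F,F,T,T,F], [T,F,F,F,T], [F,T,F,F,T], [F,F,F,T,T], [T,T,F,T,T], [T,F,T,T,T], [F,T,T,T,T]],
      [([-567, 85, 667, -44, 1087, -72, -601, 651, -2873, -173, -50], [1072, -2928, -524, 692, -676], 3768)]),
    ([([T,F,F,F], 1), ([T,F,F,T], 1), ([T,F,T,F], 1), ([T,F,T,T], 3), ([T,T,F,F], 1)],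
      [([1, 0, 0, 0, 0], [0, 2, 4], 2), ([0, 1, 0, 0, 0], [0, 2, 4], 2), ([0, 0, 1, 0, 0], [0, 3, 4], 2), ([0, 0, 0, 0, 1], [0, 2, 4], 2), ([0, 1, 0, 0, 1], [2, 0, 4], 2), ([0, 0, 1, 0, 1], [3, 0, 4], 2), ([1, 1, 0, 1, 1], [4, 3, 2], 2), ([1, 0, 1, 1, 1], [4, 2, 3], 2), ([1, 1, 0, 2, 1], [1, 2, 4, 0, 3], 6), ([1, 0, 1, 2, 1], [1, 3, 4, 0, 2], 6), ([1, 1, 0, 3, 1], [0, 4, 2, 1, 3], 7), ([1, 0, 1, 3, 1], [0, 4, 3, 1, 2], 7)],
      [[T,F,T,T], [F,T,T,T], [T,F,F,F], [F,T,F,F], [F,F,T,F], [T,T,T,F], [F,F,F,T], [T,T,F,T]],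
      [[F,F,F,F], [T,T,F,F], [T,F,T,F], [F,T,T,F], [T,F,F,T], [F,T,F,T], [F,F,T,T], [T,T,T,T]],
      [([-173, 99, 59, -33, 59, -33, 75, 11], [-920, -544, -544, -296, -656], 2352)]),
    ([([T,F,F,F,F], 1), ([T,F,F,F,T], 1), ([T,F,F,T,F], 1), ([T,F,F,T,T], 1), ([T,F,T,F,T], 1), ([T,T,F,T,T], 2)],
      [([1, 1, 1, 1, 1, 1], [1, 2, 5], 2)],
      [[T,F,F,T,T], [F,T,F,T,T], [T,T,T,T,T], [F,T,T,T,F], [F,T,T,F,T], [T,T,F,T,F], [T,T,F,F,T], [T,F,F,F,F], [F,F,T,F,F], [T,F,T,T,F], [T,F,T,F,T]],
      [[F,F,F,F,F], [T,T,F,F,F], [T,F,T,F,F], [F,T,T,F,F], [T,F,F,T,F], [F,T,F,T,F], [F,F,T,T,F], [T,T,T,T,F], [T,F,F,F,T], [F,T,F,F,T], [F,F,T,F,T], [T,T,T,F,T], [F,F,F,T,T], [T,T,F,T,T], [T,F,T,T,T], [F,T,T,T,T]],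
      [([-104407863, 250954257, 153365244, 8422434, -19401597, 96748115, -156060792, -158543866, 20795817, 90753765, -51405750, -14559084, 119420199, -6702321, 37950674, 11910804], [747326592, 863716248, 894203496, 0, -277423272, -598897944], 1268938560)]),
    ([([T,F,F,F], 1), ([T,F,F,T], 2), ([T,F,T,T], 2), ([T,T,T,F], 2)],
      [([0, 1, 0, 0], [0, 2, 4], 2), ([1, 1, 0, 0], [2, 0, 4], 2), ([0, 1, 1, 0], [1, 0, 3, 4, 2], 9), ([1, 2, 1, 0], [1, 2, 4], 0), ([1, 1, 2, 0], [4, 2, 1], 2), ([0, 2, 2, 0], [4, 2, 1], 2), ([0, 0, 0, 1], [0, 3, 4], 2), ([1, 0, 0, 1], [3, 0, 4], 2), ([0, 1, 0, 1], [3, 1, 0, 4], 8), ([0, 0, 1, 1], [3, 1, 0, 4], 8), ([1, 2, 2, 1], [4, 2, 1], 2), ([0, 0, 0, 2], [4, 1, 0], 5)],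
      [[T,T,T,F], [T,F,T,T], [T,F,F,F], [F,T,F,F], [F,F,F,T], [F,T,T,T]],
      [[F,F,F,F], [T,T,F,F], [T,F,T,F], [F,T,T,F], [T,F,F,T], [F,T,F,T], [F,F,T,T], [T,T,T,T]],
      [([0, 0, 1, 0, 0, -4, 0, 1], [20, 0, 0, 0], 4), ([-18, -3, 3, 0, 0, 3, 0, -1], [-24, 0, 0, 12], 12), ([0, -87, 0, 51, 0, -195, 66, -49], [564, 492, 492, -36], -312), ([267, -129, 51, -77, -21, -81, -177, -57], [-336, -840, -2352, 1008], 3864), ([12, -24, 11, -11, -9, 0, -30, -13], [48, -168, -324, 132], 588), ([-48, -9, 9, 0, -2, 0, -3, -3], [-48, -48, -12, 60], 60), ([-60, 0, 0, 29, 24, 0, 39, 38], [204, 168, 984, 0], -1482), ([-15, 3, 0, 0, 0, 6, 3, -1], [-24, 24, 48, 24], -108)]),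
    ([([T,F,F,F], 1), ([T,F,F,T], 2), ([T,F,T,F], 2), ([T,T,F,T], 2)],
      [([0, 2, 0, 0], [4, 3, 1, 2], 10), ([1, 0, 1, 0], [3, 0, 4], 2), ([0, 1, 1, 0], [3, 2, 0, 4], 8), ([1, 2, 1, 0], [4, 3, 1], 2), ([0, 0, 2, 0], [4, 2, 0], 5), ([0, 0, 1, 1], [3, 2, 0, 4], 8), ([0, 2, 1, 1], [4, 3, 1, 2], 10), ([1, 2, 2, 1], [4, 3, 1], 2), ([0, 0, 0, 2], [4, 1, 0], 5), ([1, 0, 0, 2], [0, 1, 3, 4], 10), ([0, 2, 0, 2], [3, 4, 1], 5), ([0, 2, 2, 2], [4, 3, 1, 2], 10), ([1, 2, 2, 2], [4, 0, 1], 5)],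
      [[T,T,F,T], [F,T,T,T], [T,F,F,F], [F,F,T,F], [T,T,T,F], [T,F,T,T]],
      [[F,F,F,F], [T,T,F,F], [T,F,T,F], [F,T,T,F], [T,F,F,T], [F,T,F,T], [F,F,T,T], [T,T,T,T]],
      [([-12, -3, 0, 0, 0, 1, 0, 0], [12, 0, 12, 0], 0), ([-363, -9, 27, 27, 0, 16, -108, 0], [492, -132, 60, 156], -24), ([-33, -2, 3, 0, 0, 1, 6, 1], [0, 0, 0, 48], -48), ([-4, -3, 0, 0, 0, 0, 0, 1], [-4, 0, 0, 0], 8), ([-9, -3, 9, 3, 2, 0, 0, 0], [36, 12, -36, 36], -12), ([375, 113, -9, -3, 0, -2, 324, 108], [-108, -36, -36, -140], 284), ([-3, -1, 0, 0, 0, 0, 0, 0], [0, 0, 0, 4], -4)]),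
    ([([T,F,F,F], 1), ([T,F,F,T], 1), ([T,F,T,F], 2), ([T,T,F,T], 3)],
      [([1, 0, 1, 0], [1, 4, 3], 0), ([1, 1, 0, 1], [0, 2, 4, 3], 10), ([1, 0, 1, 1], [1, 4, 3], 2), ([1, 1, 2, 1], [3, 4, 1], 0)],
      [[T,T,F,T], [F,T,T,T], [T,F,F,F], [F,F,T,F], [T,T,T,F], [T,F,T,T]],
      [[T,T,F,F], [F,F,T,T], [T,T,T,T]],
      [([-3, 4, -3], [20, 0, 0, 0], 4)]),
    ([([T,F,F], 1), ([T,F,T], 2), ([T,T,F], 4)],
      [([0, 1, 0], [0, 1, 3], 2), ([0, 1, 1], [1, 2, 0, 3], 8), ([1, 2, 1], [0, 3, 2, 1], 12), ([1, 0, 2], [0, 2, 3, 1], 10), ([1, 2, 2], [0, 3, 2, 1], 11), ([1, 2, 4], [3, 0, 2], 5)],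
      [[T,F,F], [F,T,F], [F,F,T], [T,T,T]],
      [[T,T,F], [T,F,T], [F,T,T]],
      [([1, 3, 4], [-16, -12, 12], -8)]),
    ([([T,F,F,F,F], 1), ([T,F,F,F,T], 1), ([T,F,F,T,F], 1), ([T,F,T,F,T], 1), ([T,T,F,T,T], 2), ([T,T,T,F,T], 1)],
      [([0, 0, 1, 0, 0, 0], [0, 4, 5], 0), ([0, 0, 1, 0, 1, 0], [2, 5, 3], 13), ([1, 1, 1, 1, 0, 1], [1, 3, 5], 0)],
      [[T,T,T,T,T], [T,T,F,F,T], [F,T,F,T,T], [F,T,T,F,T], [T,T,F,T,F], [T,F,F,T,T], [F,T,T,T,F], [T,F,F,F,F], [F,F,F,T,F], [T,F,T,F,T]],
      [[F,F,F,F,F], [T,T,F,F,F], [F,T,T,F,F], [T,F,F,T,F], [F,F,T,T,F], [T,T,T,T,F], [T,F,F,F,T], [F,T,F,F,T], [F,F,T,F,T], [T,T,T,F,T], [F,F,F,T,T], [T,T,F,T,T], [T,F,T,T,T], [F,T,T,T,T]],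
      [([191727, 229203, 28180, -75816, 43281, -56095, 31762, -98214, 54899, 29523, 207729, 47349, -40958, 23626], [0, 1617504, 0, -955056, -780840, 885384], 1101504)]),
    ([([T,F,F,F,F], 1), ([T,F,F,F,T], 1), ([T,F,F,T,F], 1), ([T,F,T,F,T], 1), ([T,F,T,T,T], 1), ([T,T,F,T,F], 2)],
      [([1, 0, 0, 1, 0, 0], [3, 0, 5], 2), ([1, 0, 0, 1, 1, 0], [0, 5, 2], 13), ([1, 0, 0, 0, 0, 1], [2, 5, 4], 2), ([0, 1, 1, 0, 0, 1], [4, 5, 2], 2), ([1, 1, 1, 0, 0, 1], [4, 5, 2], 0), ([1, 0, 1, 1, 0, 1], [2, 5, 4], 2), ([1, 0, 0, 1, 0, 2], [2, 5, 4], 2), ([0, 1, 1, 1, 0, 2], [4, 5, 2], 2), ([1, 1, 1, 1, 0, 2], [4, 5, 2], 0)],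
      [[F,T,T,T,F], [T,F,T,F,T], [F,T,T,F,T], [T,T,T,T,T], [T,T,F,T,F], [T,F,T,T,F], [T,F,F,T,T], [F,F,T,T,T], [T,F,F,F,F], [F,T,F,F,F], [T,T,F,F,T]],
      [[F,F,F,F,F], [T,F,T,F,F], [F,T,T,F,F], [T,F,F,T,F], [F,T,F,T,F], [F,F,T,T,F], [T,T,T,T,F], [T,F,F,F,T], [F,T,F,F,T], [F,F,T,F,T], [F,F,F,T,T], [T,T,F,T,T], [T,F,T,T,T], [F,T,T,T,T]],
      [([-310179, 19721, -9954, -3198, -995, -3574, -2809, -7363, -21318, 2805, -131130, -2725, 4962, -4643], [-333696, 148608, -97224, 0, 417240, 15552], 0)]),
    ([([T,F,F,F], 1), ([T,F,F,T], 1), ([T,F,T,F], 1), ([T,F,T,T], 2), ([T,T,F,T], 2)],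
      [([0, 1, 0, 0, 0], [4, 3, 0], 2), ([0, 0, 1, 0, 0], [0, 3, 4], 0), ([0, 0, 0, 1, 0], [4, 3, 0], 2), ([0, 0, 1, 1, 0], [1, 4, 2], 13), ([1, 0, 1, 1, 0], [4, 0, 3], 2), ([0, 0, 0, 0, 1], [2, 4, 1], 13), ([1, 1, 1, 0, 1], [0, 4, 1, 2, 3], 14), ([0, 0, 0, 0, 2], [4, 1, 0], 5), ([1, 0, 0, 0, 2], [0, 4, 1], 13), ([0, 1, 0, 0, 2], [0, 4, 1], 13), ([0, 0, 1, 0, 2], [0, 4, 1], 13), ([0, 0, 0, 1, 2], [0, 4, 1], 13), ([0, 1, 0, 1, 2], [1, 3, 4], 13), ([1, 1, 0, 1, 2], [1, 0, 2, 3, 4], 15), ([0, 0, 0, 2, 2], [1, 3, 4], 13), ([0, 1, 0, 2, 2], [3, 4, 0], 5), ([1, 1, 0, 2, 2], [1, 4, 0], 13)],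
      [[T,T,F,T], [T,F,T,T], [F,T,T,T], [T,F,F,F], [F,T,F,F], [F,F,T,F], [T,T,T,F]],
      [[F,F,F,F], [T,T,F,F], [T,F,T,F], [F,T,T,F], [T,F,F,T], [F,T,F,T], [F,F,T,T], [T,T,T,T]],
      [([0, 0, -19, 0, -14, 0, -57, 0], [408, -132, -72, -132, -132], 642), ([84, 15, -30, -15, -23, 0, -45, 10], [0, -216, 360, -336, -336], 1224), ([0, 0, 6, -51, 0, -11, -54, -6], [432, -156, 300, -144, -300], 624), ([291, 0, 0, -15, -15, 32, 60, 35], [264, 360, -96, 0, -144], 504), ([150, 21, 20, 21, -3, 0, 9, -14], [216, 120, 240, 144, -216], 72), ([0, 0, 7, 0, 2, 0, -6, 0], [18, -18, 30, -18, -18], 63), ([0, 6, 0, 0, 1, -3, -9, -1], [36, -36, 108, 36, -84], 48), ([-9, 9, -9, 9, -3, 3, 9, -1], [-144, 72, -72, 144, 144], -288)]),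
    ([([T,F,F,F,F], 1), ([T,F,F,F,T], 1), ([T,F,F,T,F], 1), ([T,F,F,T,T], 1), ([T,F,T,F,F], 1), ([T,T,F,T,T], 1), ([T,T,T,F,F], 1)],
      [([0, 0, 0, 0, 0, 1, 0], [3, 1, 5], 13), ([0, 0, 0, 1, 0, 1, 0], [1, 3, 5], 13), ([0, 0, 1, 0, 1, 1, 0], [2, 3, 5, 1], 16), ([0, 0, 1, 1, 1, 1, 0], [2, 5, 3], 13), ([1, 1, 1, 1, 1, 1, 0], [1, 2, 5], 0), ([1, 1, 1, 1, 1, 0, 1], [2, 5, 0], 13), ([0, 0, 0, 0, 0, 1, 1], [5, 1, 0], 5), ([1, 0, 0, 0, 0, 1, 1], [0, 5, 1], 13), ([1, 1, 0, 0, 0, 1, 1], [5, 1, 0, 3], 16), ([1, 0, 1, 1, 1, 1, 1], [1, 5, 0], 13)],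
      [[F,T,F,T,T], [F,T,T,T,F], [T,F,F,T,T], [T,T,T,T,T], [T,T,T,F,F], [T,T,F,T,F], [T,T,F,F,T], [F,T,T,F,T], [T,F,F,F,F], [F,F,T,F,F], [F,F,F,T,F], [T,F,T,T,F], [F,F,F,F,T], [T,F,T,F,T]],
      [[F,F,F,F,F], [T,T,F,F,F], [T,F,T,F,F], [F,T,T,F,F], [T,F,F,T,F], [F,T,F,T,F], [F,F,T,T,F], [T,T,T,T,F], [T,F,F,F,T], [F,T,F,F,T], [F,F,T,F,T], [T,T,T,F,T], [F,F,F,T,T], [T,F,T,T,T], [F,T,T,T,T]],
      [([-290778, -58310, 39393, -28875, -39266, -49326, -184467, -7339, -37070, -31008, -141089, -12583, -24374, -43817, -8475], [1080416, 930168, 678008, 243888, 990528, -1000104, 611304], -302720)]),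
    ([([T,F,F,F], 1), ([T,F,F,T], 1), ([T,F,T,F], 1), ([T,F,T,T], 2), ([T,T,F,F], 2)],
      [([0, 1, 1, 0, 0], [0, 1, 2, 4], 16), ([1, 0, 0, 1, 0], [0, 1, 2, 4], 16), ([0, 1, 0, 1, 0], [0, 1, 2, 4], 16), ([0, 0, 1, 1, 0], [1, 4, 2], 13), ([0, 0, 0, 0, 1], [2, 4, 1], 13), ([1, 1, 0, 0, 1], [4, 3, 2], 2), ([1, 0, 1, 0, 1], [4, 2, 3], 2), ([1, 1, 0, 1, 1], [2, 1, 0, 4], 16), ([1, 0, 1, 1, 1], [3, 1, 0, 4], 16), ([1, 1, 1, 1, 1], [0, 4, 1, 2, 3], 17), ([1, 1, 0, 2, 1], [3, 4, 0, 2], 16), ([1, 0, 1, 2, 1], [2, 4, 0, 3], 16), ([0, 1, 0, 0, 2], [0, 4, 1], 13), ([0, 0, 1, 0, 2], [0, 4, 1], 13), ([1, 1, 0, 1, 2], [4, 3, 2], 2), ([1, 0, 1, 1, 2], [4, 2, 3], 2), ([0, 1, 0, 2, 2], [3, 4, 0, 2], 16), ([1, 1, 0, 2, 2], [1, 4, 0], 13), ([0, 0, 1, 2, 2], [2, 4, 0, 3], 16), ([1, 0, 1, 2, 2], [1, 4, 0], 13), ([1, 1, 1, 2, 2], [4, 0, 1], 5)],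
      [[T,F,T,T], [F,T,T,T], [T,F,F,F], [F,T,F,F], [F,F,T,F], [T,T,T,F], [F,F,F,T], [T,T,F,T]],
      [[F,F,F,F], [T,T,F,F], [T,F,T,F], [F,T,T,F], [T,F,F,T], [F,T,F,T], [F,F,T,T], [T,T,T,T]],
      [([408, -89, 0, 85, -11, 52, -13, -68], [-376, -120, -384, -192, -408], 1600), ([63, -3, 0, -12, 0, -12, -7, -21], [0, 48, 48, -96, -24], 264), ([753, -255, 97, 225, 97, 225, 1, 129], [-3552, 24, 24, 1584, -744], 0)]),
    ([([T,F,F,F], 1), ([T,F,F,T], 1), ([T,F,T,T], 2), ([T,T,F,T], 3)],
      [([0, 0, 1, 0], [3, 4, 0], 0), ([0, 0, 2, 0], [4, 2, 0], 5), ([0, 0, 0, 1], [3, 4, 0], 0), ([0, 1, 0, 1], [0, 2, 1, 4], 16), ([0, 0, 1, 1], [1, 2, 0, 4], 18), ([0, 1, 2, 1], [0, 2, 1, 4], 18), ([0, 0, 0, 2], [2, 4, 1], 13), ([1, 1, 2, 2], [2, 4, 0], 13), ([0, 1, 0, 3], [3, 1, 4], 13), ([1, 0, 2, 3], [2, 4, 0], 13), ([0, 1, 2, 3], [2, 4, 0], 13)],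
      [[T,T,F,T], [T,F,T,T], [F,T,T,T], [T,F,F,F], [F,T,F,F], [F,F,T,F]],
      [[F,F,F,F], [T,T,F,F], [T,F,T,F], [F,T,T,F], [T,F,F,T], [F,T,F,T], [F,F,T,T], [T,T,T,T]],
      [([-2817, -18, -963, 144, -120, -93, 66, 113], [-3096, -4896, 0, 648], 3600)]),
    ([([T,F,F], 2), ([T,F,T], 2), ([T,T,F], 3)],
      [([1, 0, 0], [0, 1, 2, 3], 19), ([0, 1, 0], [1, 3, 2], 13), ([2, 1, 0], [1, 0, 2, 3], 19), ([1, 2, 0], [0, 3, 2], 13), ([1, 0, 1], [0, 2, 1, 3], 16), ([0, 1, 1], [1, 2, 0, 3], 18), ([2, 1, 1], [1, 2, 0, 3], 16), ([1, 2, 1], [0, 2, 1, 3], 18)],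
      [[T,F,F], [F,T,F], [F,F,T], [T,T,T]],
      [[T,T,F]],
      [([1], [0, 0, 12], -21)]),
    ([([T,F], 5), ([T,T], 2)],
      [([0, 2], [2, 1, 0], 5), ([1, 2], [0, 2, 1], 13), ([2, 2], [0, 2, 1], 20), ([3, 2], [1, 2, 0], 20), ([4, 2], [1, 2, 0], 13), ([5, 2], [2, 0, 1], 5)],
      [[T,F], [F,T]],
      [],
      [([], [0, -1], 1)]),
    ([([T,F,F], 1), ([T,F,T], 6)],
      [([0, 1], [2, 3, 0], 0), ([1, 4], [0, 3], 21), ([1, 5], [2, 3], 21)],
      [[T,F,F], [F,T,F], [F,F,T]],
      [[T,T,F], [T,F,T], [F,T,T]],
      [([16, -1, 7], [-116, -20], 112)]),
    ([([T,F], 6), ([T,T], 1)],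
      [([5, 0], [0, 2], 21), ([2, 1], [1, 2], 21), ([4, 1], [0, 2], 21), ([6, 1], [2, 0, 1], 22)],
      [[T,F], [F,T]],
      [[F,F], [T,T]],
      [([4, -1], [-2, -2], 7)]),
    ([([T,F,F,T], 3), ([T,F,T,F], 4)],
      [([1, 3], [2, 4], 21), ([3, 3], [0, 4], 23), ([1, 4], [0, 4], 21)],
      [[T,F,F,F], [F,T,F,F], [F,F,T,F], [F,F,F,T]],
      [[T,F,F,T], [F,T,F,T], [T,T,T,T]],
      [([3, 5, -48], [0, -96], 186)]),
    ([([T,F,F], 3), ([T,F,T], 4)],
      [([1, 1], [1, 3], 21), ([0, 2], [1, 3], 21), ([0, 3], [2, 3], 23), ([1, 3], [2, 3], 21), ([0, 4], [0, 1, 2, 3], 24), ([2, 4], [0, 3], 23)],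
      [[T,F,F], [F,T,F], [F,F,T]],
      [[T,T,F], [F,T,T]],
      [([-51, -1], [56, -20], -30)]),
    ([([T,F], 7)],
      [([4], [1, 0, 2], 25), ([5], [0, 2], 21), ([6], [0, 2], 23)],
      [[T,F], [F,T]],
      [],
      [([], [-1], 3)]),
    ([([T], 7)],
      [([5], [0, 1], 21), ([6], [0, 1], 23), ([7], [0, 1], 26)],
      [[T]],
      [[F]],
      [([1], [-2], 7)])]"

lemma check_chain_certificate_7: "check_entries 7 [chain_pattern 7] chain_certificate_7"
  by code_simp

text \<open>The two opposite steps for \<open>[([T,F], 4), ([T,T], 4)]\<close> exploit integrality.
  After the first one only columns of value 0 remain although the total is 16; the negated step sees
  the total -16 and discards them.\<close>

definition chain_certificate_8 :: "entry list" where
  "chain_certificate_8 = [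
    ([([T,F,F,F], 1), ([T,F,F,T], 1), ([T,F,T,T], 1), ([T,T,F,T], 1), ([T,T,T,T], 4)],
      [],
      [[T,T,F,T], [F,T,T,T], [T,F,T,T], [T,F,F,F], [F,T,F,F], [F,F,T,F]],
      [[T,T,F,F], [T,F,T,F], [F,T,T,F], [T,F,F,T], [F,T,F,T], [F,F,T,T], [T,T,T,T]],
      [([1024743, 0, 161679, 485037, 0, 298665, 42104], [-4174032, -25475136, 4174032, 936624, -1834848], 22597296), ([-1954671, -759867, 3238194, 0, -1171189, -1615213, 120498], [-53749080, -100138680, 0, 0, -76346424], 389774952)]),
    ([([T,F,F], 1), ([T,F,T], 2), ([T,T,T], 5)],
      [([0, 1, 0], [2, 3, 0], 0), ([1, 1, 0], [0, 3, 2], 0), ([0, 0, 1], [2, 3, 0], 0), ([1, 1, 1], [0, 1, 3, 2], 1)],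
      [[T,T,T], [T,F,F], [F,T,F]],
      [[F,F,F], [T,T,F], [T,F,T], [F,T,T]],
      [([23247, 3483, 1148, -1120], [9072, 0, -13284], 83916), ([-5, -1, 0, 0], [-16, 16, -12], 56), ([567, -33, -8, -24], [0, 0, -324], 2268), ([945, -54, -14, -41], [0, -108, -540], 3888), ([-312, 5, 3, 8], [96, 12, 0], -336)]),
    ([([T,F,F,F,F], 1), ([T,F,F,F,T], 1), ([T,F,F,T,F], 1), ([T,F,T,F,T], 1), ([T,T,F,T,F], 2), ([T,T,T,T,T], 2)],
      [([1, 1, 0, 0, 1, 0], [1, 5, 3], 2)],
      [[F,T,T,T,F], [F,T,T,F,T], [T,T,F,T,F], [T,F,T,F,T], [T,T,T,T,T], [T,F,T,T,F], [T,T,F,F,T], [T,F,F,T,T], [T,F,F,F,F]],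
      [[F,F,F,F,F], [T,T,F,F,F], [T,F,T,F,F], [F,T,T,F,F], [T,F,F,T,F], [F,F,T,T,F], [T,F,F,F,T], [F,T,F,F,T], [T,T,T,F,T], [F,F,F,T,T], [T,T,F,T,T], [T,F,T,T,T]],
      [([-11817885, -6465252, 526864, -921405, 2031116, 3983612, 2301689, -3972881, 170060, 4830033, -185952, -666251], [4136352, 0, -14285040, 9324088, 5206656, -93663048], 207374856)]),
    ([([T,F,F,F,F], 1), ([T,F,F,F,T], 1), ([T,F,F,T,T], 1), ([T,F,T,F,T], 2), ([T,T,F,T,T], 1), ([T,T,T,T,T], 2)],
      [([1, 1, 0, 1, 0, 0], [1, 5, 3], 0), ([1, 1, 1, 1, 0, 0], [3, 5, 1], 0), ([0, 0, 0, 2, 0, 0], [1, 5, 3], 2), ([0, 0, 1, 0, 1, 0], [4, 5, 0], 2), ([1, 0, 0, 2, 1, 0], [1, 5, 3], 2), ([1, 1, 0, 1, 0, 1], [1, 5, 3], 2)],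
      [[F,T,T,T,F], [T,F,F,T,T], [F,T,F,T,T], [T,T,T,T,T], [T,F,T,F,T], [F,T,T,F,T], [T,F,F,F,F], [F,F,T,F,F]],
      [[F,F,F,F,F], [T,T,F,F,F], [T,F,T,F,F], [F,T,T,F,F], [T,F,F,T,F], [F,T,F,T,F], [F,F,T,T,F], [F,T,F,F,T], [F,F,T,F,T], [T,T,T,F,T], [F,F,F,T,T], [T,T,F,T,T], [T,F,T,T,T], [F,T,T,T,T]],
      [([-2565810, -722904, -790941, -227313, 574323, -36549, 190314, -299310, -226488, -49204, 866301, -61899, 15659, -25851], [3995964, -11138148, 7157628, -3130164, -811980, -4571100], 16678008)]),
    ([([T,F,F,F], 1), ([T,F,F,T], 3), ([T,F,T,T], 1), ([T,T,T,T], 3)],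
      [([0, 2, 0, 0], [1, 4, 2], 2), ([1, 2, 0, 0], [1, 4, 2], 0), ([0, 0, 1, 0], [3, 4, 0], 0), ([0, 2, 1, 0], [2, 4, 1], 2), ([1, 2, 1, 0], [2, 4, 1], 0), ([0, 0, 0, 1], [3, 4, 0], 0), ([0, 2, 0, 1], [1, 0, 4, 3, 2], 4), ([1, 2, 0, 1], [1, 4, 2], 2), ([0, 0, 1, 1], [3, 4, 0], 2), ([0, 2, 1, 1], [4, 2, 3, 1, 0], 3), ([1, 2, 1, 1], [2, 4, 1], 2), ([1, 3, 1, 2], [2, 4, 1], 2)],
      [[T,F,T,T], [F,T,T,T], [T,F,F,F], [F,T,F,F]],
      [[F,F,F,F], [T,T,F,F], [T,F,T,F], [F,T,T,F], [T,F,F,T], [F,T,F,T], [F,F,T,T], [T,T,T,T]],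
      [([0, 0, -3, 0, 0, 0, 1, 0], [-12, 0, -24, 0], 36), ([-2079, 753, 0, 12, 4, 4, 2903, -193], [384, 288, 1008, 18360], -37824)]),
    ([([T,F,F,F], 1), ([T,F,F,T], 1), ([T,F,T,T], 2), ([T,T,F,T], 2), ([T,T,T,T], 2)],
      [([0, 0, 1, 0, 0], [3, 4, 0], 0), ([0, 1, 1, 0, 0], [3, 4, 0], 2), ([0, 0, 0, 1, 0], [3, 4, 0], 0), ([0, 1, 0, 1, 0], [3, 4, 0], 2), ([1, 0, 1, 1, 0], [0, 4, 3], 2), ([1, 1, 2, 1, 0], [0, 4, 1, 3], 5), ([1, 1, 1, 2, 0], [0, 4, 2, 3], 5), ([0, 0, 0, 0, 1], [3, 4, 0], 0), ([1, 1, 2, 0, 1], [0, 4, 1, 3], 5), ([1, 1, 0, 2, 1], [0, 4, 2, 3], 5)],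
      [[T,T,F,T], [T,F,T,T], [F,T,T,T], [T,F,F,F], [F,T,F,F], [F,F,T,F]],
      [[F,F,F,F], [T,T,F,F], [T,F,T,F], [F,T,T,F], [T,F,F,T], [F,T,F,T], [F,F,T,T], [T,T,T,T]],
      [([245487, -31125, -31125, 16829, -6031, -29533, -29533, -545], [243696, 113688, -216000, -216000, -284088], 1521240)]),
    ([([T,F,F], 1), ([T,F,T], 3), ([T,T,T], 4)],
      [([1, 1, 0], [0, 3, 2], 0), ([1, 1, 1], [0, 3, 2], 2), ([1, 3, 1], [0, 3, 1, 2], 5), ([1, 1, 2], [0, 1, 3, 2], 6)],
      [[T,T,T], [T,F,F], [F,T,F]],
      [[T,T,F], [T,F,T], [F,T,T]],
      [([-4, 1, -1], [60, 12, 0], -24)]),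
    ([([T,F,F,F], 1), ([T,F,F,T], 3), ([T,F,T,T], 1), ([T,T,F,T], 1), ([T,T,T,T], 2)],
      [([1, 1, 0, 0, 0], [0, 4, 3], 0), ([1, 1, 1, 0, 0], [0, 4, 3], 2), ([1, 2, 1, 0, 0], [4, 2, 1], 2), ([0, 3, 1, 0, 0], [4, 2, 1], 2), ([1, 1, 0, 1, 0], [0, 4, 3], 2), ([0, 3, 0, 1, 0], [4, 1, 2], 2), ([1, 0, 1, 1, 0], [0, 4, 3], 2), ([1, 1, 1, 1, 0], [0, 4, 3], 7), ([1, 1, 0, 0, 1], [0, 4, 3], 2), ([1, 1, 1, 0, 1], [0, 4, 3], 7), ([1, 1, 0, 1, 1], [0, 4, 3], 7), ([1, 3, 0, 1, 1], [4, 1, 2], 2), ([1, 0, 1, 1, 1], [0, 4, 3], 7), ([1, 1, 0, 0, 2], [0, 4, 3], 7)],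
      [[T,T,F,T], [F,T,T,T], [T,F,T,T], [T,F,F,F], [F,T,F,F], [F,F,T,F]],
      [[F,F,F,F], [T,T,F,F], [T,F,T,F], [F,T,T,F], [T,F,F,T], [F,T,F,T], [F,F,T,T], [T,T,T,T]],
      [([-28593, -3294, -774, 25, 1389, -1212, 948, -549], [51912, 47304, 100008, 104328, 104328], -345456)]),
    ([([T,F,F], 1), ([T,F,T], 4), ([T,T,T], 3)],
      [([1, 1, 0], [0, 3, 2], 0), ([1, 3, 0], [0, 3, 2], 7), ([1, 1, 1], [0, 3, 2], 2), ([1, 3, 1], [0, 1, 3, 2], 8), ([1, 1, 2], [0, 3, 2], 7)],
      [[T,T,T], [T,F,F], [F,T,F]],
      [[T,T,F], [T,F,T], [F,T,T]],
      [([-78, 7, -73], [0, 648, 828], -2646)]),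
    ([([T,F], 1), ([T,T], 7)],
      [([0, 1], [1, 2, 0], 0), ([0, 2], [1, 2, 0], 2), ([0, 3], [1, 2, 0], 7), ([0, 4], [1, 2, 0], 9)],
      [[T,F], [F,T]],
      [[T,T]],
      [([-1], [0, 36], -171)]),
    ([([T,F,F,F,F], 1), ([T,F,F,F,T], 1), ([T,F,F,T,F], 1), ([T,F,T,F,T], 1), ([T,F,T,T,T], 1), ([T,T,F,T,T], 1), ([T,T,T,T,T], 2)],
      [([0, 0, 1, 0, 0, 0, 0], [0, 4, 5], 0), ([0, 0, 0, 0, 1, 0, 0], [0, 5], 10), ([0, 0, 0, 0, 0, 1, 0], [0, 5], 10), ([1, 1, 0, 0, 0, 1, 0], [2, 5], 10), ([0, 0, 0, 0, 0, 0, 1], [0, 5], 10)],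
      [[T,T,T,T,T], [F,T,T,T,F], [T,F,F,T,T], [T,F,T,F,T], [T,T,F,T,F], [T,F,T,T,F], [F,T,F,T,T], [T,T,F,F,T], [F,T,T,F,T], [T,F,F,F,F], [F,T,F,F,F]],
      [[F,F,F,F,F], [T,T,F,F,F], [T,F,T,F,F], [F,T,T,F,F], [T,F,F,T,F], [F,T,F,T,F], [F,F,T,T,F], [T,T,T,T,F], [T,F,F,F,T], [F,T,F,F,T], [F,F,T,F,T], [T,T,T,F,T], [F,F,F,T,T], [T,F,T,T,T], [F,T,T,T,T]],
      [([1989312397734, 3258130762650, 2799183143169, -682805904487, -1093697152269, 93473908484, -2393561912262, -206071027989, -1044572373071, -511278546205, -1238380362664, -101357971850, -1823953258079, -98313064002, -29247090827], [12728064999144, 6165024273984, 4036810236936, -6498081654120, -41572726896168, -28250757920304, -56771522316696], 192333200296584)]),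
    ([([T,F,F,F,F], 1), ([T,F,F,F,T], 1), ([T,F,F,T,F], 1), ([T,F,T,F,T], 2), ([T,T,T,F,F], 1), ([T,T,T,T,T], 2)],
      [],
      [[F,T,T,T,F], [F,T,T,F,T], [T,F,T,F,T], [F,T,F,T,T], [F,F,T,T,T], [T,T,F,T,F], [T,F,F,T,T], [T,F,F,F,F], [F,F,F,T,F], [F,F,F,F,T]],
      [[F,F,F,F,F], [T,T,F,F,F], [T,F,T,F,F], [T,F,F,T,F], [F,T,F,T,F], [F,F,T,T,F], [T,T,T,T,F], [T,F,F,F,T], [F,T,F,F,T], [F,F,T,F,T], [F,F,F,T,T], [T,T,F,T,T]],
      [([-14230862631, -3542293341, -1986610488, 1969640991, -1069834245, -4675095912, 442572624, 1053944841, -6684092511, -1270646336, 3243115233, -1422274113], [41025602808, -24307450272, -28765280016, -12868650144, 0, -78317616672], 209998998792)]),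
    ([([T,F,F,F,F], 1), ([T,F,F,F,T], 1), ([T,F,F,T,T], 1), ([T,F,T,T,F], 2), ([T,T,F,T,T], 1), ([T,T,T,T,T], 2)],
      [([1, 0, 0, 1, 0, 0], [4, 5], 10), ([0, 1, 0, 1, 0, 0], [2, 4, 5, 1, 3], 11), ([1, 1, 1, 1, 0, 0], [1, 5], 10), ([0, 0, 0, 0, 1, 0], [0, 5], 10), ([1, 0, 0, 1, 1, 0], [1, 0, 5, 3, 4], 11), ([1, 1, 0, 1, 1, 0], [0, 1, 5, 4, 3], 11), ([1, 1, 1, 2, 1, 0], [1, 5], 10)],
      [[F,T,T,T,F], [F,T,F,T,T], [T,T,T,T,T], [T,F,F,T,T], [T,T,F,F,T], [F,T,T,F,T], [T,F,T,T,F], [T,F,F,F,F], [F,F,T,F,F]],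
      [[F,F,F,F,F], [T,F,T,F,F], [F,T,T,F,F], [T,F,F,T,F], [F,T,F,T,F], [F,F,T,T,F], [T,T,T,T,F], [T,F,F,F,T], [F,T,F,F,T], [F,F,T,F,T], [T,T,T,F,T], [F,F,F,T,T], [T,T,F,T,T], [T,F,T,T,T], [F,T,T,T,T]],
      [([-5964690534, 2619400732, -1044803291, 911040306, 1607363168, 1136771040, -35720553, -688517597, -37742481, 701472537, 171781308, 1518808115, -164471301, -18167739, -149777478], [20997673044, 701639412, -9723618924, 3216057636, -20507597340, -43077880428], 110103885684)]),
    ([([T,F,F,F,F], 1), ([T,F,F,T,T], 1), ([T,F,T,F,T], 2), ([T,T,T,F,F], 2), ([T,T,T,T,T], 2)],
      [],
      [[T,T,T,F,F], [T,F,T,F,T], [F,T,T,T,F], [F,T,F,T,T], [F,F,T,T,T], [F,T,T,F,T], [T,T,T,T,T]],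
      [[F,F,F,F,F], [T,T,F,F,F], [T,F,F,T,F], [T,F,F,F,T], [F,T,F,F,T], [F,F,T,F,T], [T,T,F,T,T]],
      [([702, 324, -1079, -243, 379, 243, 42], [0, 0, 0, 0, -7696], 17496)]),
    ([([T,F,F,F,F], 1), ([T,F,F,F,T], 1), ([T,F,F,T,T], 1), ([T,F,T,T,T], 1), ([T,T,F,T,T], 1), ([T,T,T,T,F], 2), ([T,T,T,T,T], 1)],
      [],
      [[T,T,T,T,T], [F,T,T,T,F], [T,F,F,T,T], [T,F,F,F,F], [F,T,F,F,F], [F,F,T,F,F], [F,F,F,F,T]],
      [[F,F,F,F,F], [F,T,F,F,T], [F,F,T,F,T], [T,T,T,F,T]],
      [([-252, 69, 69, 22], [648, -648, 648, -1476, -1476, -1440, -720], 6228)]),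
    ([([T,F,F,F,F], 1), ([T,F,F,F,T], 1), ([T,F,F,T,F], 1), ([T,F,T,T,T], 2), ([T,T,T,F,F], 1), ([T,T,T,F,T], 1), ([T,T,T,T,T], 1)],
      [],
      [[T,T,T,T,T], [T,F,T,F,T], [F,F,T,T,T], [F,T,T,F,T], [T,F,F,T,T], [T,F,T,T,F], [T,T,T,F,F], [F,T,T,T,F], [T,F,F,F,F], [F,F,F,T,F], [F,F,F,F,T]],
      [[T,T,F,F,F], [F,T,F,T,F], [F,T,F,F,T], [T,T,F,T,T]],
      [([-9, -9, -15, -5], [0, 0, 0, -144, 0, 0, -288], 666)]),
    ([([T,F,F,F], 1), ([T,F,F,T], 1), ([T,F,T,T], 2), ([T,T,T,F], 2), ([T,T,T,T], 2)],
      [([0, 0, 1, 0, 0], [0, 4], 10), ([1, 1, 1, 0, 0], [1, 2, 4], 0), ([0, 1, 2, 0, 0], [1, 4], 10), ([1, 0, 0, 1, 0], [3, 4], 10), ([1, 0, 1, 1, 0], [1, 3, 0, 4, 2], 11), ([0, 1, 2, 1, 0], [3, 1, 2, 4, 0], 12), ([0, 0, 0, 2, 0], [3, 4], 10), ([1, 0, 1, 2, 0], [3, 4], 10), ([1, 1, 1, 2, 0], [0, 4, 1, 2, 3], 13), ([1, 0, 2, 2, 0], [0, 1, 2, 4, 3], 14), ([1, 1, 1, 0, 1], [0, 1, 4, 2, 3], 15), ([0, 1, 0, 1, 1], [3, 1, 2, 4, 0], 16), ([1, 0, 0, 2, 1], [3, 4], 10)],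
      [[T,T,T,F], [T,F,T,T], [F,T,T,T], [T,F,F,F], [F,T,F,F], [F,F,F,T]],
      [[F,F,F,F], [T,T,F,F], [T,F,T,F], [F,T,T,F], [T,F,F,T], [F,T,F,T], [F,F,T,T], [T,T,T,T]],
      [([0, 3, 0, 0, 0, 0, 0, 0], [0, 0, 0, -26, -26], 107), ([0, 0, -1, 1, -1, 0, -3, 0], [0, 24, -108, 0, 0], 216), ([0, 199, 0, 0, -45, 486, 0, 0], [1028, 0, -504, -544, -3044], 8678), ([28, 0, 0, 0, 0, 17, -5, 0], [112, 0, -20, 0, -112], 280), ([465, 544, 83, 58, -68, 899, 0, 3], [3576, 0, -552, -1968, -4872], 14844), ([16911, 13223, 2896, 1552, -1686, 24822, 0, 14], [116976, 47064, 0, -32436, -95628], 269856), ([0, 311670, 109365, 71357, -72879, 275902, 116474, 2827], [0, -1379760, -1265916, -1002036, -2381796], 10541280), ([10791, 7641, 1134, 900, -552, 7866, 297, 23], [29736, 0, -3960, -40032, -36648], 171864), ([-60, 141, 35, 62, 28, 111, 79, 0], [2448, -168, -528, -1128, 384], 2472), ([0, 219606, 94299, 80426, 0, 34506, 50316, 3273], [1380204, 0, -872928, -499032, -308196], 3318660)]),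
    ([([T,F,F,F], 1), ([T,F,F,T], 1), ([T,F,T,T], 2), ([T,T,T,F], 1), ([T,T,T,T], 3)],
      [([0, 0, 1, 0, 0], [0, 4], 10), ([0, 1, 2, 0, 0], [1, 4], 10), ([1, 0, 1, 1, 0], [3, 4], 10), ([1, 1, 2, 1, 0], [1, 4], 10), ([0, 0, 0, 0, 1], [0, 4], 10), ([1, 0, 0, 1, 1], [0, 1, 2, 4], 17), ([1, 1, 1, 0, 2], [1, 0, 2, 4], 17)],
      [[T,F,T,T], [T,T,T,F], [F,T,T,T], [T,F,F,F], [F,T,F,F], [F,F,F,T]],
      [[F,F,F,F], [T,T,F,F], [F,T,T,F], [T,F,F,T], [F,T,F,T], [T,T,T,T]],
      [([78327, 6669, -1857, -5631, 6669, -317], [18612, 80424, 0, -18612, -85968], 319680)]),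
    ([([T,F,F], 2), ([T,F,T], 2), ([T,T,T], 4)],
      [([1, 0, 0], [0, 2, 3], 0), ([0, 1, 0], [0, 3], 10), ([2, 1, 0], [1, 2, 3], 0), ([1, 2, 0], [1, 3], 10), ([1, 0, 1], [0, 1, 2, 3], 18), ([2, 1, 1], [1, 0, 2, 3], 18), ([1, 0, 2], [0, 1, 2, 3], 17), ([2, 1, 2], [1, 0, 2, 3], 17)],
      [[T,T,T], [T,F,F], [F,T,F]],
      [[T,T,F], [T,F,T], [F,T,T]],
      [([166, 35, 35], [140, -140, -832], 3564)]),
    ([([T,F,F,F,F], 2), ([T,F,F,T,T], 1), ([T,F,T,F,T], 2), ([T,T,T,F,F], 2), ([T,T,T,T,T], 1)],
      [([0, 0, 1, 0, 0], [0, 5], 10), ([1, 0, 0, 1, 0], [0, 4, 5], 19), ([2, 0, 2, 1, 0], [2, 5, 1], 19), ([1, 1, 0, 2, 0], [3, 5, 4], 19), ([2, 1, 2, 2, 0], [2, 5, 1], 19), ([2, 0, 0, 1, 1], [3, 5, 4], 19), ([2, 0, 2, 1, 1], [4, 5, 3], 19), ([2, 1, 2, 1, 1], [2, 5, 1], 19)],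
      [[T,T,T,F,F], [F,T,T,T,F], [T,F,T,F,T], [F,T,F,T,T], [F,F,T,T,T], [F,T,T,F,T], [T,T,T,T,T]],
      [[F,F,F,F,F], [T,T,F,F,F], [T,F,T,F,F], [F,T,T,F,F], [T,F,F,T,F], [F,T,F,T,F], [T,T,T,T,F], [T,F,F,F,T], [F,T,F,F,T], [F,F,T,F,T], [T,T,T,F,T], [F,F,F,T,T], [T,T,F,T,T], [T,F,T,T,T], [F,T,T,T,T]],
      [([-181524, -59316, -9498, 0, 205278, 11313, 13206, 34770, -94236, -35103, 0, 0, -31404, -15184, -5526], [408528, -385344, -125616, 0, -976848], 1621320), ([-41472, 73017, 28251, -16360, 487908, -24507, 0, -48888, 361344, 57891, -9800, -25828, 77139, 13777, -21816], [-1177776, -1800288, 373608, -64368, -1666656], 3990600)]),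
    ([([T,F,F,T], 2), ([T,F,T,F], 3), ([T,T,T,T], 3)],
      [([0, 1, 0], [0, 4], 10), ([2, 2, 0], [1, 4], 10), ([0, 1, 1], [2, 4, 0], 19), ([2, 2, 1], [3, 4, 1], 19), ([2, 2, 2], [4, 3, 1, 0, 2], 20)],
      [[T,T,T,F], [T,T,F,T], [T,F,T,T], [F,T,T,T]],
      [[F,F,F,F], [T,F,T,F], [F,T,T,F], [T,F,F,T], [F,T,F,T]],
      [([-378, -2, -33, 33, 20], [-504, -504, 936], -720)]),
    ([([T,F,F,F,F], 1), ([T,F,F,F,T], 1), ([T,F,F,T,T], 1), ([T,F,T,F,T], 2), ([T,T,T,F,F], 2), ([T,T,T,T,T], 1)],
      [([1, 0, 1, 0, 0, 0], [2, 5], 10), ([1, 1, 1, 1, 0, 0], [1, 2, 5], 0), ([0, 0, 0, 2, 0, 0], [0, 1, 5, 2], 21), ([0, 0, 0, 0, 1, 0], [0, 5], 10), ([0, 1, 1, 0, 1, 0], [1, 5, 2], 19), ([1, 1, 1, 2, 1, 0], [1, 5], 10), ([0, 0, 0, 0, 0, 1], [0, 5], 10), ([1, 0, 1, 0, 0, 1], [1, 5, 2], 19)],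
      [[F,T,T,T,F], [T,T,T,F,F], [T,F,T,F,T], [T,F,F,T,T], [F,T,F,T,T], [F,F,T,T,T], [T,T,T,T,T], [T,T,F,T,F], [F,T,T,F,T], [T,F,F,F,F]],
      [[F,F,F,F,F], [T,T,F,F,F], [T,F,T,F,F], [F,T,T,F,F], [T,F,F,T,F], [F,F,T,T,F], [T,T,T,T,F], [T,F,F,F,T], [F,T,F,F,T], [F,F,T,F,T], [T,T,T,F,T], [F,F,F,T,T], [T,T,F,T,T], [F,T,T,T,T]],
      [([-190595421, -137934191, -40205059, -3002971, -10298034, -253301940, -1157566, -11641899, -209577573, -54118755, -2375263, -12753866, 2709666, 65391720], [-19315560, 155287392, -544953984, -194317896, 153491880, -694723056], 1958988840)]),
    ([([T,F,F,F,F], 1), ([T,F,F,F,T], 2), ([T,F,F,T,T], 1), ([T,F,T,T,F], 2), ([T,T,T,F,T], 2)],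
      [([0, 1, 0, 0, 0], [0, 5], 10), ([1, 1, 0, 0, 0], [0, 2, 5], 19), ([1, 1, 0, 0, 2], [3, 5], 10), ([1, 1, 0, 2, 2], [4, 2, 1, 3, 5], 22), ([1, 2, 0, 2, 2], [1, 3, 2, 5], 21)],
      [[F,T,T,T,F], [F,T,T,F,T], [T,T,T,T,T], [T,T,F,F,T], [T,F,T,F,T], [T,T,T,F,F], [T,F,T,T,F], [T,F,F,F,F], [F,T,F,T,T]],
      [[F,F,F,F,F], [F,T,T,F,F], [T,F,F,T,F], [F,T,F,T,F], [F,F,T,T,F], [T,T,T,T,F], [F,T,F,F,T], [F,F,T,F,T], [T,T,T,F,T], [F,F,F,T,T], [T,T,F,T,T], [T,F,T,T,T], [F,T,T,T,T]],
      [([58322637, 1731855, -29973618, 76962879, 22006665, 7881440, 6645663, 109981089, -25248546, -96371073, -6769206, -3207222, 6378597], [195436296, 45627552, -739793160, -58981320, -171511488], 1143135648)]),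
    ([([T,F,F,F], 2), ([T,F,F,T], 1), ([T,F,T,F], 2), ([T,T,T,F], 2), ([T,T,T,T], 1)],
      [([1, 0, 0, 0, 0], [0, 4], 10), ([1, 1, 0, 0, 0], [2, 4], 10), ([0, 0, 1, 0, 0], [0, 4], 10), ([2, 1, 1, 0, 0], [1, 2, 4], 0), ([0, 0, 2, 0, 0], [0, 1, 4, 2], 21), ([1, 0, 2, 0, 0], [2, 4, 1], 19), ([0, 0, 0, 1, 0], [0, 4], 10), ([2, 0, 0, 1, 0], [1, 4, 2], 19), ([1, 1, 0, 1, 0], [1, 4, 2], 19), ([2, 0, 2, 1, 0], [2, 4, 1], 19), ([1, 1, 2, 1, 0], [2, 4, 1], 19), ([2, 1, 2, 1, 0], [1, 4], 10), ([1, 0, 0, 2, 0], [0, 1, 2, 3, 4], 22), ([2, 0, 0, 2, 0], [1, 4, 2, 3], 21), ([2, 0, 1, 2, 0], [3, 4], 10), ([1, 0, 2, 2, 0], [3, 4], 10), ([2, 1, 2, 2, 0], [2, 4, 1], 19), ([0, 0, 0, 0, 1], [0, 4], 10), ([1, 1, 0, 0, 1], [1, 4, 2], 19), ([0, 0, 2, 0, 1], [4, 2, 1, 3, 0], 23), ([2, 1, 2, 1, 1], [2, 4, 1], 19), ([2, 0, 0, 2, 1], [4, 1, 2, 0, 3], 23), ([2, 0, 2, 2, 1], [3, 4], 10)],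
      [[T,T,T,F], [F,T,T,T], [T,T,F,T], [T,F,T,T], [T,F,F,F], [F,F,F,T]],
      [[F,F,F,F], [T,T,F,F], [T,F,T,F], [F,T,T,F], [T,F,F,T], [F,T,F,T], [F,F,T,T], [T,T,T,T]],
      [([11417, 652, -1596, 687, 2271, 0, -3642, -393], [7824, 0, -6384, -14664, -15784], 68936), ([0, 0, 0, 2, 0, 0, -7, 0], [0, 0, 0, -48, 0], 123), ([33813, -3000, -1565, 432, 0, -1565, -4234, -285], [-24264, 14544, 0, 9456, 20424], 18648), ([-1, -1, 0, 0, 0, 0, 0, 0], [0, 0, 0, -4, -4], 12), ([602, -177, -29, 0, 100, -79, -75, -6], [0, 0, 600, 0, -176], 1088), ([6183, -675, -216, 68, 0, -322, -663, -51], [-4248, 2448, 1080, 2736, 4536], 0), ([333, -33, -10, 4, 0, -19, -40, -3], [-288, 96, 108, 96, 288], 48), ([10, 0, 0, 1, 0, 0, -1, 0], [0, 4, 0, -4, 0], 20), ([417, -87, -24, 0, 36, -34, -87, -9], [-240, 96, 120, 120, 264], 336), ([0, 0, 1, 1, -3, 1, 0, 0], [0, 0, 0, 0, 0], 0), ([1188, -225, -69, 0, 0, -69, -225, -16], [-792, 1008, 0, 792, 0], 792), ([1157, -174, -71, 0, 90, -78, -301, -19], [0, 104, 84, 424, 432], 856), ([5280, 0, 0, -164, -63, -845, -2535, 3], [-2892, -2316, 10140, 2892, 3756], -864), ([0, -207, -47, 0, 186, -47, -207, -30], [192, -1000, 0, -192, 1144], 1512), ([1131, -192, -78, 0, 0,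 -50, -192, -15], [-612, 672, -336, 948, 408], 456), ([0, -375, -187, -56, -126, 125, 629, 78], [-816, -936, -3744, 0, 1896], 4488), ([0, 12, 3, 1, -3, -2, -3, 0], [-48, 24, 60, 48, 72], -168)]),
    ([([T,F,F,F,F], 1), ([T,F,F,F,T], 1), ([T,F,F,T,F], 1), ([T,F,T,T,T], 2), ([T,T,T,F,F], 1), ([T,T,T,F,T], 1), ([T,T,T,T,F], 1)],
      [],
      [[T,T,T,T,T], [T,F,T,T,F], [T,F,T,F,T], [F,F,T,T,T], [T,T,T,F,F], [F,T,T,T,F], [F,T,T,F,T], [T,F,F,T,T], [T,F,F,F,F], [F,F,F,T,F], [F,F,F,F,T]],
      [[T,F,F,T,F], [T,F,F,F,T], [F,T,F,F,T], [F,F,F,T,T], [T,T,F,T,T]],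
      [([-331, -334, -135, -334, -1108], [4356, 0, -2816, -16420, 0, -4356, -3060], 44496)]),
    ([([T,F,F,F], 2), ([T,F,F,T], 1), ([T,F,T,T], 2), ([T,T,F,T], 2), ([T,T,T,T], 1)],
      [([0, 0, 1, 0, 0], [0, 4], 10), ([0, 1, 2, 0, 0], [0, 1, 3, 4], 21), ([0, 0, 0, 1, 0], [0, 4], 10), ([0, 0, 1, 1, 0], [3, 4, 0], 19), ([2, 0, 1, 1, 0], [0, 4, 3], 19), ([0, 1, 0, 2, 0], [1, 0, 3, 4], 24), ([2, 1, 2, 2, 0], [1, 2, 4], 19), ([0, 0, 0, 0, 1], [0, 4], 10), ([0, 0, 1, 0, 1], [3, 4, 0], 19), ([2, 1, 2, 0, 1], [1, 4], 10), ([0, 0, 0, 1, 1], [3, 4, 0], 19), ([0, 0, 1, 1, 1], [1, 0, 3, 4], 24), ([2, 0, 1, 1, 1], [1, 0, 3, 2, 4], 25), ([2, 1, 0, 2, 1], [2, 4], 10)],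
      [[T,T,F,T], [F,T,T,T], [T,F,T,T], [T,F,F,F], [F,T,F,F], [F,F,T,F]],
      [[F,F,F,F], [T,T,F,F], [T,F,T,F], [F,T,T,F], [T,F,F,T], [F,T,F,T], [F,F,T,T]],
      [([10, 3, 3, 1, -1, 1, 1], [-32, 44, 32, 32, 0], -66)]),
    ([([T,F,F], 2), ([T,F,T], 3), ([T,T,T], 3)],
      [([0, 1, 0], [0, 3], 10), ([2, 1, 0], [2, 3], 10), ([0, 2, 0], [2, 3, 0], 19), ([0, 3, 0], [0, 1, 2, 3], 21), ([1, 3, 0], [1, 3], 10), ([0, 0, 1], [0, 3], 10), ([0, 1, 1], [2, 3, 0], 19), ([2, 1, 1], [0, 3, 2], 19), ([2, 3, 1], [1, 3], 10), ([0, 0, 2], [2, 3, 0], 19), ([0, 1, 2], [1, 0, 2, 3], 24), ([2, 1, 2], [0, 1, 3, 2], 26)],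
      [[T,T,T], [T,F,F], [F,T,F]],
      [[F,F,F], [T,T,F], [T,F,T], [F,T,T]],
      [([60, 39, -14, 15], [-372, 600, 816], -2064)]),
    ([([T,F], 2), ([T,T], 6)],
      [([0, 1], [0, 2], 10), ([2, 1], [1, 2], 10), ([0, 2], [1, 2, 0], 19), ([2, 2], [0, 2, 1], 19), ([0, 3], [1, 2, 0], 27), ([2, 3], [0, 2, 1], 27)],
      [[T,F], [F,T]],
      [[T,T]],
      [([-1], [0, 36], -135)]),
    ([([T,F,F,F], 1), ([T,F,F,T], 1), ([T,F,T,F], 2), ([T,T,F,F], 2), ([T,T,T,F], 1), ([T,T,T,T], 1)],
      [([1, 0, 0, 0, 0, 0], [0, 4], 10), ([0, 1, 0, 0, 0, 0], [0, 4], 10), ([1, 0, 1, 0, 0, 0], [0, 4], 28), ([0, 1, 1, 0, 0, 0], [0, 4], 28), ([0, 0, 2, 0, 0, 0], [0, 4], 28), ([0, 0, 0, 1, 0, 0], [0, 4], 10), ([1, 0, 0, 1, 0, 0], [0, 4], 28), ([1, 1, 0, 1, 0, 0], [2, 4], 10), ([0, 0, 1, 1, 0, 0], [0, 4], 28), ([1, 1, 1, 1, 0, 0], [1, 4], 28), ([1, 0, 2, 1, 0, 0], [1, 4], 28), ([0, 0, 0, 2, 0, 0], [0, 4], 28), ([0, 1, 0, 2, 0, 0], [2, 4], 10), ([1, 0, 1, 2, 0, 0], [2, 4], 28), ([0, 1, 1, 2, 0, 0], [2, 4], 28), ([1, 1, 1, 2, 0, 0], [2, 4], 10), ([0, 0,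 2, 2, 0, 0], [3, 4], 28), ([1, 0, 2, 2, 0, 0], [3, 4], 10), ([1, 0, 0, 0, 1, 0], [0, 4], 28), ([0, 1, 0, 0, 1, 0], [0, 4], 28), ([0, 0, 1, 0, 1, 0], [0, 4], 28), ([1, 0, 2, 0, 1, 0], [1, 4], 28), ([0, 0, 0, 1, 1, 0], [0, 4], 28), ([1, 1, 0, 1, 1, 0], [2, 4], 28), ([1, 0, 1, 1, 1, 0], [3, 4], 28), ([0, 0, 2, 1, 1, 0], [3, 4], 28), ([1, 1, 2, 1, 1, 0], [1, 4], 28), ([1, 0, 0, 2, 1, 0], [2, 4], 28), ([0, 1, 0, 2, 1, 0], [2, 4], 28), ([1, 1, 0, 2, 1, 0], [2, 4], 10), ([0, 0, 1, 2, 1, 0], [3, 4], 28), ([1, 0, 1, 2, 1, 0], [3, 4], 10), ([0, 1, 2, 2, 1, 0], [3, 4], 28), ([1, 1, 2, 2, 1, 0], [3, 4], 10), ([1, 0, 0, 0, 0, 1], [0, 4], 28), ([0, 1, 0, 0, 0, 1], [0, 4], 28), ([0, 0, 0, 1, 0, 1], [0, 4], 28), ([1, 1, 0, 1, 0, 1], [2, 4], 28), ([0, 1, 0, 2, 0, 1], [2, 4], 28), ([1, 1, 1, 2, 0, 1], [2, 4], 28), ([1, 0, 2, 2, 0, 1], [3, 4], 28), ([1, 1, 0, 2, 1, 1], [2, 4], 28), ([1, 0, 1, 2, 1, 1], [3, 4], 28), ([1, 1, 2, 2, 1, 1], [3, 4], 28)],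
      [[T,T,T,F], [F,T,T,T], [T,T,F,T], [T,F,T,T], [T,F,F,F], [F,T,F,F], [F,F,T,F], [F,F,F,T]],
      [[F,F,F,F], [T,F,T,F], [T,F,F,T], [F,F,T,T]],
      [([-15, 1, -3, 1], [-12, 12, 12, -12, 12, 36], -36)]),
    ([([T,F,F,F], 1), ([T,F,F,T], 1), ([T,F,T,F], 1), ([T,F,T,T], 1), ([T,T,F,T], 2), ([T,T,T,F], 2)],
      [([0, 1, 0, 0, 0, 0], [0, 4], 10), ([0, 0, 1, 0, 0, 0], [0, 4], 10), ([0, 1, 0, 1, 0, 0], [0, 4], 28), ([1, 1, 0, 1, 0, 0], [1, 4], 10), ([1, 0, 1, 1, 0, 0], [1, 4], 10), ([0, 1, 1, 1, 0, 0], [1, 4], 10), ([0, 0, 0, 0, 1, 0], [0, 4], 10), ([1, 0, 0, 0, 1, 0], [0, 4], 28), ([1, 1, 0, 0, 1, 0], [2, 4], 10), ([0, 0, 1, 0, 1, 0], [0, 4], 28), ([1, 1, 1, 0, 1, 0], [1, 4], 28), ([0, 0, 0, 1, 1, 0], [0, 4], 28), ([1, 1, 0, 1, 1, 0], [1, 4], 28), ([1, 0, 1, 1, 1, 0], [1, 4], 28), ([0, 1, 1, 1, 1, 0], [1, 4], 28), ([1, 1, 1, 1, 1, 0], [1, 4], 10), ([1, 0, 0, 0, 2, 0], [2, 4], 10), ([0, 1, 0, 0, 2, 0], [2, 4], 10), ([0, 1, 1, 0, 2, 0], [2, 4], 28), ([1, 1, 1, 0, 2, 0], [2, 4], 10),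 ([1, 0, 0, 1, 2, 0], [2, 4], 28), ([0, 1, 0, 1, 2, 0], [2, 4], 28), ([1, 1, 0, 1, 2, 0], [2, 4], 10), ([0, 0, 0, 0, 0, 1], [0, 4], 10), ([1, 0, 0, 0, 0, 1], [0, 4], 28), ([0, 1, 0, 0, 0, 1], [0, 4], 28), ([0, 0, 1, 0, 0, 1], [0, 4], 28), ([1, 0, 1, 0, 0, 1], [3, 4], 10), ([1, 1, 1, 0, 0, 1], [1, 4], 28), ([0, 0, 0, 1, 0, 1], [0, 4], 28), ([1, 1, 0, 1, 0, 1], [1, 4], 28), ([1, 0, 1, 1, 0, 1], [1, 4], 28), ([0, 1, 1, 1, 0, 1], [1, 4], 28), ([0, 0, 0, 0, 1, 1], [0, 4], 28), ([1, 1, 0, 0, 1, 1], [2, 4], 28), ([1, 0, 1, 0, 1, 1], [3, 4], 28), ([0, 1, 1, 0, 1, 1], [2, 0, 4, 3], 29), ([1, 0, 0, 1, 1, 1], [2, 1, 4, 3], 29), ([1, 1, 1, 1, 1, 1], [1, 4], 28), ([1, 0, 0, 0, 2, 1], [2, 4], 28), ([0, 1, 0, 0, 2, 1], [2, 4], 28), ([0, 0, 1, 0, 2, 1], [1, 0, 2, 4], 29), ([1, 1, 1, 0, 2, 1], [2, 4], 28), ([1, 1, 0, 1, 2, 1], [2, 4], 28), ([1, 0, 1, 1, 2, 1], [0, 1, 2, 4], 29), ([1, 0, 0, 0, 0, 2], [3, 4], 10), ([0, 0, 1, 0, 0, 2], [3, 4], 10), ([0, 1, 1, 0, 0, 2],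 [3, 4], 28), ([1, 0, 0, 1, 0, 2], [3, 4], 28), ([1, 0, 0, 0, 1, 2], [3, 4], 28), ([0, 1, 0, 0, 1, 2], [1, 0, 3, 4], 29), ([0, 0, 1, 0, 1, 2], [3, 4], 28), ([1, 1, 1, 0, 1, 2], [3, 4], 28), ([1, 1, 0, 1, 1, 2], [0, 1, 3, 4], 29), ([1, 1, 0, 0, 2, 2], [2, 4], 28), ([1, 0, 1, 0, 2, 2], [3, 4], 28)],
      [[T,T,T,F], [T,T,F,T], [T,F,T,T], [F,T,T,T], [T,F,F,F], [F,T,F,F], [F,F,T,F], [F,F,F,T]],
      [[F,F,F,F], [T,T,F,F], [T,F,T,F], [F,T,T,F], [T,F,F,T], [F,T,F,T], [F,F,T,T], [T,T,T,T]],
      [([-29691, 669, 1455, 597, 777, -69, -3555, -23], [-31176, 2160, 18000, 51336, 15624, 31464], -87768)]),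
    ([([T,F,F], 2), ([T,F,T], 2), ([T,T,F], 2), ([T,T,T], 2)],
      [([1, 0, 0, 0], [0, 3], 10), ([0, 1, 0, 0], [0, 3], 10), ([2, 1, 0, 0], [1, 3], 10), ([1, 2, 0, 0], [1, 3], 10), ([0, 0, 1, 0], [0, 3], 10), ([1, 0, 1, 0], [0, 3], 28), ([2, 0, 1, 0], [2, 3], 10), ([0, 1, 1, 0], [0, 3], 28), ([2, 1, 1, 0], [1, 3], 28), ([1, 2, 1, 0], [1, 3], 28), ([2, 2, 1, 0], [1, 3], 10), ([1, 0, 2, 0], [2, 3], 10), ([1, 1, 2, 0], [2, 3], 28), ([2, 1, 2, 0], [2, 3], 10), ([1, 0, 0, 1], [0, 3], 28), ([0, 1, 0, 1], [0, 3], 28), ([2, 1, 0, 1], [1, 3], 28), ([1, 2, 0, 1], [1, 3], 28), ([0, 0, 1, 1], [0, 3], 28), ([2, 0, 1, 1], [2, 3], 28), ([2, 2, 1, 1], [1, 3], 28), ([1, 0, 2, 1], [2, 3], 28), ([0, 1, 2, 1], [1, 0, 2, 3], 29), ([2, 1, 2, 1], [2, 3], 28), ([1, 2, 2, 1], [0, 1, 2, 3], 29), ([1, 0, 1, 2], [0, 2, 1, 3], 30), ([2, 1, 1, 2], [1, 2, 0, 3], 30)],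
      [[T,T,T], [T,F,F], [F,T,F], [F,F,T]],
      [[F,F,F], [T,T,F], [T,F,T], [F,T,T]],
      [([-39, 3, 2, 2], [-24, 24, 12, 60], -96)]),
    ([([T,F], 4), ([T,T], 4)],
      [([1, 0], [0, 2], 10), ([2, 0], [0, 2], 28), ([3, 0], [1, 2], 10), ([1, 1], [0, 2], 28), ([3, 1], [1, 2], 28), ([0, 2], [0, 2], 28), ([2, 2], [0, 1, 2], 31), ([4, 2], [1, 2], 28)],
      [[T,F], [F,T]],
      [[F,F], [T,T]],
      [([-21, 1], [0, 36], -84), ([21, -1], [0, -36], 84)]),
    ([([T], 8)],
      [([1], [0, 1], 10), ([2], [0, 1], 28), ([4], [0, 1], 32)],
      [[T]],
      [[F]],
      [([-3], [2], -9)])]"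

lemma check_chain_certificate_8: "check_entries 8 [chain_pattern 8] chain_certificate_8"
  by code_simp

section \<open>Classification of splitting matrices up to order 8\<close>

lemma has_chain_if_card:
  assumes M: "splitting_matrix R C a" and R: "card R \<in> {3, 5, 6, 7, 8}"
  shows "has_chain R C a"
proof -
  have ne: "R \<noteq> {}" using R by auto
  have "[([True], 3)] \<in> fst ` set chain_certificate_3"
    by (simp add: chain_certificate_3_def)
  then have "has_chain R C a" if "card R = 3"
    using has_chain_certificate_column[OF M ne, of chain_certificate_3] check_chain_certificate_3 that by simp
  moreover
  have "[([True], 5)] \<in> fst ` set chain_certificate_5"
    by (simp add: chain_certificate_5_def)
  then have "has_chain R C a" if "card R = 5"
    using has_chain_certificate_column[OF M ne, of chain_certificate_5] check_chain_certificate_5 that by simp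
  moreover
  have "[([True], 6)] \<in> fst ` set chain_certificate_6"
    by (simp add: chain_certificate_6_def)
  then have "has_chain R C a" if "card R = 6"
    using has_chain_certificate_column[OF M ne, of chain_certificate_6] check_chain_certificate_6 that by simp
  moreover
  have "[([True], 7)] \<in> fst ` set chain_certificate_7"
    by (simp add: chain_certificate_7_def)
  then have "has_chain R C a" if "card R = 7"
    using has_chain_certificate_column[OF M ne, of chain_certificate_7] check_chain_certificate_7 that by simp
  moreover
  have "[([True], 8)] \<in> fst ` set chain_certificate_8"
    by (simp add: chain_certificate_8_def)
  then have "has_chain R C a" if "card R = 8"
    using has_chain_certificate_column[OF M ne, of chain_certificate_8] check_chain_certificate_8 that by simp
  ultimately show ?thesis using R by blast
qed

lemma has_chain_if_antipodes:
  assumes M: "splitting_matrix R C a" and R: "card R = 4"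
    and pq: "p \<in> C" "q \<in> C" "\<And>i. i \<in> R \<Longrightarrow> a i q = - a i p"
  shows "has_chain R C a"
proof -
  have "[([True, False], 4)] \<in> fst ` set chain_certificate_4"
    by (simp add: chain_certificate_4_def)
  then show ?thesis
    using R check_chain_certificate_4
    by (intro has_chain_certificate_antipodal[OF M, of chain_certificate_4 p q] pq) auto
qed

text \<open>Induction by deleting row r and the columns q, \<open>q'\<close> of a chain. The outer
  columns p and s of the chain become neighbours in the smaller cycle, which tells where to
  reinsert. Without a chain only n = 4 with no antipodal columns is left.\<close>

theorem splitting_matrix_cases:
  assumes "splitting_matrix R C a" "R \<noteq> {}" "card R \<le> 8"
  shows "(\<exists>d \<rho>. standard_matrix R C a d \<rho>) \<or> exceptional_matrix R C a"
  using assms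
proof (induction "card R" arbitrary: R C rule: less_induct)
  case less
  note M = less.prems(1)
  have fin: "finite R" using M by (simp add: splitting_matrix_def)
  then have pos: "card R > 0" using less.prems(2) by (simp add: card_gt_0_iff)
  show ?case
  proof (cases "card R = 1")
    case True
    then show ?thesis using standard_matrix_1[OF M] by blast
  next
    case False
    show ?thesis
    proof (cases "has_chain R C a")
      case True
      then obtain p q s r t where mem: "p \<in> C" "q \<in> C" "s \<in> C" "r \<in> R" "t \<in> R" "r \<noteq> t"
        and "\<forall>i\<in>R. a i q = (if i = r then - a i p else a i p)"
        and "\<forall>i\<in>R. a i s = (if i = t then - a i q else a i q)"
        unfolding has_chain_def by blast
      then have pq: "\<And>i. i \<in> R \<Longrightarrow> a i q = (if i = r then - a i p else a i p)"
        and qs: "\<And>i. i \<in> R \<Longrightarrow> a i s = (if i = t then - a i q else a i q)"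
        by blast+
      obtain q' where q'C: "q' \<in> C" and q': "\<And>i. i \<in> R \<Longrightarrow> a i q' = - a i q"
        and rt: "\<And>l. l \<in> C \<Longrightarrow> l \<noteq> q \<Longrightarrow> l \<noteq> q' \<Longrightarrow> a r l * a r p = a t l * a t p"
        using splitting_matrix_chain[OF M mem pq qs] by blast
      have M': "splitting_matrix (R - {r}) (C - {q, q'}) a"
        using splitting_matrix_reduce[OF M mem(1,2) q'C mem(4,5,6) q' rt] by blast
      have nz: "a i p \<noteq> 0" if "i \<in> R" for i using M that mem(1) by (force simp: splitting_matrix_def)
      note rp = nz[OF mem(4)] and tp = nz[OF mem(5)]
      have "p \<noteq> q" using pq[OF mem(4)] rp by auto
      moreover have "p \<noteq> q'" using pq[OF mem(5)] q'[OF mem(5)] tp mem(6) by auto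
      moreover have "s \<noteq> q" using pq[OF mem(5)] qs[OF mem(5)] tp mem(6) by auto
      moreover have "s \<noteq> q'" using pq[OF mem(4)] qs[OF mem(4)] q'[OF mem(4)] rp mem(6) by auto
      ultimately have pC: "p \<in> C - {q, q'}" and sC: "s \<in> C - {q, q'}" using mem by auto
      have t: "t \<in> R - {r}" using mem by simp
      have ps: "a i s = (if i = t then - a i p else a i p)" if "i \<in> R - {r}" for i
        using pq[of i] qs[of i] that by auto
      have card': "card (R - {r}) = card R - 1" using fin mem(4) by simp
      have "(\<exists>d \<rho>. standard_matrix (R - {r}) (C - {q, q'}) a d \<rho>) \<or>
          exceptional_matrix (R - {r}) (C - {q, q'}) a"
      proof (rule less.hyps[OF _ M'])
        show "card (R - {r}) < card R" "card (R - {r}) \<le> 8" using card' pos less.prems(3) by simp_all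
        show "R - {r} \<noteq> {}" using t by blast
      qed
      then show ?thesis
      proof
        assume "\<exists>d \<rho>. standard_matrix (R - {r}) (C - {q, q'}) a d \<rho>"
        then obtain d0 \<rho>0 where std0: "standard_matrix (R - {r}) (C - {q, q'}) a d0 \<rho>0" by blast
        obtain d \<rho> where std: "standard_matrix (R - {r}) (C - {q, q'}) a d \<rho>"
          and start: "d 0 = p" "d 1 = s" "\<rho> 0 = t"
          using standard_matrix_edge[OF M' std0 pC sC t ps] by blast
        show ?thesis
          using standard_matrix_insert[OF M mem(1,2) q'C mem(4,5,6) pq qs q' rt std start] by blast
      next
        assume ex: "exceptional_matrix (R - {r}) (C - {q, q'}) a"
        then have "card (R - {r}) = 4" by (simp add: exceptional_matrix_def)
        then have "card R = 5" using card' by linarith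
        then show ?thesis
          using exceptional_matrix_chain_False[OF M _ mem(1,2,3) q'C mem(4,5,6) pq qs q' rt ex] by blast
      qed
    next
      case no_chain: False
      then have "card R \<noteq> 2" "card R \<notin> {3, 5, 6, 7, 8}"
        using has_chain_2[OF M] has_chain_if_card[OF M] by blast+
      then have R4: "card R = 4" using False pos less.prems(3) by force
      have "exceptional_matrix R C a"
      proof (rule exceptional_matrix_if_no_antipodes[OF M R4])
        fix p q assume "p \<in> C" "q \<in> C"
        then show "\<exists>i\<in>R. a i q \<noteq> - a i p" using has_chain_if_antipodes[OF M R4] no_chain by blast
      qed
      then show ?thesis ..
    qed
  qed
qed

section \<open>Equivalence of families\<close>

text \<open>The zero row sums come from uniformity, which for even k leaves only members of size
  k/2.\<close>

lemma splitting_matrix_if_minimal: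
  assumes min: "minimal_splitting_family k \<A>" and k: "even k" "k > 0"
  shows "splitting_matrix \<A> {1..k} (\<lambda>A j. if j \<in> A then 1 else - 1)"
proof -
  have sub: "A \<subseteq> {1..k}" if "A \<in> \<A>" for A
    using min that by (auto simp: minimal_splitting_family_def splitting_family_def)
  have "finite \<A>"
    using min finite_subset[of \<A> "Pow {1..k}"]
    by (auto simp: minimal_splitting_family_def splitting_family_def)
  moreover have "card {1..k} = 2 * card \<A>" using minimal_splitting_family_card[OF min k(2)] k by auto
  moreover have "(\<Sum>j\<in>{1..k}. if j \<in> A then 1 else - 1 :: int) = 0" if A: "A \<in> \<A>" for A
  proof -
    have "card A = k div 2"
      using minimal_splitting_family_uniform[OF min k(2)] A k by (auto simp: uniform_splitting_family_def elim!: evenE)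
    moreover have "A \<inter> {1..k} = A" using sub[OF A] by blast
    ultimately show ?thesis using k by (auto simp: excess_eq[unfolded excess_def] elim!: evenE)
  qed
  moreover have "\<exists>A\<in>\<A>. (\<Sum>j\<in>B. if j \<in> A then 1 else - 1 :: int) = 0"
    if B: "B \<subseteq> {1..k}" "even (card B)" for B
  proof -
    obtain A where A: "A \<in> \<A>" "splits A B"
      using min B(1) unfolding minimal_splitting_family_def splitting_family_def by blast
    have "finite B" using B(1) finite_subset by blast
    moreover have "2 * card (A \<inter> B) = card B" using A(2) B(2) by (simp add: splits_def)
    ultimately have "(\<Sum>j\<in>B. if j \<in> A then 1 else - 1 :: int) = 0" by (simp add: excess_eq[unfolded excess_def])
    with A(1) show ?thesis by blast
  qed
  ultimately show ?thesis unfolding splitting_matrix_def by auto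
qed

lemma permutes_image_eq:
  assumes "\<sigma> permutes S" "A \<subseteq> S" "Y \<subseteq> S" "\<And>j. j \<in> S \<Longrightarrow> \<sigma> j \<in> A \<longleftrightarrow> j \<in> Y"
  shows "\<sigma> ` Y = A"
proof
  show "A \<subseteq> \<sigma> ` Y"
  proof
    fix x assume x: "x \<in> A"
    then obtain j where "j \<in> S" "x = \<sigma> j" using assms(1,2) permutes_image by fastforce
    with x assms(4) show "x \<in> \<sigma> ` Y" by blast
  qed
qed (use assms in auto)

text \<open>The map f assigns to each member its partner in the target family, and
  \<open>\<sigma>\<close> carries points of the partner to points of the member, so the permutation
  required is the inverse of \<open>\<sigma>\<close>. Members that \<open>\<sigma>\<close> does not
  match as they stand are complemented.\<close>

lemma equivalent_familiesI:
  assumes \<sigma>: "\<sigma> permutes {1..k}" and \<A>: "\<A> \<subseteq> Pow {1..k}" and \<B>: "\<B> \<subseteq> Pow {1..k}" and f: "f ` \<A> = \<B>"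
    and same: "\<And>A. A \<in> \<A> \<Longrightarrow> (\<forall>j\<in>{1..k}. \<sigma> j \<in> A \<longleftrightarrow> j \<in> f A) \<or> (\<forall>j\<in>{1..k}. \<sigma> j \<in> A \<longleftrightarrow> j \<notin> f A)"
  shows "equivalent_families k \<A> \<B>"
proof -
  define \<S> where "\<S> = {A \<in> \<A>. \<sigma> ` f A \<noteq> A}"
  have inv: "inv \<sigma> ` (\<sigma> ` X) = X" for X using permutes_inj[OF \<sigma>] by (simp add: image_comp)
  have fA: "f A \<subseteq> {1..k}" if "A \<in> \<A>" for A using that f \<B> by auto
  have 1: "inv \<sigma> ` A = f A" if "A \<in> \<A> - \<S>" for A
    using that inv[of "f A"] by (auto simp: \<S>_def)
  have 2: "inv \<sigma> ` ({1..k} - A) = f A" if A: "A \<in> \<S>" for A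
  proof -
    have "A \<in> \<A>" using A by (simp add: \<S>_def)
    have "\<not> (\<forall>j\<in>{1..k}. \<sigma> j \<in> A \<longleftrightarrow> j \<in> f A)"
      using permutes_image_eq[OF \<sigma> _ fA, of A A] A \<A> by (auto simp: \<S>_def)
    then have "\<forall>j\<in>{1..k}. \<sigma> j \<in> A \<longleftrightarrow> j \<notin> f A" using same[OF \<open>A \<in> \<A>\<close>] by blast
    then have "\<sigma> ` f A = {1..k} - A"
      using \<sigma> permutes_in_image[OF \<sigma>] by (intro permutes_image_eq[OF \<sigma> _ fA[OF \<open>A \<in> \<A>\<close>]]) auto
    then show ?thesis using inv[of "f A"] by simp
  qed
  have "image (inv \<sigma>) ` ((\<A> - \<S>) \<union> (\<lambda>A. {1..k} - A) ` \<S>) = f ` (\<A> - \<S>) \<union> f ` \<S>"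
    using 1 2 by (simp add: image_Un image_image)
  also have "\<dots> = \<B>" using f by (auto simp: \<S>_def)
  finally show ?thesis
    unfolding equivalent_families_def using permutes_inv[OF \<sigma>] by (intro exI[of _ \<S>] exI[of _ "inv \<sigma>"]) (auto simp: \<S>_def)
qed

lemma standard_matrix_antipodes:
  assumes std: "standard_matrix R C a d \<rho>" and R: "card R > 0" and i: "i \<in> R"
  shows "a i (d (t + int (card R))) = - a i (d t)"
proof -
  note std' = standard_matrix_shift[OF std, of t]
  have "range (\<lambda>x. \<rho> (x + t)) = R" "\<And>x. \<rho> (x + int (card R) + t) = \<rho> (x + t)"
    using std' unfolding standard_matrix_def by blast+
  then have "(\<lambda>x. \<rho> (x + t)) ` {0..<int (card R)} = R"
    using inj_on_period(1)[of "\<lambda>x. \<rho> (x + t)" "card R"] R by simp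
  then show ?thesis using standard_matrix_steps[OF std' R order_refl i] i by (simp add: add.commute)
qed

text \<open>Label the points along the cycle. Row A changes sign between positions g A and g A + 1
  and again n steps later, so up to complement it is the interval from g A + 1 to g A + n, a
  standard set.\<close>

lemma equivalent_families_if_standard_matrix:
  assumes \<A>: "\<A> \<subseteq> Pow {1..k}" and k: "k = 2 * card \<A>" "k > 0"
    and std: "standard_matrix \<A> {1..k} (\<lambda>A j. if j \<in> A then 1 else - 1 :: int) d \<rho>"
  shows "equivalent_families k \<A> (standard_splitting_family k)"
proof -
  define n where "n = card \<A>"
  define a where "a A j = (if j \<in> A then 1 else - 1 :: int)" for A :: "nat set" and j
  have n: "n > 0" "k = 2 * n" using k by (simp_all add: n_def)
  have std: "standard_matrix \<A> {1..k} a d \<rho>" using std unfolding a_def .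
  have ranges: "range d = {1..k}" "range \<rho> = \<A>" using std by (simp_all add: standard_matrix_def)
  have period: "d (t + int k) = d t" "\<rho> (t + int n) = \<rho> t" for t
    using std by (simp_all add: standard_matrix_def n_def k)
  have d0: "d ` {0..<int k} = {1..k}" "inj_on d {0..<int k}"
    using inj_on_period[of d k] period(1) k(2) ranges(1) by simp_all
  have \<rho>0: "\<rho> ` {0..<int n} = \<A>" "inj_on \<rho> {0..<int n}"
    using inj_on_period[of \<rho> n] period(2) n(1) ranges(2) by (simp_all add: n_def)
  define \<sigma> where "\<sigma> j = (if j \<in> {1..k} then d (int j) else j)" for j
  have "d ` int ` {1..k} = {1..k}"
  proof (intro equalityI subsetI)
    fix x assume "x \<in> {1..k}"
    then have "x \<in> d ` {0..<int k}" using d0(1) by simp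
    then obtain t where "t \<in> {0..<int k}" and t: "x = d t" by (rule imageE)
    then have t01: "0 \<le> t" "t < int k" by simp_all
    \<comment> \<open>The labels run from 1 to k, so position 0 of the cycle is represented by
      k.\<close>
    have "x = d (int (if t = 0 then k else nat t))" using t t01 period(1)[of 0] by simp
    moreover have "(if t = 0 then k else nat t) \<in> {1..k}" using t01 k(2) by simp linarith
    ultimately show "x \<in> d ` int ` {1..k}" by blast
  qed (use ranges in blast)
  then have im: "\<sigma> ` {1..k} = {1..k}" by (simp add: \<sigma>_def image_image)
  then have "inj_on \<sigma> {1..k}" by (intro eq_card_imp_inj_on) simp_all
  with im have \<sigma>: "\<sigma> permutes {1..k}"
    by (intro bij_imp_permutes) (auto simp: bij_betw_def \<sigma>_def)
  have \<rho>': "bij_betw (\<lambda>y. \<rho> (int y)) {..<n} \<A>"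
  proof -
    have "bij_betw int {..<n} {0..<int n}"
      by (rule bij_betwI[of _ _ _ nat]) auto
    moreover have "bij_betw \<rho> {0..<int n} \<A>" using \<rho>0 by (simp add: bij_betw_def)
    ultimately show ?thesis using bij_betw_trans[of int] by (auto simp: comp_def)
  qed
  define g where "g = the_inv_into {..<n} (\<lambda>y. \<rho> (int y))"
  have g: "g A < n" "\<rho> (int (g A)) = A" if "A \<in> \<A>" for A
    using that \<rho>' the_inv_into_into[of "\<lambda>y. \<rho> (int y)" "{..<n}" A "{..<n}"] f_the_inv_into_f[of "\<lambda>y. \<rho> (int y)" "{..<n}" A]
    by (auto simp: g_def bij_betw_def)
  have g\<rho>: "g ` \<A> = {..<n}"
    using bij_betw_the_inv_into[OF \<rho>'] by (simp add: g_def bij_betw_def)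
  define f where "f A = {g A + 1..g A + n}" for A
  show ?thesis
  proof (rule equivalent_familiesI[OF \<sigma> \<A>, of _ f])
    show "standard_splitting_family k \<subseteq> Pow {1..k}" using n by (auto simp: standard_splitting_family_def)
    have "f ` \<A> = (\<lambda>y. {y + 1..y + n}) ` {..<n}" by (simp add: f_def image_image flip: g\<rho>)
    also have "\<dots> = (\<lambda>i. {i..i + n - 1}) ` Suc ` {..<n}" by (simp add: image_image)
    also have "\<dots> = standard_splitting_family k"
      using n(2) by (simp add: standard_splitting_family_def image_Suc_lessThan)
    finally show "f ` \<A> = standard_splitting_family k" .
  next
    fix A assume A: "A \<in> \<A>"
    have inj: "int m \<in> {0..<int n}" if "m < n" for m using that by simp
    have half: "a A (d (int m)) = (if g A < m then - a A (d 0) else a A (d 0))" if m: "m \<le> n" for m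
    proof -
      have "A \<in> \<rho> ` {0..<int m} \<longleftrightarrow> g A < m"
      proof
        assume "A \<in> \<rho> ` {0..<int m}"
        then obtain t where t: "t \<in> {0..<int m}" "A = \<rho> t" by blast
        then have "t = int (g A)" using inj_onD[OF \<rho>0(2), of t "int (g A)"] g[OF A] m by auto
        then show "g A < m" using t by simp
      next
        assume "g A < m"
        then show "A \<in> \<rho> ` {0..<int m}" using g(2)[OF A] by (intro image_eqI[of _ _ "int (g A)"]) auto
      qed
      then show ?thesis
        using standard_matrix_steps[OF std, of m A] m A n(1) by (simp add: n_def)
    qed
    have sign: "a A (\<sigma> j) = (if j \<in> f A then - a A (d 0) else a A (d 0))" if j: "j \<in> {1..k}" for j
    proof (cases "j \<le> n")
      case True
      then show ?thesis using half[of j] j g(1)[OF A] by (auto simp: \<sigma>_def f_def)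
    next
      \<comment> \<open>In the second half the entry is read off at the antipode m, where its sign
        is opposite.\<close>
      case False
      define m where "m = j - n"
      have m: "j = m + n" "m \<le> n" using False j n by (auto simp: m_def)
      have "a A (d (int m + int n)) = - a A (d (int m))"
        using standard_matrix_antipodes[OF std _ A] n(1) by (simp add: n_def)
      then have "a A (\<sigma> j) = - a A (d (int m))" using j by (simp add: \<sigma>_def m(1))
      then show ?thesis using half[OF m(2)] False g(1)[OF A] by (auto simp: f_def m(1))
    qed
    have mem: "x \<in> A \<longleftrightarrow> a A x = 1" for x by (simp add: a_def)
    have "a A (d 0) = 1 \<or> a A (d 0) = - 1" by (simp add: a_def)
    then show "(\<forall>j\<in>{1..k}. \<sigma> j \<in> A \<longleftrightarrow> j \<in> f A) \<or> (\<forall>j\<in>{1..k}. \<sigma> j \<in> A \<longleftrightarrow> j \<notin> f A)"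
      unfolding mem using sign by auto
  qed
qed

text \<open>Membership in u, x and y identifies the 8 points with the 8 truth triples, and z is
  determined by x and y up to complement. The target family has the same structure with {1, 3, 5, 7}
  in the place of u, so the permutation is found by matching triples.\<close>

lemma equivalent_families_if_exceptional_matrix:
  assumes M: "splitting_matrix \<A> {1..8} (\<lambda>A j. if j \<in> A then 1 else - 1 :: int)"
    and \<A>: "\<A> \<subseteq> Pow {1..8}"
    and ex: "exceptional_matrix \<A> {1..8} (\<lambda>A j. if j \<in> A then 1 else - 1 :: int)"
  shows "equivalent_families 8 \<A> exceptional_family"
proof -
  obtain u \<eta> where u: "u \<in> \<A>" and prod: "\<And>j. j \<in> {1..8} \<Longrightarrow> (\<Prod>A\<in>\<A> - {u}. if j \<in> A then 1 else - 1 :: int) = \<eta>"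
    using ex unfolding exceptional_matrix_def by blast
  have "card \<A> = 4" using ex by (simp add: exceptional_matrix_def)
  moreover have "finite \<A>" using M by (simp add: splitting_matrix_def)
  ultimately have "card (\<A> - {u}) = 3" using u by simp
  then obtain x y z where xyz: "\<A> - {u} = {x, y, z}" "x \<noteq> y" "x \<noteq> z" "y \<noteq> z"
    by (auto simp: card_Suc_eq numeral_eq_Suc)
  have \<A>': "\<A> = {u, x, y, z}" using xyz(1) u by auto
  have ne: "x \<noteq> u" "y \<noteq> u" "z \<noteq> u" using xyz(1) by auto
  have z: "(j \<in> z) = (if \<eta> = 1 then (j \<in> x) = (j \<in> y) else (j \<in> x) \<noteq> (j \<in> y))" if "j \<in> {1..8}" for j
    using prod[OF that] xyz(2-4) unfolding xyz(1) by (auto split: if_splits)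
  define \<phi> where "\<phi> j = (j \<in> u, j \<in> x, j \<in> y)" for j
  have inj: "inj_on \<phi> {1..8}"
  proof (rule inj_onI, rule ccontr)
    fix j l :: nat assume jl: "j \<in> {1..8}" "l \<in> {1..8}" "\<phi> j = \<phi> l" "j \<noteq> l"
    then have "(j \<in> u) = (l \<in> u)" "(j \<in> x) = (l \<in> x)" "(j \<in> y) = (l \<in> y)" by (simp_all add: \<phi>_def)
    moreover from this have "(j \<in> z) = (l \<in> z)" using z[OF jl(1)] z[OF jl(2)] by simp
    ultimately have "(j \<in> A) = (l \<in> A)" if "A \<in> \<A>" for A using that unfolding \<A>' by blast
    then show False using splitting_matrix_distinct[OF M jl(1,2,4)] by (auto split: if_splits)
  qed
  have UNIV8: "card (UNIV :: (bool \<times> bool \<times> bool) set) = 8" by (simp flip: UNIV_Times_UNIV)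
  have im: "\<phi> ` {1..8} = UNIV"
    by (rule image_eq_if_card_eq[OF inj]) (simp_all add: UNIV8)
  define \<psi> where "\<psi> j = (j \<in> {1, 3, 5, 7}, j \<in> {1, 2, 3, 4}, j \<in> {1, 2, 5, 6})" for j :: nat
  have range8: "{1..8} = {1, 2, 3, 4, 5, 6, 7, 8 :: nat}" by auto
  have \<psi>: "inj_on \<psi> {1..8}" unfolding range8 by (simp add: \<psi>_def)
  define \<sigma> where "\<sigma> j = (if j \<in> {1..8} then the_inv_into {1..8} \<phi> (\<psi> j) else j)" for j
  have \<sigma>1: "\<phi> (\<sigma> j) = \<psi> j" "\<sigma> j \<in> {1..8}" if "j \<in> {1..8}" for j
    using that im f_the_inv_into_f[OF inj, of "\<psi> j"] the_inv_into_into[OF inj, of "\<psi> j" "{1..8}"]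
    by (auto simp: \<sigma>_def)
  have inj\<sigma>: "inj_on \<sigma> {1..8}"
    by (rule inj_onI) (metis \<sigma>1(1) \<psi> inj_onD)
  have "\<sigma> ` {1..8} = {1..8}"
    using \<sigma>1(2) by (intro image_eq_if_card_eq[OF inj\<sigma>]) auto
  with inj\<sigma> have \<sigma>: "\<sigma> permutes {1..8}"
    by (intro bij_imp_permutes) (auto simp: bij_betw_def \<sigma>_def)
  define f where "f A = (if A = u then {1, 3, 5, 7} else if A = x then {1, 2, 3, 4}
    else if A = y then {1, 2, 5, 6} else {3, 4, 5, 6 :: nat})" for A
  have f: "f u = {1, 3, 5, 7}" "f x = {1, 2, 3, 4}" "f y = {1, 2, 5, 6}" "f z = {3, 4, 5, 6}"
    using ne xyz(2-4) by (simp_all add: f_def)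
  show ?thesis
  proof (rule equivalent_familiesI[OF \<sigma> \<A>, of _ f])
    show "exceptional_family \<subseteq> Pow {1..8}" by (simp add: exceptional_family_def range8)
    show "f ` \<A> = exceptional_family" unfolding \<A>' by (auto simp: f exceptional_family_def)
  next
    fix A assume "A \<in> \<A>"
    have uxy: "\<sigma> j \<in> u \<longleftrightarrow> j \<in> f u" "\<sigma> j \<in> x \<longleftrightarrow> j \<in> f x" "\<sigma> j \<in> y \<longleftrightarrow> j \<in> f y" if "j \<in> {1..8}" for j
      using \<sigma>1(1)[OF that] unfolding f by (simp_all add: \<phi>_def \<psi>_def)
    have "\<forall>j\<in>{1..8}. j \<in> f z \<longleftrightarrow> (j \<in> f x) \<noteq> (j \<in> f y)"
      unfolding f range8 by simp
    then have "(\<forall>j\<in>{1..8}. \<sigma> j \<in> z \<longleftrightarrow> j \<in> f z) \<or> (\<forall>j\<in>{1..8}. \<sigma> j \<in> z \<longleftrightarrow> j \<notin> f z)"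
      using z[OF \<sigma>1(2)] uxy(2,3) by auto
    then show "(\<forall>j\<in>{1..8}. \<sigma> j \<in> A \<longleftrightarrow> j \<in> f A) \<or> (\<forall>j\<in>{1..8}. \<sigma> j \<in> A \<longleftrightarrow> j \<notin> f A)"
      using \<open>A \<in> \<A>\<close> uxy unfolding \<A>' by blast
  qed
qed

section \<open>Minimality and inequivalence of the exceptional family\<close>

text \<open>Splitting depends on a set only through its eight indicators, so all 256 sets are
  checked by cases.\<close>

lemma exceptional_family_signs:
  fixes b1 b2 b3 b4 b5 b6 b7 b8 :: nat
  assumes "b1 = 0 \<or> b1 = 1" "b2 = 0 \<or> b2 = 1" "b3 = 0 \<or> b3 = 1" "b4 = 0 \<or> b4 = 1"
    "b5 = 0 \<or> b5 = 1" "b6 = 0 \<or> b6 = 1" "b7 = 0 \<or> b7 = 1" "b8 = 0 \<or> b8 = 1"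
    and S: "S = b1 + (b2 + (b3 + (b4 + (b5 + (b6 + (b7 + b8))))))"
  shows "(b1 + (b2 + (b3 + b4)) = S div 2 \<or> b1 + (b2 + (b3 + b4)) = S - S div 2) \<or>
    (b1 + (b2 + (b5 + b6)) = S div 2 \<or> b1 + (b2 + (b5 + b6)) = S - S div 2) \<or>
    (b3 + (b4 + (b5 + b6)) = S div 2 \<or> b3 + (b4 + (b5 + b6)) = S - S div 2) \<or>
    (b1 + (b3 + (b5 + b7)) = S div 2 \<or> b1 + (b3 + (b5 + b7)) = S - S div 2)"
  using assms(1-8) unfolding S by (elim disjE; simp)

lemma splitting_family_exceptional: "splitting_family 8 exceptional_family"
  unfolding splitting_family_def
proof (intro conjI allI impI)
  have range8: "{1..8} = {1, 2, 3, 4, 5, 6, 7, 8 :: nat}" by auto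
  show "exceptional_family \<subseteq> Pow {1..8}" by (simp add: exceptional_family_def range8)
  fix B :: "nat set" assume B: "B \<subseteq> {1..8}"
  define b where "b j = (if j \<in> B then 1 else 0 :: nat)" for j
  have b: "b j = 0 \<or> b j = 1" for j by (simp add: b_def)
  have card: "card (A \<inter> B) = (\<Sum>j\<in>A. b j)" if "finite A" for A
    using that by (simp add: b_def flip: sum.inter_restrict)
  have "{1..8} \<inter> B = B" using B by blast
  then have S: "card B = b 1 + (b 2 + (b 3 + (b 4 + (b 5 + (b 6 + (b 7 + b 8))))))"
    using card[of "{1..8}"] unfolding range8 by simp
  have r1: "card ({1, 2, 3, 4} \<inter> B) = b 1 + (b 2 + (b 3 + b 4))" by (subst card) simp_all
  have r2: "card ({1, 2, 5, 6} \<inter> B) = b 1 + (b 2 + (b 5 + b 6))" by (subst card) simp_all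
  have r3: "card ({3, 4, 5, 6} \<inter> B) = b 3 + (b 4 + (b 5 + b 6))" by (subst card) simp_all
  have r4: "card ({1, 3, 5, 7} \<inter> B) = b 1 + (b 3 + (b 5 + b 7))" by (subst card) simp_all
  show "\<exists>A\<in>exceptional_family. splits A B"
    unfolding exceptional_family_def splits_iff
    using exceptional_family_signs[OF b b b b b b b b S] by (simp only: bex_simps r1 r2 r3 r4) simp
qed

lemma minimal_splitting_family_exceptional: "minimal_splitting_family 8 exceptional_family"
proof -
  have "card exceptional_family = 4" by code_simp
  moreover have "4 \<le> card \<B>" if "splitting_family 8 \<B>" for \<B>
    using splitting_family_card_ge[OF that] by simp
  ultimately show ?thesis using splitting_family_exceptional by (simp add: minimal_splitting_family_def)
qed

text \<open>Every member of the standard family separates 1 from 5, and the existence of a pair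
  separated by all members survives complements and permutations. No pair is separated by all of {1,
  2, 3, 4}, {1, 2, 5, 6} and {3, 4, 5, 6}, since the third is the symmetric difference of the first
  two.\<close>

lemma not_equivalent_exceptional_standard:
  "\<not> equivalent_families 8 exceptional_family (standard_splitting_family 8)"
proof
  assume "equivalent_families 8 exceptional_family (standard_splitting_family 8)"
  then obtain \<S> \<pi> where \<S>: "\<S> \<subseteq> exceptional_family" and \<pi>: "\<pi> permutes {1..8}"
    and eq: "standard_splitting_family 8 = image \<pi> ` ((exceptional_family - \<S>) \<union> (\<lambda>A. {1..8} - A) ` \<S>)"
    unfolding equivalent_families_def by (elim exE conjE) (rule that)
  have "{1..8 div 2} = {1, 2, 3, 4 :: nat}" by auto
  then have sep: "1 \<in> A \<longleftrightarrow> 5 \<notin> A" if "A \<in> standard_splitting_family 8" for A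
    using that by (auto simp: standard_splitting_family_def)
  have "1 \<in> \<pi> ` {1..8}" "5 \<in> \<pi> ` {1..8}" unfolding permutes_image[OF \<pi>] by simp_all
  then obtain p q where pq: "p \<in> {1..8}" "q \<in> {1..8}" "\<pi> p = 1" "\<pi> q = 5"
    by (elim imageE) auto
  have im: "1 \<in> \<pi> ` X \<longleftrightarrow> p \<in> X" "5 \<in> \<pi> ` X \<longleftrightarrow> q \<in> X" for X
    using inj_image_mem_iff[OF permutes_inj[OF \<pi>], of p X] inj_image_mem_iff[OF permutes_inj[OF \<pi>], of q X]
    by (simp_all add: pq(3,4))
  have sepE: "p \<in> A \<longleftrightarrow> q \<notin> A" if A: "A \<in> exceptional_family" for A
  proof (cases "A \<in> \<S>")
    case True
    then have "\<pi> ` ({1..8} - A) \<in> standard_splitting_family 8" unfolding eq by blast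
    from sep[OF this] show ?thesis unfolding im using pq by blast
  next
    case False
    then have "\<pi> ` A \<in> standard_splitting_family 8" unfolding eq using A by blast
    from sep[OF this] show ?thesis unfolding im .
  qed
  have "{1..8} = {1, 2, 3, 4, 5, 6, 7, 8 :: nat}" by auto
  then have "\<forall>j\<in>{1..8::nat}. (j \<in> {3, 4, 5, 6}) = ((j \<in> {1, 2, 3, 4}) \<noteq> (j \<in> {1, 2, 5, 6}))" by simp
  then have "(j \<in> {3, 4, 5, 6}) = ((j \<in> {1, 2, 3, 4}) \<noteq> (j \<in> {1, 2, 5, 6}))" if "j \<in> {p, q}" for j
    using pq(1,2) that by blast
  note parity = this[of p, OF insertI1] this[of q, OF insertI2[OF singletonI]]
  have "{1, 2, 3, 4} \<in> exceptional_family" "{1, 2, 5, 6} \<in> exceptional_family" "{3, 4, 5, 6} \<in> exceptional_family"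
    by (simp_all add: exceptional_family_def)
  from this[THEN sepE] show False using parity by argo
qed

theorem proposition2p2:
  shows "(\<forall>k \<A>. 1 \<le> k \<and> k \<le> 16 \<and> minimal_splitting_family k \<A>
            \<longrightarrow> uniform_splitting_family k \<A>) \<and>
         (minimal_splitting_family 8 exceptional_family \<and>
          \<not> equivalent_families 8 exceptional_family (standard_splitting_family 8) \<and>
          (\<forall>k \<A>. 1 \<le> k \<and> k \<le> 16 \<and> even k \<and> minimal_splitting_family k \<A> \<and>
                 \<not> equivalent_families k \<A> (standard_splitting_family k)
             \<longrightarrow> k = 8 \<and> equivalent_families k \<A> exceptional_family))"
proof (intro conjI allI impI)
  fix k \<A> assume "1 \<le> k \<and> k \<le> 16 \<and> minimal_splitting_family k \<A>"
  then show "uniform_splitting_family k \<A>" using minimal_splitting_family_uniform by simp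
next
  show "minimal_splitting_family 8 exceptional_family" by (rule minimal_splitting_family_exceptional)
  show "\<not> equivalent_families 8 exceptional_family (standard_splitting_family 8)"
    by (rule not_equivalent_exceptional_standard)
next
  fix k \<A>
  assume asm: "1 \<le> k \<and> k \<le> 16 \<and> even k \<and> minimal_splitting_family k \<A> \<and>
    \<not> equivalent_families k \<A> (standard_splitting_family k)"
  then have k: "0 < k" "k \<le> 16" "even k" and min: "minimal_splitting_family k \<A>"
    and ne: "\<not> equivalent_families k \<A> (standard_splitting_family k)" by simp_all
  have card: "k = 2 * card \<A>" using minimal_splitting_family_card[OF min k(1)] k(3) by (auto elim!: evenE)
  have \<A>: "\<A> \<subseteq> Pow {1..k}"
    using min unfolding minimal_splitting_family_def splitting_family_def by blast
  note M = splitting_matrix_if_minimal[OF min k(3,1)]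
  have "\<not> standard_matrix \<A> {1..k} (\<lambda>A j. if j \<in> A then 1 else - 1 :: int) d \<rho>" for d \<rho>
    using equivalent_families_if_standard_matrix[OF \<A> card k(1)] ne by blast
  moreover have "\<A> \<noteq> {}" "card \<A> \<le> 8" using card k(1,2) by auto
  ultimately have ex: "exceptional_matrix \<A> {1..k} (\<lambda>A j. if j \<in> A then 1 else - 1 :: int)"
    using splitting_matrix_cases[OF M] by blast
  then have "card \<A> = 4" by (simp add: exceptional_matrix_def)
  then have k8: "k = 8" using card by simp
  show "k = 8" by (rule k8)
  show "equivalent_families k \<A> exceptional_family"
    unfolding k8
    by (rule equivalent_families_if_exceptional_matrix[OF M[unfolded k8] \<A>[unfolded k8] ex[unfolded k8]])
qed

end
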